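(* Let $X$ be a Banach space, $K\subseteq X$ a closed cone with $K\cap(-K)=\{0\}$ and nonempty interior $\mathring K$, let $U\subseteq X$ be an affine space intersecting $K^+=K\setminus\{0\}$ transversely, let $E=\mathring K\cap U$, and assume that $(E,d_H)$ is a complete metric space, where $d_H$ is Hilbert's projective distance. Let $(\Omega,\mathcal F,\mathbb P,\vartheta)$ be an ergodic invertible metric discrete dynamical system and let $A:\Omega\to\mathcal L(X)$ be a random variable such that $A(\omega)$ is a positive operator for every $\omega\in\Omega$ and $$\mathbb P\big(A\in\mathcal L_{\mathrm{cp}}(X)\big)>0 .$$ Let $\varphi_0(\omega)=\mathrm{Id}$, $\varphi_n(\omega)=A(\vartheta^{n-1}\omega)\cdots A(\vartheta\omega)A(\omega)$ for $n\ge 1$, and let $\varphi^\pi_n(\omega):E\to E$ be the associated projective action. Then there exist a $\vartheta$-invariant set $\widetilde\Omega\subseteq\Omega$ of full $\mathbb P$-measure and a random variable $u:\Omega\to E$ such that: (i) For all $\omega\in\widetilde\Omega$: $$\limsup_{n\to\infty}\Big[\frac1n\sup_{f,g\in E}\log d_H\big(\varphi_n^\pi(\omega)f,\varphi_n^\pi(\omega)g\big)\Big]\le \mathbb E\log\big(\tau(A)\big)<0 .$$ (ii) $u$ is measurable with respect to the $\sigma$-field $\mathcal F^-=\sigma\big((A(\vartheta^{-n}\cdot))_{n\in\mathbb N}\big)$, $\mathbb N=\{1,2,\dots\}$, and $\varphi_n^\pi(\omega)u(\omega)=u(\vartheta^n\omega)$ for all $\omega\in\widetilde\Omega$, $n\in\mathbb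 N$. (iii) For all $\omega\in\widetilde\Omega$: $$\limsup_{n\to\infty}\Big[\frac1n\sup_{f\in E}\log d_H\big(\varphi_n^\pi(\vartheta^{-n}\omega)f,u(\omega)\big)\Big]\le\mathbb E\log\big(\tau(A)\big)<0,$$ $$\limsup_{n\to\infty}\Big[\frac1n\sup_{f\in E}\log d_H\big(\varphi_n^\pi(\omega)f,u(\vartheta^n\omega)\big)\Big]\le\mathbb E\log\big(\tau(A)\big)<0 .$$ (iv) The measure $\delta_{u(\omega)}(\mathrm df)\,\mathbb P(\mathrm d\omega)$ is the unique invariant measure for the random dynamical system $\varphi^\pi$ on $E$.
   Context: Order: for $x,y\in X$, $x\le y$ iff $y-x\in K$. For $x,y\in K^+$ let $M(x,y)=\inf\{\lambda\ge0: x\le\lambda y\}$ (with $\inf\emptyset=\infty$), $m(x,y)=\sup\{\mu\ge0:\mu y\le x\}$, and define Hilbert's projective distance $d_H(x,y)=\log M(x,y)-\log m(x,y)\in[0,\infty]$. $U$ intersects $K^+$ transversely if for every $x\in K^+$ there is a unique $\lambda=\lambda(x)>0$ with $\lambda x\in U$. $(E,d_H)$ is then a metric space. $A\in\mathcal L(X)$ (bounded linear operators on $X$) is positive if $A(\mathring K)\subseteq\mathring K$. Its projective action is $A^\pi:E\to E$, $A^\pi x$ = the unique positive multiple of $Ax$ lying in $U$. The projective norm is $$\tau(A)=\sup_{x\ne y\in E}\frac{d_H(A^\pi x,A^\pi y)}{d_H(x,y)}\in[0,1].$$ $\mathcal L_{\mathrm{cp}}(X)$ is the set of positive $A\in\mathcal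 L(X)$ with $\tau(A)<1$. The value $\mathbb E\log\tau(A)=-\infty$ is allowed; $\log 0=-\infty$. An invertible metric discrete dynamical system (IDS) $(\Omega,\mathcal F,\mathbb P,\vartheta)$ is a probability space with a measurable map $\vartheta:\mathbb Z\times\Omega\to\Omega$, written $\vartheta^z=\vartheta(z,\cdot)$, with $\vartheta^{z+z'}=\vartheta^z\circ\vartheta^{z'}$, $\vartheta^0=\mathrm{Id}$, and $\mathbb P$ invariant under every $\vartheta^z$. A set $\widetilde\Omega$ is $\vartheta$-invariant if $\vartheta^z\widetilde\Omega=\widetilde\Omega$ for all $z\in\mathbb Z$. The IDS is ergodic if every invariant measurable set has probability $0$ or $1$. A probability measure $\mu$ on $\Omega\times E$ is invariant for $\varphi^\pi$ if its marginal on $\Omega$ is $\mathbb P$ and it is invariant under $\Theta_n(\omega,x)=(\vartheta^n\omega,\varphi_n^\pi(\omega)x)$ for all $n$.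
   Formalization: Added assumption: (ω,f) ↦ A^π(ω)f is jointly measurable for σ(A)⊗B(E). It is automatic for separable X; for non-separable X the maps Θ_n may otherwise fail to be measurable, so that invariance of a measure under φ^π is undefined. Also K ≠ {0}. *)

theory Defs
  imports "HOL-Probability.Probability"
begin

section \<open>Extended logarithm and expectation\<close>

definition ext_ln :: "ennreal \<Rightarrow> ereal" where
  "ext_ln x = (if x = 0 then - \<infinity> else if x = \<infinity> then \<infinity> else ereal (ln (enn2real x)))"

text \<open>Positive part minus negative part (\<^const>\<open>e2ennreal\<close> truncates negative values to 0), so that
  the value \<open>-\<infinity>\<close> is possible.\<close>

definition ereal_expectation :: "'w measure \<Rightarrow> ('w \<Rightarrow> ereal) \<Rightarrow> ereal" where
  "ereal_expectation M Y =
     enn2ereal (\<integral>\<^sup>+\<omega>. e2ennreal (Y \<omega>) \<partial>M) - enn2ereal (\<integral>\<^sup>+\<omega>. e2ennreal (- Y \<omega>) \<partial>M)"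

section \<open>Cones and Hilbert's projective distance\<close>

definition closed_cone :: "'x::real_normed_vector set \<Rightarrow> bool" where
  "closed_cone K \<longleftrightarrow> closed K \<and> convex K \<and> cone K"

definition cone_le :: "'x::real_vector set \<Rightarrow> 'x \<Rightarrow> 'x \<Rightarrow> bool" where
  "cone_le K x y \<longleftrightarrow> y - x \<in> K"

definition cone_M :: "'x::real_vector set \<Rightarrow> 'x \<Rightarrow> 'x \<Rightarrow> ennreal" where
  "cone_M K x y = Inf {ennreal s |s. 0 \<le> s \<and> cone_le K x (s *\<^sub>R y)}"

definition cone_m :: "'x::real_vector set \<Rightarrow> 'x \<Rightarrow> 'x \<Rightarrow> ennreal" where
  "cone_m K x y = Sup {ennreal s |s. 0 \<le> s \<and> cone_le K (s *\<^sub>R y) x}"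

definition hilbert_dist :: "'x::real_vector set \<Rightarrow> 'x \<Rightarrow> 'x \<Rightarrow> ereal" where
  "hilbert_dist K x y = ext_ln (cone_M K x y) - ext_ln (cone_m K x y)"

definition intersects_transversely :: "'x::real_vector set \<Rightarrow> 'x set \<Rightarrow> bool" where
  "intersects_transversely U K \<longleftrightarrow> (\<forall>x\<in>K - {0}. \<exists>!s. 0 < s \<and> s *\<^sub>R x \<in> U)"

definition cone_section :: "'x::real_normed_vector set \<Rightarrow> 'x set \<Rightarrow> 'x set" where
  "cone_section K U = interior K \<inter> U"

text \<open>On the section \<open>E\<close> the distance is finite; this is the real-valued metric there.\<close>

definition hilbert_metric :: "'x::real_vector set \<Rightarrow> 'x \<Rightarrow> 'x \<Rightarrow> real" where
  "hilbert_metric K x y = real_of_ereal (hilbert_dist K x y)"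

definition hilbert_borel :: "'x::real_normed_vector set \<Rightarrow> 'x set \<Rightarrow> 'x measure" where
  "hilbert_borel K U = sigma (cone_section K U)
     {W. openin (Metric_space.mtopology (cone_section K U) (hilbert_metric K)) W}"

section \<open>Positive operators\<close>

definition positive_op :: "'x::real_normed_vector set \<Rightarrow> ('x \<Rightarrow>\<^sub>L 'x) \<Rightarrow> bool" where
  "positive_op K T \<longleftrightarrow> blinfun_apply T ` interior K \<subseteq> interior K"

definition proj_action :: "'x::real_normed_vector set \<Rightarrow> ('x \<Rightarrow>\<^sub>L 'x) \<Rightarrow> 'x \<Rightarrow> 'x" where
  "proj_action U T x = (THE y. y \<in> U \<and> (\<exists>c>0. y = c *\<^sub>R blinfun_apply T x))"

text \<open>The supremum is taken in \<open>[0,\<infinity>]\<close>, hence is 0 if \<open>E\<close> is a single point.\<close>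

definition proj_norm :: "'x::real_normed_vector set \<Rightarrow> 'x set \<Rightarrow> ('x \<Rightarrow>\<^sub>L 'x) \<Rightarrow> ennreal" where
  "proj_norm K U T =
     (SUP (x, y)\<in>{(x, y). x \<in> cone_section K U \<and> y \<in> cone_section K U \<and> x \<noteq> y}.
        e2ennreal (hilbert_dist K (proj_action U T x) (proj_action U T y))
          / e2ennreal (hilbert_dist K x y))"

definition contracting_ops :: "'x::real_normed_vector set \<Rightarrow> 'x set \<Rightarrow> ('x \<Rightarrow>\<^sub>L 'x) set" where
  "contracting_ops K U = {T. positive_op K T \<and> proj_norm K U T < 1}"

section \<open>Dynamical systems\<close>

definition flow_invariant :: "(int \<Rightarrow> 'w \<Rightarrow> 'w) \<Rightarrow> 'w set \<Rightarrow> bool" where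
  "flow_invariant \<theta> S \<longleftrightarrow> (\<forall>z. \<theta> z ` S = S)"

definition invertible_ds :: "'w measure \<Rightarrow> (int \<Rightarrow> 'w \<Rightarrow> 'w) \<Rightarrow> bool" where
  "invertible_ds M \<theta> \<longleftrightarrow>
     prob_space M \<and>
     (\<lambda>(z, \<omega>). \<theta> z \<omega>) \<in> measurable (count_space UNIV \<Otimes>\<^sub>M M) M \<and>
     (\<forall>z z'. \<forall>\<omega>\<in>space M. \<theta> (z + z') \<omega> = \<theta> z (\<theta> z' \<omega>)) \<and>
     (\<forall>\<omega>\<in>space M. \<theta> 0 \<omega> = \<omega>) \<and>
     (\<forall>z. distr M M (\<theta> z) = M)"

definition ergodic_ds :: "'w measure \<Rightarrow> (int \<Rightarrow> 'w \<Rightarrow> 'w) \<Rightarrow> bool" where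
  "ergodic_ds M \<theta> \<longleftrightarrow> invertible_ds M \<theta> \<and>
     (\<forall>S\<in>sets M. flow_invariant \<theta> S \<longrightarrow> measure M S = 0 \<or> measure M S = 1)"

primrec cocycle ::
  "(int \<Rightarrow> 'w \<Rightarrow> 'w) \<Rightarrow> ('w \<Rightarrow> 'x::real_normed_vector \<Rightarrow>\<^sub>L 'x) \<Rightarrow> nat \<Rightarrow> 'w \<Rightarrow> 'x \<Rightarrow>\<^sub>L 'x" where
  "cocycle \<theta> A 0 \<omega> = id_blinfun"
| "cocycle \<theta> A (Suc n) \<omega> = A (\<theta> (int n) \<omega>) o\<^sub>L cocycle \<theta> A n \<omega>"

definition proj_cocycle ::
  "'x::real_normed_vector set \<Rightarrow> (int \<Rightarrow> 'w \<Rightarrow> 'w) \<Rightarrow> ('w \<Rightarrow> 'x \<Rightarrow>\<^sub>L 'x) \<Rightarrow> nat \<Rightarrow> 'w \<Rightarrow> 'x \<Rightarrow> 'x" where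
  "proj_cocycle U \<theta> A n \<omega> = proj_action U (cocycle \<theta> A n \<omega>)"

definition past_sigma ::
  "'w measure \<Rightarrow> (int \<Rightarrow> 'w \<Rightarrow> 'w) \<Rightarrow> ('w \<Rightarrow> 'x::real_normed_vector \<Rightarrow>\<^sub>L 'x) \<Rightarrow> 'w measure" where
  "past_sigma M \<theta> A = sigma (space M)
     {(\<lambda>\<omega>. A (\<theta> (- int n) \<omega>)) -` B \<inter> space M |n B. 1 \<le> n \<and> B \<in> sets borel}"

text \<open>Measurability of the random dynamical system generated by \<open>A\<close> on \<open>E\<close>: the map
  \<open>(\<omega>, f) \<mapsto> A\<^sup>\<pi>(\<omega>) f\<close> is jointly measurable, where \<open>\<Omega>\<close> carries the \<open>\<sigma>\<close>-field generated by \<open>A\<close>.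
  For a Borel map \<open>A\<close> with positive values this is automatic if the space is separable (lemma
  \<open>measurable_action_separable\<close> below); it is needed in general since neither the composition of operators nor the evaluation
  \<open>(T, x) \<mapsto> T x\<close> need be measurable for the product of the Borel \<open>\<sigma>\<close>-fields of non-separable
  spaces.\<close>

definition measurable_action ::
  "'x::real_normed_vector set \<Rightarrow> 'x set \<Rightarrow> 'w measure \<Rightarrow> ('w \<Rightarrow> 'x \<Rightarrow>\<^sub>L 'x) \<Rightarrow> bool" where
  "measurable_action K U M A \<longleftrightarrow>
     (\<lambda>(\<omega>, f). proj_action U (A \<omega>) f)
       \<in> measurable (vimage_algebra (space M) A borel \<Otimes>\<^sub>M hilbert_borel K U) (hilbert_borel K U)"

definition skew_product ::
  "'x::real_normed_vector set \<Rightarrow> (int \<Rightarrow> 'w \<Rightarrow> 'w) \<Rightarrow> ('w \<Rightarrow> 'x \<Rightarrow>\<^sub>L 'x) \<Rightarrow> nat \<Rightarrow> 'w \<times> 'x \<Rightarrow> 'w \<times> 'x" where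
  "skew_product U \<theta> A n = (\<lambda>(\<omega>, x). (\<theta> (int n) \<omega>, proj_cocycle U \<theta> A n \<omega> x))"

definition rds_invariant ::
  "'x::real_normed_vector set \<Rightarrow> 'x set \<Rightarrow> 'w measure \<Rightarrow> (int \<Rightarrow> 'w \<Rightarrow> 'w) \<Rightarrow> ('w \<Rightarrow> 'x \<Rightarrow>\<^sub>L 'x)
     \<Rightarrow> ('w \<times> 'x) measure \<Rightarrow> bool" where
  "rds_invariant K U M \<theta> A \<mu> \<longleftrightarrow>
     prob_space \<mu> \<and> sets \<mu> = sets (M \<Otimes>\<^sub>M hilbert_borel K U) \<and>
     distr \<mu> M fst = M \<and>
     (\<forall>n. distr \<mu> \<mu> (skew_product U \<theta> A n) = \<mu>)"

text \<open>The measure \<open>\<delta>\<^bsub>u(\<omega>)\<^esub>(df) P(d\<omega>)\<close> on \<open>\<Omega> \<times> E\<close>.\<close>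

definition dirac_disintegration ::
  "'x::real_normed_vector set \<Rightarrow> 'x set \<Rightarrow> 'w measure \<Rightarrow> ('w \<Rightarrow> 'x) \<Rightarrow> ('w \<times> 'x) measure" where
  "dirac_disintegration K U M u =
     measure_of (space M \<times> cone_section K U) (sets (M \<Otimes>\<^sub>M hilbert_borel K U))
       (\<lambda>C. \<integral>\<^sup>+\<omega>. emeasure (return (hilbert_borel K U) (u \<omega>)) (Pair \<omega> -` C) \<partial>M)"

section \<open>Joint measurability is automatic in separable spaces\<close>

lemma ext_ln_ennreal: "0 < a \<Longrightarrow> ext_ln (ennreal a) = ereal (ln a)"
  by (auto simp: ext_ln_def)

lemma ext_ln_mono: "x \<le> y \<Longrightarrow> ext_ln x \<le> ext_ln y"
proof -
  assume xy: "x \<le> y"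
  show ?thesis
  proof (cases "x = 0 \<or> y = \<infinity>")
    case True then show ?thesis using xy by (auto simp: ext_ln_def)
  next
    case False
    then have y: "y < top" and x: "x < top" "0 < x" "0 < y" using xy 
      by (auto simp: less_top top_unique zero_less_iff_neq_zero)
    then have "0 < enn2real x" "enn2real x \<le> enn2real y"
      using xy by (auto simp: enn2real_positive_iff enn2real_mono)
    then show ?thesis using x y by (auto simp: ext_ln_def)
  qed
qed

lemma closed_coneD:
  assumes "closed_cone K"
  shows "x \<in> K \<Longrightarrow> y \<in> K \<Longrightarrow> x + y \<in> K" "x \<in> K \<Longrightarrow> 0 \<le> c \<Longrightarrow> c *\<^sub>R x \<in> K"
  using assms convex_cone[of K] by (auto simp: closed_cone_def cone_def)

lemma interior_absorbing:
  fixes K :: "'x::real_normed_vector set"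
  assumes "x \<in> interior K" 
  shows "\<exists>a>0. x - a *\<^sub>R y \<in> K"
proof -
  have "((\<lambda>a. x - a *\<^sub>R y) \<longlongrightarrow> x - 0 *\<^sub>R y) (at_right 0)" by (intro tendsto_intros)
  then have "\<forall>\<^sub>F a in at_right (0::real). x - a *\<^sub>R y \<in> interior K"
    using assms by (auto simp: tendsto_def)
  moreover have "\<forall>\<^sub>F a in at_right (0::real). 0 < a" by (simp add: eventually_at_right_less)
  ultimately have "\<forall>\<^sub>F a in at_right (0::real). 0 < a \<and> x - a *\<^sub>R y \<in> interior K" by eventually_elim auto
  then show ?thesis using interior_subset eventually_happens[of _ "at_right (0::real)"]
    by (metis (mono_tags, lifting) subsetD trivial_limit_at_right_real)
qed

lemma interior_nonzero:
  fixes K :: "'x::real_normed_vector set"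
  assumes K: "closed_cone K" "K \<inter> uminus ` K = {0}" "K - {0} \<noteq> {}"
  shows "0 \<notin> interior K"
proof
  assume "0 \<in> interior K"
  obtain z where z: "z \<in> K" "z \<noteq> 0" using K(3) by auto
  obtain a where "a > 0" "0 - a *\<^sub>R z \<in> K" using interior_absorbing[OF \<open>0 \<in> interior K\<close>] by blast
  then have "(1/a) *\<^sub>R (0 - a *\<^sub>R z) \<in> K" by (intro closed_coneD(2)[OF K(1)]) auto
  then have "- z \<in> K" using \<open>a > 0\<close> by simp
  then have "z \<in> uminus ` K" by (metis add.inverse_inverse imageI)
  then show False using z K(2) by auto
qed

lemma hilbert_dist_bounds:
  fixes K :: "'x::real_normed_vector set"
  assumes K: "closed_cone K" "K \<inter> uminus ` K = {0}" "K - {0} \<noteq> {}"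
    and x: "x \<in> interior K" and y: "y \<in> interior K"
  obtains M' m' where "0 < M'" "0 < m'" "cone_M K x y = ennreal M'" "cone_m K x y = ennreal m'"
    "hilbert_dist K x y = ereal (ln M' - ln m')"
proof -
  have order: "s \<le> t" if st: "t *\<^sub>R y - x \<in> K" "x - s *\<^sub>R y \<in> K" for s t
  proof (rule ccontr)
    assume "\<not> s \<le> t"
    have "(t - s) *\<^sub>R y \<in> K" using closed_coneD(1)[OF K(1) st] by (simp add: algebra_simps)
    then have "(1/(s - t)) *\<^sub>R ((t - s) *\<^sub>R y) \<in> K" 
      by (rule closed_coneD(2)[OF K(1)]) (use \<open>\<not> s \<le> t\<close> in simp)
    moreover have "(1/(s - t)) *\<^sub>R ((t - s) *\<^sub>R y) = - y" 
    proof -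
      have "(t - s) / (s - t) = -1" using \<open>\<not> s \<le> t\<close> by (simp add: divide_simps)
      then show ?thesis by simp
    qed
    ultimately have "y \<in> uminus ` K" by (metis add.inverse_inverse imageI)
    then have "y = 0" using y K(2) interior_subset[of K] by auto
    then show False using y interior_nonzero[OF K] by simp
  qed
  obtain a where a: "a > 0" "x - a *\<^sub>R y \<in> K" using interior_absorbing[OF x] by blast
  obtain b where b: "b > 0" "y - b *\<^sub>R x \<in> K" using interior_absorbing[OF y] by blast
  have "(1/b) *\<^sub>R (y - b *\<^sub>R x) \<in> K" using b closed_coneD(2)[OF K(1)] by simp
  then have t: "(1/b) *\<^sub>R y - x \<in> K" using b by (simp add: algebra_simps)
  have M1: "cone_M K x y \<le> ennreal (1/b)" unfolding cone_M_def
    by (rule Inf_lower) (use t b in \<open>auto simp: cone_le_def\<close>)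
  have m1: "ennreal a \<le> cone_m K x y" unfolding cone_m_def
    by (rule Sup_upper) (use a in \<open>auto simp: cone_le_def\<close>)
  have M2: "ennreal a \<le> cone_M K x y" unfolding cone_M_def
    by (rule Inf_greatest) (use a order in \<open>auto simp: cone_le_def intro!: ennreal_leI\<close>)
  have m2: "cone_m K x y \<le> ennreal (1/b)" unfolding cone_m_def
    by (rule Sup_least) (use t order in \<open>auto simp: cone_le_def intro!: ennreal_leI\<close>)
  obtain M' where M': "cone_M K x y = ennreal M'" "0 \<le> M'" using M1 by (cases "cone_M K x y") (auto simp: top_unique)
  obtain m' where m': "cone_m K x y = ennreal m'" "0 \<le> m'" using m2 by (cases "cone_m K x y") (auto simp: top_unique)
  have "0 < M'" "0 < m'" using M2 m1 M' m' a by (auto simp: ennreal_le_iff)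
  then show thesis using that M' m' by (auto simp: hilbert_dist_def ext_ln_ennreal)
qed

lemma hilbert_metric_less_iff:
  fixes K :: "'x::real_normed_vector set"
  assumes K: "closed_cone K" "K \<inter> uminus ` K = {0}" "K - {0} \<noteq> {}"
    and x: "x \<in> interior K" and y: "y \<in> interior K"
  shows "hilbert_metric K x y < r \<longleftrightarrow>
    (\<exists>a b. 0 < a \<and> 0 < b \<and> x - a *\<^sub>R y \<in> K \<and> b *\<^sub>R y - x \<in> K \<and> ln b - ln a < r)"
proof -
  obtain M' m' where Mm: "0 < M'" "0 < m'" "cone_M K x y = ennreal M'" "cone_m K x y = ennreal m'"
    "hilbert_dist K x y = ereal (ln M' - ln m')" using hilbert_dist_bounds[OF K x y] .
  have d: "hilbert_metric K x y = ln M' - ln m'" using Mm by (simp add: hilbert_metric_def)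
  show ?thesis
  proof
    assume "hilbert_metric K x y < r"
    define e where "e = (r - (ln M' - ln m')) / 2"
    have e: "e > 0" using d \<open>_ < r\<close> by (simp add: e_def)
    have "cone_M K x y < ennreal (M' * exp e)" using Mm e by (simp add: ennreal_less_iff)
    then obtain b where b: "0 \<le> b" "b *\<^sub>R y - x \<in> K" "ennreal b < ennreal (M' * exp e)"
      unfolding cone_M_def Inf_less_iff by (auto simp: cone_le_def)
    have "ennreal (m' * exp (- e)) < cone_m K x y" using Mm e by (simp add: ennreal_less_iff)
    then obtain a where a: "0 \<le> a" "x - a *\<^sub>R y \<in> K" "ennreal (m' * exp (- e)) < ennreal a"
      unfolding cone_m_def less_Sup_iff by (auto simp: cone_le_def)
    have "cone_M K x y \<le> ennreal b" unfolding cone_M_def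
      by (rule Inf_lower) (use b in \<open>auto simp: cone_le_def\<close>)
    then have b0: "0 < b" using Mm b by (auto simp: ennreal_le_iff)
    have "m' * exp (- e) < a" using a Mm by (auto simp: ennreal_less_iff)
    then have a0: "0 < a" and "ln m' - e < ln a"
      using Mm apply (smt (verit) exp_gt_zero mult_pos_pos)
      using Mm \<open>m' * exp (- e) < a\<close> by (smt (verit) exp_gt_zero ln_exp ln_less_cancel_iff ln_mult_pos mult_pos_pos)
    have "b < M' * exp e" using b Mm by (auto simp: ennreal_less_iff)
    then have "ln b < ln M' + e" using Mm b0
      by (smt (verit) exp_gt_zero ln_exp ln_less_cancel_iff ln_mult_pos mult_pos_pos)
    then show "\<exists>a b. 0 < a \<and> 0 < b \<and> x - a *\<^sub>R y \<in> K \<and> b *\<^sub>R y - x \<in> K \<and> ln b - ln a < r"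
      using a b a0 b0 \<open>ln m' - e < ln a\<close> by (intro exI[of _ a] exI[of _ b]) (auto simp: e_def field_simps)
  next
    assume "\<exists>a b. 0 < a \<and> 0 < b \<and> x - a *\<^sub>R y \<in> K \<and> b *\<^sub>R y - x \<in> K \<and> ln b - ln a < r"
    then obtain a b where ab: "0 < a" "0 < b" "x - a *\<^sub>R y \<in> K" "b *\<^sub>R y - x \<in> K" "ln b - ln a < r" by blast
    have "cone_M K x y \<le> ennreal b" unfolding cone_M_def
      by (rule Inf_lower) (use ab in \<open>auto simp: cone_le_def\<close>)
    moreover have "ennreal a \<le> cone_m K x y" unfolding cone_m_def
      by (rule Sup_upper) (use ab in \<open>auto simp: cone_le_def\<close>)
    ultimately have "M' \<le> b" "a \<le> m'" using Mm ab by (auto simp: ennreal_le_iff)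
    then have "ln M' \<le> ln b" "ln a \<le> ln m'" using Mm ab by auto
    then show "hilbert_metric K x y < r" using d ab by linarith
  qed
qed

lemma proj_action_props:
  fixes K :: "'x::real_normed_vector set"
  assumes K: "closed_cone K" "K \<inter> uminus ` K = {0}" "K - {0} \<noteq> {}"
    and U: "intersects_transversely U K" and T: "positive_op K T" and x: "x \<in> interior K"
  shows "\<exists>c>0. proj_action U T x = c *\<^sub>R T x" and "proj_action U T x \<in> cone_section K U"
proof -
  have Tx: "T x \<in> interior K" using T x by (auto simp: positive_op_def)
  then have "T x \<in> K - {0}" using interior_nonzero[OF K] interior_subset[of K] by auto
  then have ex: "\<exists>!s. 0 < s \<and> s *\<^sub>R T x \<in> U" using U by (auto simp: intersects_transversely_def)
  then obtain s where s: "0 < s" "s *\<^sub>R T x \<in> U" by blast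
  have *: "proj_action U T x = s *\<^sub>R T x" unfolding proj_action_def
    by (rule the_equality) (use s ex in auto)
  then show "\<exists>c>0. proj_action U T x = c *\<^sub>R T x" using s by auto
  have "(\<lambda>y. s *\<^sub>R y) ` interior K \<subseteq> interior K"
  proof (rule interior_maximal)
    show "open ((\<lambda>y. s *\<^sub>R y) ` interior K)" using s by (intro open_scaling) auto
    show "(\<lambda>y. s *\<^sub>R y) ` interior K \<subseteq> K" using closed_coneD(2)[OF K(1)] s interior_subset[of K] by force
  qed
  then show "proj_action U T x \<in> cone_section K U" using * s Tx by (auto simp: cone_section_def)
qed

lemma positive_op_cone:
  fixes K :: "'x::real_normed_vector set"
  assumes K: "closed_cone K" "interior K \<noteq> {}" and T: "positive_op K T" and "x \<in> K"
  shows "T x \<in> K"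
proof -
  obtain e where e: "e \<in> interior K" using K by auto
  have add: "T x + q *\<^sub>R T e \<in> K" if "0 < q" for q
  proof -
    have "(\<lambda>y. x + q *\<^sub>R y) ` interior K \<subseteq> interior K"
    proof (rule interior_maximal)
      have "(\<lambda>y. x + q *\<^sub>R y) ` interior K = (+) x ` (\<lambda>y. q *\<^sub>R y) ` interior K" by auto
      then show "open ((\<lambda>y. x + q *\<^sub>R y) ` interior K)"
        using that by (simp add: open_translation open_scaling)
      show "(\<lambda>y. x + q *\<^sub>R y) ` interior K \<subseteq> K"
        using closed_coneD[OF K(1)] that \<open>x \<in> K\<close> interior_subset[of K] by (force simp: subset_iff)
    qed
    then have "T (x + q *\<^sub>R e) \<in> interior K" using T e by (auto simp: positive_op_def)
    then show ?thesis using interior_subset[of K] by (auto simp: blinfun.add_right blinfun.scaleR_right)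
  qed
  have "((\<lambda>q. T x + q *\<^sub>R T e) \<longlongrightarrow> T x + 0 *\<^sub>R T e) (at_right 0)" by (intro tendsto_intros)
  moreover have "\<forall>\<^sub>F q in at_right (0::real). T x + q *\<^sub>R T e \<in> K"
    using eventually_at_right_less[of "0::real"] by eventually_elim (rule add)
  ultimately have "T x + 0 *\<^sub>R T e \<in> K"
    using K(1) Lim_in_closed_set[of K _ "at_right (0::real)"] by (simp add: closed_cone_def)
  then show ?thesis by simp
qed

lemma proj_action_nonexpansive:
  fixes K :: "'x::real_normed_vector set"
  assumes K: "closed_cone K" "K \<inter> uminus ` K = {0}" "K - {0} \<noteq> {}" "interior K \<noteq> {}"
    and U: "intersects_transversely U K" and T: "positive_op K T"
    and x: "x \<in> cone_section K U" and y: "y \<in> cone_section K U"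
  shows "hilbert_metric K (proj_action U T x) (proj_action U T y) \<le> hilbert_metric K x y"
proof (rule dense_ge)
  fix r assume "hilbert_metric K x y < r"
  have xy: "x \<in> interior K" "y \<in> interior K" using x y by (auto simp: cone_section_def)
  obtain a b where ab: "0 < a" "0 < b" "x - a *\<^sub>R y \<in> K" "b *\<^sub>R y - x \<in> K" "ln b - ln a < r"
    using hilbert_metric_less_iff[OF K(1-3) xy] \<open>_ < r\<close> by blast
  obtain c where c: "c > 0" "proj_action U T x = c *\<^sub>R T x" using proj_action_props[OF K(1-3) U T xy(1)] by auto
  obtain c' where c': "c' > 0" "proj_action U T y = c' *\<^sub>R T y" using proj_action_props[OF K(1-3) U T xy(2)] by auto
  have int: "proj_action U T x \<in> interior K" "proj_action U T y \<in> interior K" 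
    using proj_action_props[OF K(1-3) U T] xy by (auto simp: cone_section_def)
  have "T (x - a *\<^sub>R y) \<in> K" "T (b *\<^sub>R y - x) \<in> K" using positive_op_cone[OF K(1,4) T] ab by auto
  then have "c *\<^sub>R T (x - a *\<^sub>R y) \<in> K" "c *\<^sub>R T (b *\<^sub>R y - x) \<in> K" using closed_coneD(2)[OF K(1)] c by auto
  then have "proj_action U T x - (a * c / c') *\<^sub>R proj_action U T y \<in> K" 
    "(b * c / c') *\<^sub>R proj_action U T y - proj_action U T x \<in> K"
    using c c' by (auto simp: blinfun.diff_right blinfun.scaleR_right algebra_simps)
  moreover have "ln (b * c / c') - ln (a * c / c') < r" using ab c c' by (simp add: ln_mult_pos ln_div)
  ultimately have "hilbert_metric K (proj_action U T x) (proj_action U T y) < r"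
    unfolding hilbert_metric_less_iff[OF K(1-3) int]
    using ab c c' by (intro exI[of _ "a * c / c'"] exI[of _ "b * c / c'"]) auto
  then show "hilbert_metric K (proj_action U T x) (proj_action U T y) \<le> r" by simp
qed

lemma hilbert_small:
  fixes K :: "'x::real_normed_vector set"
  assumes K: "closed_cone K" "K \<inter> uminus ` K = {0}" "K - {0} \<noteq> {}"
    and y: "y \<in> interior K" and "0 < r"
  shows "\<exists>e>0. \<forall>x c c'. dist x y < e \<longrightarrow> 0 < c \<longrightarrow> 0 < c' \<longrightarrow> c *\<^sub>R x \<in> interior K \<longrightarrow> c' *\<^sub>R y \<in> interior K
     \<longrightarrow> hilbert_metric K (c *\<^sub>R x) (c' *\<^sub>R y) < r"
proof -
  obtain e where e: "e > 0" "ball y e \<subseteq> K" using y mem_interior by blast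
  have "((\<lambda>q. ln (1 + q) - ln (1 - q)) \<longlongrightarrow> ln (1 + 0) - ln (1 - 0)) (at_right (0::real))"
    by (intro tendsto_intros) auto
  then have "\<forall>\<^sub>F q in at_right (0::real). ln (1 + q) - ln (1 - q) < r" using \<open>0 < r\<close>
    by (auto intro: order_tendstoD)
  moreover have "\<forall>\<^sub>F q in at_right (0::real). 0 < q \<and> q < 1" by (simp add: eventually_at_right_real eventually_at_right[of 0 1] exI[of _ 1])
  ultimately have "\<forall>\<^sub>F q in at_right (0::real). 0 < q \<and> q < 1 \<and> ln (1 + q) - ln (1 - q) < r" by eventually_elim auto
  then obtain q :: real where q: "0 < q" "q < 1" "ln (1 + q) - ln (1 - q) < r"
    using eventually_happens[of _ "at_right (0::real)"] by auto
  have "hilbert_metric K (c *\<^sub>R x) (c' *\<^sub>R y) < r" 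
    if h: "dist x y < e * q" "0 < c" "0 < c'" "c *\<^sub>R x \<in> interior K" "c' *\<^sub>R y \<in> interior K" for x c c'
  proof -
    have n: "norm ((1/q) *\<^sub>R (x - y)) < e" unfolding norm_scaleR using h q by (simp add: dist_norm field_simps)
    have "y + (1/q) *\<^sub>R (x - y) \<in> ball y e" "y - (1/q) *\<^sub>R (x - y) \<in> ball y e"
      using n by (simp_all add: dist_norm)
    then have "(c * q) *\<^sub>R (y + (1/q) *\<^sub>R (x - y)) \<in> K" "(c * q) *\<^sub>R (y - (1/q) *\<^sub>R (x - y)) \<in> K"
      using e closed_coneD(2)[OF K(1)] h q by (auto simp: subset_iff)
    moreover have "(c * q) *\<^sub>R (y + (1/q) *\<^sub>R (x - y)) = c *\<^sub>R x - (c / c' * (1 - q)) *\<^sub>R (c' *\<^sub>R y)"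
      "(c * q) *\<^sub>R (y - (1/q) *\<^sub>R (x - y)) = (c / c' * (1 + q)) *\<^sub>R (c' *\<^sub>R y) - c *\<^sub>R x"
    proof -
      have eq: "c / c' * (1 - q) * c' = c - c * q" "c / c' * (1 + q) * c' = c + c * q" "c * q * (1 / q) = c"
        using h q by (simp_all add: field_simps)
      show "(c * q) *\<^sub>R (y + (1/q) *\<^sub>R (x - y)) = c *\<^sub>R x - (c / c' * (1 - q)) *\<^sub>R (c' *\<^sub>R y)"
        "(c * q) *\<^sub>R (y - (1/q) *\<^sub>R (x - y)) = (c / c' * (1 + q)) *\<^sub>R (c' *\<^sub>R y) - c *\<^sub>R x"
        unfolding scaleR_add_right scaleR_diff_right scaleR_scaleR eq by (simp_all add: scaleR_add_left scaleR_diff_left)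
    qed
    ultimately have "c *\<^sub>R x - (c / c' * (1 - q)) *\<^sub>R (c' *\<^sub>R y) \<in> K"
      "(c / c' * (1 + q)) *\<^sub>R (c' *\<^sub>R y) - c *\<^sub>R x \<in> K" by simp_all
    moreover have "ln (c / c' * (1 + q)) - ln (c / c' * (1 - q)) < r"
      using h q ln_mult_pos[of "c / c'" "1 + q"] ln_mult_pos[of "c / c'" "1 - q"] by simp
    ultimately show ?thesis unfolding hilbert_metric_less_iff[OF K h(4,5)]
      using h q by (intro exI[of _ "c / c' * (1 - q)"] exI[of _ "c / c' * (1 + q)"]) auto
  qed
  then show ?thesis using e q by (intro exI[of _ "e * q"]) auto
qed

lemma measurable_action_separable:
  fixes K U :: "'x::real_normed_vector set"
  assumes K: "closed_cone K" "K \<inter> uminus ` K = {0}" "K - {0} \<noteq> {}" "interior K \<noteq> {}"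
    and U: "intersects_transversely U K"
    and met: "Metric_space (cone_section K U) (hilbert_metric K)"
    and D: "countable D" "closure D = (UNIV :: 'x set)"
    and A: "A \<in> borel_measurable M" "\<forall>\<omega>\<in>space M. positive_op K (A \<omega>)"
  shows "measurable_action K U M A"
proof -
  interpret Metric_space "cone_section K U" "hilbert_metric K" by fact
  let ?E = "cone_section K U" let ?d = "hilbert_metric K" let ?P = "\<lambda>\<omega>. proj_action U (A \<omega>)"
  let ?V = "vimage_algebra (space M) A borel" and ?B = "hilbert_borel K U"
  have sp: "space ?B = ?E" unfolding hilbert_borel_def
    by (rule space_measure_of) (use openin_subset in fastforce)
  have open_sets: "W \<in> sets ?B" if "openin mtopology W" for W
    unfolding hilbert_borel_def by (subst sets_measure_of) (use that openin_subset in fastforce)+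
  have PE: "?P \<omega> x \<in> ?E" if "\<omega> \<in> space M" "x \<in> ?E" for \<omega> x
    using proj_action_props(2)[OF K(1-3) U] A(2) that by (auto simp: cone_section_def)
  define scal where "scal x = (THE s. 0 < s \<and> s *\<^sub>R x \<in> U)" for x
  have scal: "0 < scal x \<and> scal x *\<^sub>R x \<in> ?E" if "x \<in> interior K" for x
  proof -
    have "x \<in> K - {0}" using that interior_nonzero[OF K(1-3)] interior_subset[of K] by auto
    then have "\<exists>!s. 0 < s \<and> s *\<^sub>R x \<in> U" using U by (auto simp: intersects_transversely_def)
    then have s: "0 < scal x \<and> scal x *\<^sub>R x \<in> U" unfolding scal_def by (rule theI')
    have "(\<lambda>y. scal x *\<^sub>R y) ` interior K \<subseteq> interior K"
    proof (rule interior_maximal)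
      show "open ((\<lambda>y. scal x *\<^sub>R y) ` interior K)" using s by (intro open_scaling) auto
      show "(\<lambda>y. scal x *\<^sub>R y) ` interior K \<subseteq> K" using closed_coneD(2)[OF K(1)] s interior_subset[of K] by force
    qed
    then show ?thesis using s that by (auto simp: cone_section_def)
  qed
  define Q where "Q = (\<lambda>x. scal x *\<^sub>R x) ` (D \<inter> interior K)"
  have Q: "countable Q" "Q \<subseteq> ?E" using D scal by (auto simp: Q_def)
  have dense: "\<exists>q\<in>Q. ?d q f < r" if f: "f \<in> ?E" and "0 < r" for f r
  proof -
    have fi: "f \<in> interior K" using f by (simp add: cone_section_def)
    obtain e where e: "e > 0" "\<And>x c c'. dist x f < e \<Longrightarrow> 0 < c \<Longrightarrow> 0 < c' \<Longrightarrow> c *\<^sub>R x \<in> interior K \<Longrightarrow> c' *\<^sub>R f \<in> interior K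
     \<Longrightarrow> ?d (c *\<^sub>R x) (c' *\<^sub>R f) < r" using hilbert_small[OF K(1-3) fi \<open>0 < r\<close>] by blast
    have "open (interior K \<inter> ball f e)" "f \<in> interior K \<inter> ball f e" using fi e by auto
    then have "D \<inter> (interior K \<inter> ball f e) \<noteq> {}" 
      using D(2) open_Int_closure_eq_empty[of "interior K \<inter> ball f e" D] by auto
    then obtain x where x: "x \<in> D" "x \<in> interior K" "dist x f < e" by (auto simp: dist_commute)
    then have "?d (scal x *\<^sub>R x) (1 *\<^sub>R f) < r" using e(2)[of x "scal x" 1] scal[of x] fi by (auto simp: cone_section_def)
    then show ?thesis using x by (auto simp: Q_def)
  qed
  have slice: "{\<omega> \<in> space M. ?d (?P \<omega> x) w < r} \<in> sets ?V" if x: "x \<in> ?E" and w: "w \<in> ?E" for x w r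
  proof -
    define O' where "O' = \<Union> {S. open S \<and> (\<forall>T\<in>S. positive_op K T \<longrightarrow> ?d (proj_action U T x) w < r)}"
    have xi: "x \<in> interior K" using x by (simp add: cone_section_def)
    have "open O'" by (auto simp: O'_def)
    have "{\<omega> \<in> space M. ?d (?P \<omega> x) w < r} = A -` O' \<inter> space M"
    proof (intro set_eqI iffI)
      fix \<omega> assume "\<omega> \<in> A -` O' \<inter> space M"
      then show "\<omega> \<in> {\<omega> \<in> space M. ?d (?P \<omega> x) w < r}" using A(2) by (auto simp: O'_def)
    next
      fix \<omega> assume "\<omega> \<in> {\<omega> \<in> space M. ?d (?P \<omega> x) w < r}"
      then have w1: "\<omega> \<in> space M" "?d (?P \<omega> x) w < r" by auto
      define T0 where "T0 = A \<omega>"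
      have T0: "positive_op K T0" using A w1 by (auto simp: T0_def)
      obtain c0 where c0: "c0 > 0" "proj_action U T0 x = c0 *\<^sub>R T0 x" using proj_action_props(1)[OF K(1-3) U T0 xi] by auto
      have T0E: "proj_action U T0 x \<in> ?E" using proj_action_props(2)[OF K(1-3) U T0 xi] .
      have T0x: "T0 x \<in> interior K" using T0 xi by (auto simp: positive_op_def)
      obtain e where e: "e > 0" "\<And>z c c'. dist z (T0 x) < e \<Longrightarrow> 0 < c \<Longrightarrow> 0 < c' \<Longrightarrow> c *\<^sub>R z \<in> interior K \<Longrightarrow> c' *\<^sub>R T0 x \<in> interior K
     \<Longrightarrow> ?d (c *\<^sub>R z) (c' *\<^sub>R T0 x) < r - ?d (proj_action U T0 x) w" using hilbert_small[OF K(1-3) T0x, of "r - ?d (proj_action U T0 x) w"] w1 unfolding T0_def by auto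
      define S where "S = {T. dist (blinfun_apply T x) (T0 x) < e}"
      have "open S" unfolding S_def by (intro open_Collect_less continuous_intros)
      moreover have "?d (proj_action U T x) w < r" if T: "T \<in> S" "positive_op K T" for T
      proof -
        obtain c where c: "c > 0" "proj_action U T x = c *\<^sub>R T x" using proj_action_props(1)[OF K(1-3) U T(2) xi] by auto
        have TE: "proj_action U T x \<in> ?E" using proj_action_props(2)[OF K(1-3) U T(2) xi] .
        have "?d (proj_action U T x) (proj_action U T0 x) < r - ?d (proj_action U T0 x) w"
          using e(2)[of "T x" c c0] T c c0 TE T0E by (auto simp: S_def cone_section_def)
        then show ?thesis using triangle[OF TE T0E w] by linarith
      qed
      moreover have "T0 \<in> S" using e by (simp add: S_def)
      ultimately show "\<omega> \<in> A -` O' \<inter> space M" using w1 by (auto simp: O'_def T0_def)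
    qed
    also have "\<dots> \<in> sets ?V" by (rule in_vimage_algebra) (use \<open>open O'\<close> in auto)
    finally show ?thesis .
  qed
  let ?N = "?V \<Otimes>\<^sub>M ?B"
  have spN: "space ?N = space M \<times> ?E" by (simp add: space_pair_measure sp)
  have ball_meas: "{(\<omega>, f) \<in> space M \<times> ?E. ?d (?P \<omega> f) w < r} \<in> sets ?N" if w: "w \<in> ?E" for w r
  proof -
    have "{(\<omega>, f) \<in> space M \<times> ?E. ?d (?P \<omega> f) w < r} =
       (\<Union>q\<in>Q. \<Union>k::nat. {\<omega> \<in> space M. ?d (?P \<omega> q) w < r - 1 / Suc k} \<times> mball q (1 / Suc k))" (is "?L = ?R")
    proof (intro equalityI subrelI)
      fix \<omega> f assume "(\<omega>, f) \<in> ?L"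
      then have h: "\<omega> \<in> space M" "f \<in> ?E" "?d (?P \<omega> f) w < r" by auto
      obtain k :: nat where k: "1 / Suc k < (r - ?d (?P \<omega> f) w) / 2" 
        using h nat_approx_posE[of "(r - ?d (?P \<omega> f) w) / 2"] by auto
      obtain q where q: "q \<in> Q" "?d q f < 1 / Suc k" using dense[OF h(2), of "1 / Suc k"] by auto
      have qE: "q \<in> ?E" using q Q by auto
      have "?d (?P \<omega> q) (?P \<omega> f) \<le> ?d q f" using proj_action_nonexpansive[OF K U _ qE h(2)] A h by auto
      then have "?d (?P \<omega> q) w < r - 1 / Suc k" 
        using triangle[OF PE[OF h(1) qE] PE[OF h(1,2)] w] k q by argo
      then show "(\<omega>, f) \<in> (\<Union>q\<in>Q. \<Union>k::nat. {\<omega> \<in> space M. ?d (?P \<omega> q) w < r - 1 / Suc k} \<times> mball q (1 / Suc k))"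
        using h q qE by (intro UN_I[of q] UN_I[of k]) auto
    next
      fix \<omega> f assume "(\<omega>, f) \<in> ?R"
      then obtain q and k :: nat where h: "q \<in> Q" "\<omega> \<in> space M" "?d (?P \<omega> q) w < r - 1 / Suc k" "f \<in> mball q (1 / Suc k)" by blast
      then have E: "f \<in> ?E" "q \<in> ?E" by auto
      have "?d (?P \<omega> q) (?P \<omega> f) \<le> ?d q f" using proj_action_nonexpansive[OF K U _ E(2,1)] A h by auto
      then have "?d (?P \<omega> f) w < r"
        using triangle[OF PE[OF h(2) E(1)] PE[OF h(2) E(2)] w] h commute[of "?P \<omega> f" "?P \<omega> q"] by auto
      then show "(\<omega>, f) \<in> {(\<omega>, f) \<in> space M \<times> ?E. ?d (?P \<omega> f) w < r}" using h E by auto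
    qed
    also have "\<dots> \<in> sets ?N"
      using Q w by (intro sets.countable_UN'' sets.countable_UN' pair_measureI slice open_sets openin_mball) auto
    finally show ?thesis .
  qed
  show ?thesis unfolding measurable_action_def
  proof (subst (2) hilbert_borel_def, rule measurable_measure_of)
    show "{W. openin mtopology W} \<subseteq> Pow ?E" using openin_subset by fastforce
    show "(\<lambda>(\<omega>, f). ?P \<omega> f) \<in> space ?N \<rightarrow> ?E" using PE by (auto simp: spN)
    fix W assume "W \<in> {W. openin mtopology W}"
    then have W: "openin mtopology W" by simp
    have WE: "W \<subseteq> ?E" using openin_subset[OF W] by simp
    define I where "I = {(q, k::nat). q \<in> Q \<and> mball q (1 / Suc k) \<subseteq> W}"
    have I: "countable I" using countable_subset[of I "Q \<times> UNIV"] Q by (auto simp: I_def)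
    have "W = (\<Union>(q,k)\<in>I. mball q (1 / Suc k))"
    proof (intro equalityI subsetI)
      fix f assume f: "f \<in> W"
      then obtain r where r: "r > 0" "mball f r \<subseteq> W" using W by (auto simp: openin_mtopology)
      obtain k :: nat where k: "1 / Suc k < r / 2" using r nat_approx_posE[of "r/2"] by auto
      obtain q where q: "q \<in> Q" "?d q f < 1 / Suc k" using dense[of f "1 / Suc k"] f WE by auto
      have "mball q (1 / Suc k) \<subseteq> mball f r"
      proof
        fix z assume z: "z \<in> mball q (1 / Suc k)"
        then show "z \<in> mball f r" using triangle[of f q z] commute[of f q] q k f WE by auto
      qed
      then have "(q, k) \<in> I" using q r by (auto simp: I_def)
      moreover have "f \<in> mball q (1 / Suc k)" using q Q f WE by auto
      ultimately show "f \<in> (\<Union>(q,k)\<in>I. mball q (1 / Suc k))" by blast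
    qed (auto simp: I_def)
    moreover have "y \<in> (\<Union>(q,k)\<in>I. mball q (1 / Suc k)) \<longleftrightarrow> (\<exists>(q, k)\<in>I. y \<in> ?E \<and> ?d y q < 1 / Suc k)" for y
      using Q commute[of y] by (fastforce simp: I_def in_mball)
    ultimately have memW: "y \<in> W \<longleftrightarrow> (\<exists>(q, k)\<in>I. y \<in> ?E \<and> ?d y q < 1 / Suc k)" for y by metis
    have "(\<lambda>(\<omega>, f). ?P \<omega> f) -` W \<inter> space ?N =
       (\<Union>(q,k)\<in>I. {(\<omega>, f) \<in> space M \<times> ?E. ?d (?P \<omega> f) q < 1 / Suc k})"
      using PE by (fastforce simp: spN memW)
    also have "\<dots> \<in> sets ?N"
    proof (intro sets.countable_UN' I, clarify)
      fix q and k :: nat assume "(q, k) \<in> I"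
      then have "q \<in> ?E" using Q by (auto simp: I_def)
      from ball_meas[OF this, of "1 / Suc k"]
      show "{(\<omega>, f) \<in> space M \<times> ?E. ?d (?P \<omega> f) q < 1 / Suc k} \<in> sets ?N" .
    qed
    finally show "(\<lambda>(\<omega>, f). ?P \<omega> f) -` W \<inter> space ?N \<in> sets ?N" .
  qed
qed

end

theory Submission
  imports Defs
begin

text \<open>An operator of projective norm \<open>\<tau> < 1\<close> maps \<open>E\<close> onto a set of finite diameter, and each later
  operator contracts by its own \<open>\<tau>\<close>. Since such operators recur with positive frequency, the diameters
  of \<open>\<phi>\<^sub>n(\<omega>) E\<close> and of the nested sets \<open>\<phi>\<^sub>n(\<theta>\<^sub>-\<^sub>n \<omega>) E\<close> decay at a rate governed by the ergodic averages
  of \<open>log \<tau>(A)\<close>; completeness yields \<open>u(\<omega>)\<close> as the point common to the closures of the nested sets. Only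
  one half of Birkhoff's theorem, a lower bound for the averages of bounded functions, is needed, because
  \<open>- log \<tau>(A)\<close> is nonnegative and may be truncated. Any invariant measure is pushed by \<open>\<phi>\<^sub>n\<close> towards the graph
  of \<open>u\<close>, hence is carried by it.\<close>

section \<open>One-sided ergodic theorem\<close>

text \<open>Distances in \<open>E\<close> are unbounded in general, so no product of contraction
  factors controls an image before some step has a finite one. A uniform constant for that needs a
  threshold: since \<open>\<tau>(A) < 1\<close> has positive probability, so has
  \<open>\<tau>(A) \<le> q\<close> for some fixed \<open>q < 1\<close>, and all such steps have
  images of diameter at most \<open>ln 4 / (1 - q)\<close>. The value need not be sharp, because
  constants disappear in \<open>(1/n) log\<close>. Future and past are not symmetric. Forward, one
  hit at a fixed time serves every large \<open>n\<close>. A pullback orbit starts at time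
  \<open>- n\<close>, and its hit must lie in the remote past, which takes two-sided control of the
  frequency of hits. The space \<open>E\<close> may be non-separable, so distances between
  measurable maps, sets of convergence and graphs may fail to be measurable. Measurability therefore
  rests on counts of hits, which are real-valued functions of the operators, and on inner
  approximations of open sets. Cones enter only through the finite image diameter and the properties
  of \<open>\<tau>\<close>; the rest concerns random maps of a complete metric space. Every finite
  rate below \<open>- \<rho>\<close> is treated instead of \<open>- \<rho>\<close>, which may be
  infinite.\<close>

locale ergodic_flow =
  fixes M :: "'w measure" and \<theta> :: "int \<Rightarrow> 'w \<Rightarrow> 'w"
  assumes ergodic: "ergodic_ds M \<theta>"
begin

sublocale prob_space M
  using ergodic by (simp add: ergodic_ds_def invertible_ds_def)

lemma flow_measurable [measurable]: "\<theta> z \<in> measurable M M"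
proof -
  have "(\<lambda>(z, \<omega>). \<theta> z \<omega>) \<in> measurable (count_space UNIV \<Otimes>\<^sub>M M) M"
    using ergodic by (simp add: ergodic_ds_def invertible_ds_def)
  then have "(\<lambda>\<omega>. (\<lambda>(z, \<omega>). \<theta> z \<omega>) (z, \<omega>)) \<in> measurable M M"
    by (rule measurable_compose[rotated]) simp
  then show ?thesis by simp
qed

lemma flow_space [simp]: "\<omega> \<in> space M \<Longrightarrow> \<theta> z \<omega> \<in> space M"
  using measurable_space[OF flow_measurable] .

lemma flow_add: "\<omega> \<in> space M \<Longrightarrow> \<theta> z (\<theta> z' \<omega>) = \<theta> (z + z') \<omega>"
  using ergodic by (simp add: ergodic_ds_def invertible_ds_def)

lemma flow_0 [simp]: "\<omega> \<in> space M \<Longrightarrow> \<theta> 0 \<omega> = \<omega>"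
  using ergodic by (simp add: ergodic_ds_def invertible_ds_def)

lemma distr_flow: "distr M M (\<theta> z) = M"
  using ergodic by (simp add: ergodic_ds_def invertible_ds_def)

lemma integral_flow:
  fixes h :: "'w \<Rightarrow> real"
  assumes "h \<in> borel_measurable M"
  shows "(\<integral>\<omega>. h (\<theta> z \<omega>) \<partial>M) = (\<integral>\<omega>. h \<omega> \<partial>M)"
  using integral_distr[OF flow_measurable assms, of z] by (simp add: distr_flow)

text \<open>\<open>ergodic_ds\<close> speaks of images under all \<open>\<theta> z\<close>.
  Invertibility spreads invariance under the one preimage by \<open>\<theta> 1\<close> to every
  \<open>z\<close>, by induction in both directions, and turns preimages into images.\<close>

lemma flow_invariant_prob:
  assumes S: "S \<in> sets M" and inv: "\<And>\<omega>. \<omega> \<in> space M \<Longrightarrow> \<theta> 1 \<omega> \<in> S \<longleftrightarrow> \<omega> \<in> S"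
  shows "prob S = 0 \<or> prob S = 1"
proof -
  have SM: "S \<subseteq> space M" using sets.sets_into_space[OF S] .
  have iff: "\<theta> z \<omega> \<in> S \<longleftrightarrow> \<omega> \<in> S" if w: "\<omega> \<in> space M" for z \<omega>
  proof (induction z rule: int_induct[where k=0])
    case base then show ?case using w by simp
  next
    case (step1 i)
    then show ?case using inv[of "\<theta> i \<omega>"] w by (simp add: flow_add add.commute)
  next
    case (step2 i)
    then show ?case using inv[of "\<theta> (i - 1) \<omega>"] w by (simp add: flow_add)
  qed
  have "flow_invariant \<theta> S"
    unfolding flow_invariant_def
  proof (intro allI equalityI subsetI)
    fix z \<omega> assume "\<omega> \<in> \<theta> z ` S" then show "\<omega> \<in> S" using iff SM by auto
  next
    fix z \<omega> assume w: "\<omega> \<in> S"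
    then have "\<omega> = \<theta> z (\<theta> (- z) \<omega>)" using SM by (simp add: flow_add subset_iff)
    then show "\<omega> \<in> \<theta> z ` S" using iff[of \<omega> "- z"] w SM by blast
  qed
  then show ?thesis using ergodic S by (simp add: ergodic_ds_def)
qed

text \<open>The points whose two-sided orbit avoids a null set \<open>N\<close> form an invariant
  set, and only countably many null translates of \<open>N\<close> are removed.\<close>

lemma AE_on_flow_invariant_set:
  assumes "AE \<omega> in M. Q \<omega>"
  obtains \<Omega>' where "\<Omega>' \<in> sets M" "flow_invariant \<theta> \<Omega>'" "prob \<Omega>' = 1" "\<And>\<omega>. \<omega> \<in> \<Omega>' \<Longrightarrow> Q \<omega>"
proof -
  obtain N where N: "{\<omega> \<in> space M. \<not> Q \<omega>} \<subseteq> N" "emeasure M N = 0" "N \<in> sets M"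
    using AE_E[OF assms] .
  define \<Omega>' where "\<Omega>' = {\<omega> \<in> space M. \<forall>z. \<theta> z \<omega> \<notin> N}"
  have [measurable]: "N \<in> sets M" by fact
  have meas: "\<Omega>' \<in> sets M" unfolding \<Omega>'_def by measurable
  have "AE \<omega> in M. \<omega> \<notin> N" using N by (intro AE_not_in) auto
  then have "AE \<omega> in M. \<theta> z \<omega> \<notin> N" for z
    by (subst (asm) distr_flow[of z, symmetric], subst (asm) AE_distr_iff) auto
  then have "AE \<omega> in M. \<forall>z. \<theta> z \<omega> \<notin> N" by (simp add: AE_all_countable)
  then have "AE \<omega> in M. \<omega> \<in> \<Omega>'" using AE_space by eventually_elim (auto simp: \<Omega>'_def)
  then have 1: "prob \<Omega>' = 1" using meas prob_eq_1 by simp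
  have "flow_invariant \<theta> \<Omega>'"
    unfolding flow_invariant_def
  proof (intro allI equalityI subsetI)
    fix z \<omega> assume "\<omega> \<in> \<theta> z ` \<Omega>'" then show "\<omega> \<in> \<Omega>'" by (auto simp: \<Omega>'_def flow_add)
  next
    fix z \<omega> assume w: "\<omega> \<in> \<Omega>'"
    then have "\<omega> = \<theta> z (\<theta> (- z) \<omega>)" "\<theta> (- z) \<omega> \<in> \<Omega>'" by (simp_all add: \<Omega>'_def flow_add)
    then show "\<omega> \<in> \<theta> z ` \<Omega>'" by blast
  qed
  moreover have "Q \<omega>" if "\<omega> \<in> \<Omega>'" for \<omega>
  proof -
    have "\<omega> \<in> space M" "\<theta> 0 \<omega> \<notin> N" using that unfolding \<Omega>'_def by blast+
    then show ?thesis using N(1) by auto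
  qed
  ultimately show thesis using that meas 1 by blast
qed

section \<open>Birkhoff sums and the maximal ergodic inequality\<close>

definition birkhoff_sum :: "('w \<Rightarrow> real) \<Rightarrow> nat \<Rightarrow> 'w \<Rightarrow> real" where
  "birkhoff_sum h n \<omega> = (\<Sum>j<n. h (\<theta> (int j) \<omega>))"

lemma birkhoff_sum_measurable [measurable]:
  assumes [measurable]: "h \<in> borel_measurable M"
  shows "birkhoff_sum h n \<in> borel_measurable M"
  unfolding birkhoff_sum_def by measurable

lemma birkhoff_sum_Suc_start:
  assumes "\<omega> \<in> space M"
  shows "birkhoff_sum h (Suc n) \<omega> = h \<omega> + birkhoff_sum h n (\<theta> 1 \<omega>)"
  using assms unfolding birkhoff_sum_def
  by (subst sum.lessThan_Suc_shift) (simp add: flow_add add.commute)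

text \<open>The maximum of the Birkhoff sums of lengths \<open>0\<close> to \<open>n\<close>.
  Splitting off the first summand relates the maximum at \<open>\<omega>\<close> directly to the one
  at \<open>\<theta> 1 \<omega>\<close>.\<close>

primrec maximal_sum :: "('w \<Rightarrow> real) \<Rightarrow> nat \<Rightarrow> 'w \<Rightarrow> real" where
  "maximal_sum h 0 \<omega> = 0"
| "maximal_sum h (Suc n) \<omega> = max 0 (h \<omega> + maximal_sum h n (\<theta> 1 \<omega>))"

lemma maximal_sum_measurable [measurable]:
  assumes [measurable]: "h \<in> borel_measurable M"
  shows "maximal_sum h n \<in> borel_measurable M"
proof (induction n)
  case (Suc n)
  note Suc.IH [measurable]
  have "(\<lambda>\<omega>. max 0 (h \<omega> + maximal_sum h n (\<theta> 1 \<omega>))) \<in> borel_measurable M" by measurable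
  then show ?case by (simp add: fun_eq_iff[of "maximal_sum h (Suc n)"] cong: measurable_cong)
qed (simp add: fun_eq_iff[of "maximal_sum h 0"] cong: measurable_cong)

lemma maximal_sum_nonneg: "0 \<le> maximal_sum h n \<omega>"
  by (cases n) auto

lemma maximal_sum_mono:
  "\<omega> \<in> space M \<Longrightarrow> maximal_sum h n \<omega> \<le> maximal_sum h (Suc n) \<omega>"
proof (induction n arbitrary: \<omega>)
  case (Suc n)
  from Suc.IH[of "\<theta> 1 \<omega>"] Suc.prems show ?case by (auto simp: max_def)
qed auto

lemma birkhoff_sum_le_maximal_sum:
  "\<omega> \<in> space M \<Longrightarrow> birkhoff_sum h n \<omega> \<le> maximal_sum h n \<omega>"
proof (induction n arbitrary: \<omega>)
  case (Suc n)
  from Suc.IH[of "\<theta> 1 \<omega>"] Suc.prems show ?case by (simp add: birkhoff_sum_Suc_start)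
qed (simp add: birkhoff_sum_def)

lemma maximal_sum_bound:
  assumes "\<And>\<omega>. \<omega> \<in> space M \<Longrightarrow> \<bar>h \<omega>\<bar> \<le> b"
  shows "\<omega> \<in> space M \<Longrightarrow> maximal_sum h n \<omega> \<le> real n * b"
proof (induction n arbitrary: \<omega>)
  case (Suc n)
  have "\<bar>h \<omega>\<bar> \<le> b" "maximal_sum h n (\<theta> 1 \<omega>) \<le> real n * b" using assms Suc by auto
  moreover have "0 \<le> b" using calculation by linarith
  ultimately show ?case by (auto simp: algebra_simps)
qed auto

text \<open>Garsia's argument: where \<open>maximal_sum h n\<close> is positive, it exceeds its own translate by at
  most \<open>h\<close>.\<close>

lemma maximal_ergodic:
  assumes h [measurable]: "h \<in> borel_measurable M"
    and bound: "\<And>\<omega>. \<omega> \<in> space M \<Longrightarrow> \<bar>h \<omega>\<bar> \<le> b"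
    and pos: "AE \<omega> in M. \<exists>n. 0 < birkhoff_sum h n \<omega>"
  shows "0 \<le> (\<integral>\<omega>. h \<omega> \<partial>M)"
proof -
  let ?m = "maximal_sum h"
  define I where "I n \<omega> = (if 0 < ?m n \<omega> then h \<omega> else 0)" for n \<omega>
  have I_meas [measurable]: "I n \<in> borel_measurable M" for n unfolding I_def by measurable
  have I_int: "integrable M (I n)" for n
    by (rule integrable_const_bound[where B="\<bar>b\<bar>"])
      (use bound in \<open>auto simp: I_def intro!: AE_I2 order_trans[OF bound]\<close>)
  have m_int: "integrable M (?m n)" for n
    by (rule integrable_const_bound[where B="\<bar>real n * b\<bar>"])
      (auto simp: maximal_sum_nonneg intro!: AE_I2 order_trans[OF maximal_sum_bound[OF bound]])
  have mT_int: "integrable M (\<lambda>\<omega>. ?m n (\<theta> 1 \<omega>))" for n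
    using m_int[of n] integrable_distr[of "\<theta> 1" M M "?m n"] distr_flow by auto
  have step: "0 \<le> (\<integral>\<omega>. I n \<omega> \<partial>M)" for n
  proof -
    have "?m n \<omega> - ?m n (\<theta> 1 \<omega>) \<le> I n \<omega>" if w: "\<omega> \<in> space M" for \<omega>
    proof (cases "0 < ?m n \<omega>")
      case True
      then obtain k where k: "n = Suc k" by (cases n) auto
      then have "?m n \<omega> = h \<omega> + ?m k (\<theta> 1 \<omega>)" using True by (auto simp: max_def split: if_splits)
      also have "\<dots> \<le> h \<omega> + ?m n (\<theta> 1 \<omega>)" using maximal_sum_mono[of "\<theta> 1 \<omega>" h k] w k by simp
      finally show ?thesis using True by (simp add: I_def)
    next
      case False
      then show ?thesis using maximal_sum_nonneg[of h n "\<theta> 1 \<omega>"] by (simp add: I_def)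
    qed
    then have "(\<integral>\<omega>. ?m n \<omega> - ?m n (\<theta> 1 \<omega>) \<partial>M) \<le> (\<integral>\<omega>. I n \<omega> \<partial>M)"
      by (intro integral_mono) (auto intro: I_int m_int mT_int)
    then show ?thesis using m_int mT_int by (simp add: integral_flow)
  qed
  \<comment> \<open>By \<open>pos\<close> and the monotonicity of \<open>?m n\<close> in
    \<open>n\<close>, almost every point eventually has \<open>0 < ?m n\<close>; from then on
    \<open>I n\<close> agrees with \<open>h\<close>.\<close>
  have "(\<lambda>n. \<integral>\<omega>. I n \<omega> \<partial>M) \<longlonglongrightarrow> (\<integral>\<omega>. h \<omega> \<partial>M)"
  proof (rule integral_dominated_convergence[where w="\<lambda>_. \<bar>b\<bar>"])
    show "AE \<omega> in M. (\<lambda>n. I n \<omega>) \<longlonglongrightarrow> h \<omega>"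
      using pos AE_space
    proof eventually_elim
      case (elim \<omega>)
      then obtain n where n: "0 < birkhoff_sum h n \<omega>" by blast
      have "0 < ?m k \<omega>" if "n \<le> k" for k
        using lift_Suc_mono_le[of "\<lambda>n. ?m n \<omega>", OF maximal_sum_mono that] elim n
          birkhoff_sum_le_maximal_sum[of \<omega> h n] by auto
      then have "\<forall>\<^sub>F k in sequentially. I k \<omega> = h \<omega>"
        unfolding eventually_sequentially by (auto simp: I_def)
      then show ?case by (rule tendsto_eventually)
    qed
    show "AE \<omega> in M. norm (I n \<omega>) \<le> \<bar>b\<bar>" for n
      using bound by (auto simp: I_def intro!: AE_I2 order_trans[OF bound])
  qed auto
  then show ?thesis by (rule LIMSEQ_le_const) (use step in auto)
qed

text \<open>If averages fell below some \<open>r < c'\<close> infinitely often with positive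
  probability, ergodicity would make this almost sure. Then \<open>c' - g\<close> has a positive
  Birkhoff sum almost everywhere, and the maximal inequality bounds the integral of \<open>g\<close>
  by \<open>c'\<close>, against the choice of \<open>c'\<close>.\<close>

lemma birkhoff_sum_lower_bound:
  assumes g [measurable]: "g \<in> borel_measurable M"
    and bound: "\<And>\<omega>. \<omega> \<in> space M \<Longrightarrow> \<bar>g \<omega>\<bar> \<le> b"
    and c: "c < (\<integral>\<omega>. g \<omega> \<partial>M)"
  shows "AE \<omega> in M. \<forall>\<^sub>F n in sequentially. c * real n < birkhoff_sum g n \<omega>"
proof -
  obtain c' where c': "c < c'" "c' < (\<integral>\<omega>. g \<omega> \<partial>M)" using dense[OF c] by blast
  \<comment> \<open>The rational \<open>r\<close> strictly below \<open>c'\<close> keeps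
    \<open>S\<close> measurable and makes it exactly invariant: a shift changes a Birkhoff sum by at
    most \<open>2 * b\<close>, which a slightly larger \<open>r\<close> absorbs for large
    \<open>n\<close>.\<close>
  define S where "S = {\<omega> \<in> space M. \<exists>r\<in>\<rat>. r < c' \<and> (\<forall>N. \<exists>n\<ge>N. birkhoff_sum g n \<omega> \<le> r * real n)}"
  have S_meas: "S \<in> sets M"
    unfolding S_def
    by (rule sets.sets_Collect_countable_Ex'[OF _ countable_rat]) measurable
  have shift: "\<bar>birkhoff_sum g n (\<theta> 1 \<omega>) - birkhoff_sum g n \<omega>\<bar> \<le> 2 * b" if w: "\<omega> \<in> space M" for n \<omega>
  proof -
    have "birkhoff_sum g (Suc n) \<omega> = birkhoff_sum g n \<omega> + g (\<theta> (int n) \<omega>)"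
      by (simp add: birkhoff_sum_def)
    then show ?thesis
      using birkhoff_sum_Suc_start[OF w, of g n] bound[OF w] bound[OF flow_space[OF w, of "int n"]]
      by linarith
  qed
  have transfer: "\<exists>r\<in>\<rat>. r < c' \<and> (\<forall>N. \<exists>n\<ge>N. Y n \<le> r * real n)"
    if XY: "\<And>n. \<bar>X n - Y n\<bar> \<le> 2 * b" and X: "\<exists>r\<in>\<rat>. r < c' \<and> (\<forall>N. \<exists>n\<ge>N. X n \<le> r * real n)"
    for X Y :: "nat \<Rightarrow> real"
  proof -
    obtain r where r: "r < c'" "\<And>N. \<exists>n\<ge>N. X n \<le> r * real n" using X by blast
    obtain r' where r': "r' \<in> \<rat>" "r < r'" "r' < c'" using Rats_dense_in_real[OF r(1)] by blast
    have "\<exists>n\<ge>N. Y n \<le> r' * real n" for N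
    proof -
      obtain N' :: nat where N': "2 * b / (r' - r) < real N'" using reals_Archimedean2 by blast
      obtain n where n: "n \<ge> max N N'" "X n \<le> r * real n" using r(2) by blast
      then have "2 * b / (r' - r) < real n" using N' by linarith
      then have "2 * b < real n * (r' - r)" using r' by (simp add: pos_divide_less_eq)
      then have "Y n \<le> r' * real n" using n XY[of n] by (simp add: algebra_simps)
      then show ?thesis using n by auto
    qed
    then show ?thesis using r' by blast
  qed
  have "prob S = 0 \<or> prob S = 1"
  proof (rule flow_invariant_prob[OF S_meas])
    fix \<omega> assume w: "\<omega> \<in> space M"
    show "\<theta> 1 \<omega> \<in> S \<longleftrightarrow> \<omega> \<in> S"
      using transfer[of "\<lambda>n. birkhoff_sum g n (\<theta> 1 \<omega>)" "\<lambda>n. birkhoff_sum g n \<omega>"]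
        transfer[of "\<lambda>n. birkhoff_sum g n \<omega>" "\<lambda>n. birkhoff_sum g n (\<theta> 1 \<omega>)"] shift[OF w] w
      by (auto simp: S_def abs_minus_commute)
  qed
  moreover have "prob S \<noteq> 1"
  proof
    assume "prob S = 1"
    then have "AE \<omega> in M. \<omega> \<in> S" using prob_eq_1[OF S_meas] by simp
    then have "AE \<omega> in M. \<exists>n. 0 < birkhoff_sum (\<lambda>\<omega>. c' - g \<omega>) n \<omega>"
    proof eventually_elim
      case (elim \<omega>)
      \<comment> \<open>\<open>n \<ge> Suc 0\<close> matters: the strict inequality
        \<open>r * n < c' * n\<close>, which makes the sum positive, fails at
        \<open>n = 0\<close>.\<close>
      then obtain r n where r: "r < c'" "n \<ge> Suc 0" "birkhoff_sum g n \<omega> \<le> r * real n"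
        unfolding S_def by blast
      then have "r * real n < c' * real n" by simp
      then have "0 < birkhoff_sum (\<lambda>\<omega>. c' - g \<omega>) n \<omega>"
        using r(3) by (simp add: birkhoff_sum_def sum_subtractf mult.commute)
      then show ?case by blast
    qed
    then have "0 \<le> (\<integral>\<omega>. c' - g \<omega> \<partial>M)"
      by (intro maximal_ergodic[where b="\<bar>c'\<bar> + b"]) (use bound in \<open>fastforce+\<close>)
    moreover have "integrable M g"
      by (rule integrable_const_bound[where B=b]) (use bound in \<open>auto intro!: AE_I2\<close>)
    ultimately show False using c' by (simp add: prob_space)
  qed
  ultimately have "AE \<omega> in M. \<omega> \<notin> S" using S_meas prob_eq_0 by blast
  then show ?thesis using AE_space
  proof eventually_elim
    case (elim \<omega>)
    obtain r where r: "r \<in> \<rat>" "c < r" "r < c'" using Rats_dense_in_real[OF c'(1)] by blast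
    then obtain N where N: "\<And>n. n \<ge> N \<Longrightarrow> r * real n < birkhoff_sum g n \<omega>"
      using elim unfolding S_def by (force simp: not_le)
    have "c * real n < birkhoff_sum g n \<omega>" if "n \<ge> N" for n
      using N[OF that] mult_right_mono[of c r "real n"] r by linarith
    then show ?case unfolding eventually_sequentially by blast
  qed
qed

end

text \<open>Averages over the past, which govern pullback orbits, become instances of the forward
  statement.\<close>

lemma ergodic_flow_reverse:
  assumes "ergodic_flow M \<theta>"
  shows "ergodic_flow M (\<lambda>z. \<theta> (- z))"
proof -
  interpret ergodic_flow M \<theta> by fact
  have "(\<lambda>(z, \<omega>). \<theta> (- z) \<omega>) \<in> measurable (count_space UNIV \<Otimes>\<^sub>M M) M"
    by (rule measurable_pair_measure_countable1) auto
  moreover have "flow_invariant \<theta> S" if "flow_invariant (\<lambda>z. \<theta> (- z)) S" for S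
    using that unfolding flow_invariant_def by (metis minus_minus)
  moreover have "\<theta> (- (z + z')) \<omega> = \<theta> (- z) (\<theta> (- z') \<omega>)" if "\<omega> \<in> space M" for z z' \<omega>
    using that by (simp add: flow_add add.commute)
  ultimately show ?thesis
    using ergodic prob_space_axioms
    by unfold_locales (auto simp: ergodic_ds_def invertible_ds_def)
qed

section \<open>Borel sets of metric spaces\<close>

context Metric_space
begin

text \<open>An inner approximation of \<open>W\<close> with a margin: points of
  \<open>deep W k\<close> may move by \<open>1 / Suc k\<close> without leaving \<open>W\<close>. A
  radius strictly above the margin makes the set open.\<close>

definition deep :: "'a set \<Rightarrow> nat \<Rightarrow> 'a set" where
  "deep W k = {x \<in> M. \<exists>r > 1 / real (Suc k). mball x r \<subseteq> W}"

lemma deep_subset: "deep W k \<subseteq> W"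
proof
  fix x assume "x \<in> deep W k"
  then obtain r where r: "x \<in> M" "1 / real (Suc k) < r" "mball x r \<subseteq> W" by (auto simp: deep_def)
  then have "0 < r" by (meson less_trans of_nat_0_less_iff zero_less_Suc zero_less_divide_1_iff)
  then show "x \<in> W" using r by auto
qed

lemma deep_near:
  assumes "x \<in> deep W k" "y \<in> M" "d x y \<le> 1 / real (Suc k)"
  shows "y \<in> W"
proof -
  obtain r where "x \<in> M" "1 / real (Suc k) < r" "mball x r \<subseteq> W" using assms by (auto simp: deep_def)
  then show ?thesis using assms by (auto simp: subset_iff)
qed

text \<open>One third of the radius \<open>3 / Suc k\<close> covers the distance from
  \<open>x\<close> to \<open>y\<close>; the rest is a ball about \<open>y\<close> strictly larger
  than the margin.\<close>

lemma near_deep: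
  assumes "mball x (3 / real (Suc k)) \<subseteq> W" "x \<in> M" "y \<in> M" "d x y < 1 / real (Suc k)"
  shows "y \<in> deep W k"
proof -
  have "mball y (2 / real (Suc k)) \<subseteq> mball x (3 / real (Suc k))"
  proof
    fix z assume "z \<in> mball y (2 / real (Suc k))"
    then have z: "z \<in> M" "d y z < 2 / real (Suc k)" by auto
    then have "d x z < 1 / real (Suc k) + 2 / real (Suc k)" using triangle[of x y z] assms by linarith
    also have "\<dots> = 3 / real (Suc k)" by (simp add: add_divide_distrib[symmetric])
    finally show "z \<in> mball x (3 / real (Suc k))" using assms z by simp
  qed
  moreover have "1 / real (Suc k) < 2 / real (Suc k)" by (simp add: divide_strict_right_mono)
  ultimately show ?thesis using assms unfolding deep_def by blast
qed

lemma openin_deep: "openin mtopology (deep W k)"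
  unfolding openin_mtopology
proof (intro conjI allI impI)
  show "deep W k \<subseteq> M" by (auto simp: deep_def)
  fix x assume "x \<in> deep W k"
  then obtain r where r: "x \<in> M" "1 / real (Suc k) < r" "mball x r \<subseteq> W" by (auto simp: deep_def)
  define e where "e = (r - 1 / real (Suc k)) / 2"
  then have e: "2 * e = r - 1 / real (Suc k)" by simp
  have "mball x e \<subseteq> deep W k"
  proof
    fix y assume y: "y \<in> mball x e"
    have "mball y (r - e) \<subseteq> mball x r"
    proof
      fix z assume "z \<in> mball y (r - e)"
      then show "z \<in> mball x r" using y triangle[of x y z] by auto
    qed
    moreover have "1 / real (Suc k) < r - e" using e r(2) by linarith
    ultimately show "y \<in> deep W k" using y r unfolding deep_def by auto
  qed
  then show "\<exists>e>0. mball x e \<subseteq> deep W k" using r by (intro exI[of _ e]) (auto simp: e_def)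
qed

lemma deep_mono: "k \<le> k' \<Longrightarrow> deep W k \<subseteq> deep W k'"
proof
  fix x assume k: "k \<le> k'" and "x \<in> deep W k"
  then obtain r where r: "x \<in> M" "1 / real (Suc k) < r" "mball x r \<subseteq> W" by (auto simp: deep_def)
  have "1 / real (Suc k') \<le> 1 / real (Suc k)" using k by (simp add: frac_le)
  then have "1 / real (Suc k') < r" using r(2) by linarith
  then show "x \<in> deep W k'" using r unfolding deep_def by blast
qed

lemma mball_in_open:
  assumes "openin mtopology W" "x \<in> W"
  obtains k :: nat where "mball x (3 / real (Suc k)) \<subseteq> W"
proof -
  obtain r where r: "0 < r" "mball x r \<subseteq> W" using assms by (auto simp: openin_mtopology)
  obtain k :: nat where "1 / real (Suc k) < r / 3" using r nat_approx_posE[of "r / 3"] by auto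
  then have "3 / real (Suc k) \<le> r" by (simp add: field_simps)
  then show thesis using r(2) by (intro that[of k]) (meson mball_subset_concentric subset_trans)
qed

lemma Union_deep:
  assumes "openin mtopology W"
  shows "(\<Union>k. deep W k) = W"
proof (intro equalityI subsetI)
  fix x assume x: "x \<in> W"
  then have xM: "x \<in> M" using openin_subset[OF assms] by auto
  obtain k where "mball x (3 / real (Suc k)) \<subseteq> W" using mball_in_open[OF assms x] .
  then have "x \<in> deep W k" using near_deep[of x k W x] xM by simp
  then show "x \<in> (\<Union>k. deep W k)" by blast
qed (use deep_subset in auto)

section \<open>Measurability with respect to the open sets of a metric space\<close>

lemma space_sigma_open: "space (sigma M {W. openin mtopology W}) = M"
  by (rule space_measure_of) (use openin_subset in fastforce)

lemma sets_sigma_open: "sets (sigma M {W. openin mtopology W}) = sigma_sets M {W. openin mtopology W}"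
  by (rule sets_measure_of) (use openin_subset in fastforce)

lemma open_in_sigma: "openin mtopology W \<Longrightarrow> W \<in> sets (sigma M {W. openin mtopology W})"
  by (simp add: sets_sigma_open)

text \<open>The limit lies in an open \<open>W\<close> exactly if, for some \<open>k\<close>, the
  sequence is eventually in \<open>deep W k\<close>: the margin keeps the limit from leaving
  \<open>W\<close>. So the preimage of \<open>W\<close> is a countable combination of preimages of
  open sets.\<close>

lemma measurable_limit:
  assumes f: "\<And>n. f n \<in> measurable N (sigma M {W. openin mtopology W})"
    and g: "\<And>\<omega>. \<omega> \<in> space N \<Longrightarrow> limitin mtopology (\<lambda>n. f n \<omega>) (g \<omega>) sequentially"
  shows "g \<in> measurable N (sigma M {W. openin mtopology W})"
proof (rule measurable_measure_of)
  show "{W. openin mtopology W} \<subseteq> Pow M" using openin_subset by fastforce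
  have gM: "g \<omega> \<in> M" if "\<omega> \<in> space N" for \<omega> using g[OF that] by (simp add: limitin_metric)
  then show "g \<in> space N \<rightarrow> M" by auto
  have fM: "f n \<omega> \<in> M" if "\<omega> \<in> space N" for n \<omega>
    using measurable_space[OF f that] by (simp add: space_sigma_open)
  fix W assume "W \<in> {W. openin mtopology W}"
  then have W: "openin mtopology W" by simp
  have lim: "\<exists>n0. \<forall>n\<ge>n0. d (g \<omega>) (f n \<omega>) < e" if "\<omega> \<in> space N" "0 < e" for \<omega> e
    using g[OF that(1)] that(2) by (simp add: limitin_metric eventually_sequentially commute) blast
  have "g -` W \<inter> space N = (\<Union>k. \<Union>n0. \<Inter>n\<in>{n0..}. f n -` deep W k \<inter> space N)"
  proof (intro equalityI subsetI)
    fix \<omega> assume w: "\<omega> \<in> g -` W \<inter> space N"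
    then obtain k where k: "mball (g \<omega>) (3 / real (Suc k)) \<subseteq> W" using mball_in_open[OF W, of "g \<omega>"] by auto
    obtain n0 where "\<forall>n\<ge>n0. d (g \<omega>) (f n \<omega>) < 1 / real (Suc k)" using lim[of \<omega> "1 / real (Suc k)"] w by auto
    then have "\<forall>n\<ge>n0. f n \<omega> \<in> deep W k" using near_deep[OF k] gM fM w by auto
    then show "\<omega> \<in> (\<Union>k. \<Union>n0. \<Inter>n\<in>{n0..}. f n -` deep W k \<inter> space N)" using w by auto
  next
    fix \<omega> assume "\<omega> \<in> (\<Union>k. \<Union>n0. \<Inter>n\<in>{n0..}. f n -` deep W k \<inter> space N)"
    then obtain k n0 where k: "\<And>n. n \<ge> n0 \<Longrightarrow> f n \<omega> \<in> deep W k \<and> \<omega> \<in> space N" by auto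
    then have w: "\<omega> \<in> space N" by blast
    obtain n1 where n1: "\<forall>n\<ge>n1. d (g \<omega>) (f n \<omega>) < 1 / real (Suc k)" using lim[of \<omega> "1 / real (Suc k)"] w by auto
    define n where "n = max n0 n1"
    have "d (f n \<omega>) (g \<omega>) \<le> 1 / real (Suc k)" using n1 by (simp add: n_def commute less_imp_le)
    then show "\<omega> \<in> g -` W \<inter> space N" using deep_near[of "f n \<omega>" W k "g \<omega>"] k[of n] gM w by (simp add: n_def)
  qed
  also have "\<dots> \<in> sets N"
  proof -
    have "(\<Inter>n\<in>{n0..}. f n -` deep W k \<inter> space N) \<in> sets N" for k n0
      by (rule sets.countable_INT') (auto intro!: measurable_sets[OF f] open_in_sigma openin_deep)
    then show ?thesis by (intro sets.countable_UN'' countableI_type)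
  qed
  finally show "g -` W \<inter> space N \<in> sets N" .
qed

end

section \<open>Random contractions\<close>

text \<open>Absorbs constants depending on \<open>\<omega>\<close> at the price of a slightly
  smaller decay rate.\<close>

lemma eventually_le_exp:
  fixes a K :: real
  assumes "0 < a"
  shows "\<forall>\<^sub>F n in sequentially. K \<le> exp (a * real n)"
proof -
  obtain N :: nat where N: "K / a < real N" using reals_Archimedean2 by blast
  have "K \<le> exp (a * real n)" if "n \<ge> N" for n
  proof -
    have "K / a < real n" using N that by linarith
    then have "K < a * real n" using assms by (simp add: divide_less_eq mult.commute)
    then show ?thesis using exp_ge_add_one_self[of "a * real n"] by linarith
  qed
  then show ?thesis unfolding eventually_sequentially by blast
qed

text \<open>\<open>V\<close> is the \<open>\<sigma>\<close>-field generated by the random step, \<open>F\<close> that of the past steps.\<close>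

locale random_contraction = ergodic_flow M \<theta> + Metric_space E d
  for M :: "'w measure" and \<theta> :: "int \<Rightarrow> 'w \<Rightarrow> 'w" and E :: "'a set" and d :: "'a \<Rightarrow> 'a \<Rightarrow> real" +
  fixes V F :: "'w measure" and P :: "'w \<Rightarrow> 'a \<Rightarrow> 'a" and t :: "'w \<Rightarrow> real" and q C :: real
  assumes complete: mcomplete
    and nonempty: "E \<noteq> {}"
    and space_V: "space V = space M" and sets_V: "sets V \<subseteq> sets M"
    and space_F: "space F = space M" and sets_F: "sets F \<subseteq> sets M"
    and past: "\<And>n. 1 \<le> n \<Longrightarrow> \<theta> (- int n) \<in> measurable F V"
    and step_measurable: "(\<lambda>(\<omega>, x). P \<omega> x)
      \<in> measurable (V \<Otimes>\<^sub>M sigma E {W. openin mtopology W}) (sigma E {W. openin mtopology W})"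
    and t_measurable_V: "t \<in> borel_measurable V"
    and t_nonneg: "\<And>\<omega>. \<omega> \<in> space M \<Longrightarrow> 0 \<le> t \<omega>"
    and t_le_1: "\<And>\<omega>. \<omega> \<in> space M \<Longrightarrow> t \<omega> \<le> 1"
    and step_lipschitz: "\<And>\<omega> x y. \<omega> \<in> space M \<Longrightarrow> x \<in> E \<Longrightarrow> y \<in> E \<Longrightarrow> d (P \<omega> x) (P \<omega> y) \<le> t \<omega> * d x y"
    and step_diameter: "\<And>\<omega> x y. \<omega> \<in> space M \<Longrightarrow> t \<omega> \<le> q \<Longrightarrow> x \<in> E \<Longrightarrow> y \<in> E \<Longrightarrow> d (P \<omega> x) (P \<omega> y) \<le> C"
    and q: "0 \<le> q" "q < 1" and C: "0 \<le> C"
    and hit_pos: "0 < prob {\<omega> \<in> space M. t \<omega> \<le> q}"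
begin

abbreviation B :: "'a measure" where
  "B \<equiv> sigma E {W. openin mtopology W}"

lemma measurable_V_M: "f \<in> measurable V N \<Longrightarrow> f \<in> measurable M N"
  using sets_V by (auto simp: measurable_def space_V)

lemma measurable_F_M: "f \<in> measurable F N \<Longrightarrow> f \<in> measurable M N"
  using sets_F by (auto simp: measurable_def space_F)

lemma t_measurable [measurable]: "t \<in> borel_measurable M"
  by (rule measurable_V_M[OF t_measurable_V])

lemma step_in: "\<omega> \<in> space M \<Longrightarrow> x \<in> E \<Longrightarrow> P \<omega> x \<in> E"
  using measurable_space[OF step_measurable, of "(\<omega>, x)"]
  by (simp add: space_pair_measure space_V space_sigma_open)

section \<open>Random orbits and the diameters of their images\<close>

primrec orbit :: "nat \<Rightarrow> 'w \<Rightarrow> 'a \<Rightarrow> 'a" where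
  "orbit 0 \<omega> x = x"
| "orbit (Suc n) \<omega> x = P (\<theta> (int n) \<omega>) (orbit n \<omega> x)"

lemma orbit_in: "\<omega> \<in> space M \<Longrightarrow> x \<in> E \<Longrightarrow> orbit n \<omega> x \<in> E"
  by (induction n) (auto intro: step_in)

lemma orbit_add:
  "\<omega> \<in> space M \<Longrightarrow> orbit (n + m) \<omega> x = orbit n (\<theta> (int m) \<omega>) (orbit m \<omega> x)"
  by (induction n) (auto simp: flow_add)

text \<open>Lengthening a pullback orbit prepends steps in the remoter past and leaves the last
  \<open>m\<close> steps unchanged. This is why the images of \<open>E\<close> are nested.\<close>

lemma orbit_from_past:
  assumes "\<omega> \<in> space M" "m \<le> n"
  shows "orbit n (\<theta> (- int n) \<omega>) x
    = orbit m (\<theta> (- int m) \<omega>) (orbit (n - m) (\<theta> (- int n) \<omega>) x)"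
  using orbit_add[of "\<theta> (- int n) \<omega>" m "n - m" x] assms by (simp add: flow_add)

lemma orbit_nonexpansive:
  assumes w: "\<omega> \<in> space M" and xy: "x \<in> E" "y \<in> E"
  shows "d (orbit n \<omega> x) (orbit n \<omega> y) \<le> d x y"
proof (induction n)
  case (Suc n)
  let ?w = "\<theta> (int n) \<omega>"
  have "d (orbit (Suc n) \<omega> x) (orbit (Suc n) \<omega> y) \<le> t ?w * d (orbit n \<omega> x) (orbit n \<omega> y)"
    using step_lipschitz w xy orbit_in by simp
  also have "\<dots> \<le> 1 * d (orbit n \<omega> x) (orbit n \<omega> y)"
    using t_le_1 w by (intro mult_right_mono) auto
  finally show ?case using Suc.IH by simp
qed simp

text \<open>The step at time \<open>k\<close> resets the diameter to at most \<open>C\<close>,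
  whatever happened before, so only factors strictly after \<open>k\<close> count.\<close>

lemma orbit_diameter_after_hit:
  assumes w: "\<omega> \<in> space M" and k: "k < n" "t (\<theta> (int k) \<omega>) \<le> q" and xy: "x \<in> E" "y \<in> E"
  shows "d (orbit n \<omega> x) (orbit n \<omega> y) \<le> C * (\<Prod>j\<in>{k<..<n}. t (\<theta> (int j) \<omega>))"
  using k(1)
proof (induction n)
  case (Suc n)
  show ?case
  proof (cases "k = n")
    case True
    have "d (orbit (Suc n) \<omega> x) (orbit (Suc n) \<omega> y) \<le> C"
      using step_diameter[of "\<theta> (int n) \<omega>"] k(2) True w xy orbit_in by simp
    moreover have "{k<..<Suc n} = {}" using True by auto
    ultimately show ?thesis by simp
  next
    case False
    then have kn: "k < n" using Suc.prems by simp
    let ?w = "\<theta> (int n) \<omega>"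
    have "d (orbit (Suc n) \<omega> x) (orbit (Suc n) \<omega> y) \<le> t ?w * d (orbit n \<omega> x) (orbit n \<omega> y)"
      using step_lipschitz w xy orbit_in by simp
    also have "\<dots> \<le> t ?w * (C * (\<Prod>j\<in>{k<..<n}. t (\<theta> (int j) \<omega>)))"
      using Suc.IH[OF kn] t_nonneg w by (intro mult_left_mono) auto
    also have "\<dots> = C * (\<Prod>j\<in>insert n {k<..<n}. t (\<theta> (int j) \<omega>))" by simp
    also have "insert n {k<..<n} = {k<..<Suc n}" using kn by auto
    finally show ?thesis .
  qed
qed simp

section \<open>Counting the steps with factor at most \<open>q\<close>\<close>

definition hit :: "'w \<Rightarrow> real" where
  "hit \<omega> = (if t \<omega> \<le> q then 1 else 0)"

lemma hit_measurable_V: "hit \<in> borel_measurable V"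
proof -
  note t_measurable_V [measurable]
  show ?thesis unfolding hit_def by measurable
qed

lemma hit_measurable [measurable]: "hit \<in> borel_measurable M"
  by (rule measurable_V_M[OF hit_measurable_V])

lemma integral_hit_pos: "0 < (\<integral>\<omega>. hit \<omega> \<partial>M)"
proof -
  have "(\<integral>\<omega>. hit \<omega> \<partial>M) = (\<integral>\<omega>. indicator {\<omega> \<in> space M. t \<omega> \<le> q} \<omega> \<partial>M)"
    by (intro Bochner_Integration.integral_cong) (auto simp: hit_def)
  also have "\<dots> = prob {\<omega> \<in> space M. t \<omega> \<le> q}" by (simp add: Int_absorb2)
  finally show ?thesis using hit_pos by simp
qed

text \<open>The first hit only makes the diameter finite and each further one gains a factor
  \<open>q\<close>; hence \<open>Suc m\<close> hits for \<open>q ^ m\<close>. This bound uses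
  nothing but a real-valued count and serves where convergence or measurability matters rather than
  the rate.\<close>

lemma orbit_diameter_hits:
  assumes w: "\<omega> \<in> space M" and xy: "x \<in> E" "y \<in> E"
  shows "real (Suc m) \<le> birkhoff_sum hit n \<omega> \<Longrightarrow> d (orbit n \<omega> x) (orbit n \<omega> y) \<le> q ^ m * C"
proof (induction n arbitrary: m)
  case (Suc n)
  let ?w = "\<theta> (int n) \<omega>"
  have step: "d (orbit (Suc n) \<omega> x) (orbit (Suc n) \<omega> y) \<le> t ?w * d (orbit n \<omega> x) (orbit n \<omega> y)"
    using step_lipschitz w xy orbit_in by simp
  have sum: "birkhoff_sum hit (Suc n) \<omega> = birkhoff_sum hit n \<omega> + hit ?w" by (simp add: birkhoff_sum_def)
  show ?case
  proof (cases "t ?w \<le> q")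
    case True
    show ?thesis
    proof (cases m)
      case 0
      then show ?thesis using step_diameter[OF _ True] w xy orbit_in by simp
    next
      case (Suc m')
      then have "real (Suc m') \<le> birkhoff_sum hit n \<omega>"
        using Suc Suc.prems sum hit_def[of ?w] True by simp
      from Suc.IH[OF this] have "t ?w * d (orbit n \<omega> x) (orbit n \<omega> y) \<le> q * (q ^ m' * C)"
        using True q by (intro mult_mono) auto
      then show ?thesis using step Suc by simp
    qed
  next
    case False
    then have "d (orbit n \<omega> x) (orbit n \<omega> y) \<le> q ^ m * C"
      using Suc sum hit_def[of ?w] by simp
    moreover have "t ?w * d (orbit n \<omega> x) (orbit n \<omega> y) \<le> 1 * d (orbit n \<omega> x) (orbit n \<omega> y)"
      using t_le_1 w by (intro mult_right_mono) auto
    ultimately show ?thesis using step by linarith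
  qed
qed (simp add: birkhoff_sum_def)

lemma hits_exceed:
  assumes "0 < e"
  obtains m where "q ^ m * C \<le> e"
proof (cases "C = 0")
  case True
  then show ?thesis using that[of 0] assms by simp
next
  case False
  then have "0 < C" using C by simp
  moreover obtain m where "q ^ m < e / C" using real_arch_pow_inv[of "e / C" q] q assms calculation by auto
  ultimately show ?thesis using that[of m] by (simp add: less_divide_eq less_imp_le)
qed

section \<open>The logarithmic contraction rate and its truncations\<close>

definition rate :: "'w \<Rightarrow> ennreal" where
  "rate \<omega> = e2ennreal (- ext_ln (ennreal (t \<omega>)))"

text \<open>Truncation provides the boundedness that the averaging result requires and a finite
  value where \<open>t \<omega> = 0\<close>. Monotone convergence recovers the full, possibly
  infinite, integral.\<close>

definition truncated_rate :: "nat \<Rightarrow> 'w \<Rightarrow> real" where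
  "truncated_rate N \<omega> = enn2real (min (of_nat N) (rate \<omega>))"

lemma rate_measurable [measurable]: "rate \<in> borel_measurable M"
  unfolding rate_def ext_ln_def by measurable

lemma truncated_rate_measurable [measurable]: "truncated_rate N \<in> borel_measurable M"
  unfolding truncated_rate_def by measurable

lemma ennreal_truncated_rate: "ennreal (truncated_rate N \<omega>) = min (of_nat N) (rate \<omega>)"
  unfolding truncated_rate_def
  by (rule ennreal_enn2real) (simp add: min_less_iff_disj of_nat_less_top)

lemma truncated_rate_nonneg: "0 \<le> truncated_rate N \<omega>"
  by (simp add: truncated_rate_def)

lemma truncated_rate_le: "truncated_rate N \<omega> \<le> real N"
proof -
  have "ennreal (truncated_rate N \<omega>) \<le> ennreal (real N)"
    by (simp add: ennreal_truncated_rate ennreal_of_nat_eq_real_of_nat)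
  then show ?thesis by (simp add: ennreal_le_iff)
qed

lemma t_le_exp_truncated_rate:
  assumes "\<omega> \<in> space M"
  shows "t \<omega> \<le> exp (- truncated_rate N \<omega>)"
proof (cases "t \<omega> = 0")
  case False
  then have t: "0 < t \<omega>" using t_nonneg[OF assms] by simp
  then have "rate \<omega> = ennreal (- ln (t \<omega>))" by (simp add: rate_def ext_ln_ennreal e2ennreal_ereal)
  then have "ennreal (truncated_rate N \<omega>) \<le> ennreal (- ln (t \<omega>))"
    by (simp add: ennreal_truncated_rate)
  then have "truncated_rate N \<omega> \<le> - ln (t \<omega>)"
    using t t_le_1[OF assms] by (subst (asm) ennreal_le_iff) auto
  then have "ln (t \<omega>) \<le> - truncated_rate N \<omega>" by simp
  then have "exp (ln (t \<omega>)) \<le> exp (- truncated_rate N \<omega>)" by (simp only: exp_le_cancel_iff)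
  then show ?thesis using t by simp
qed simp

text \<open>The source of \<open>\<rho> < 0\<close>: the rate is positive wherever
  \<open>t \<omega> \<le> q\<close>, as \<open>q < 1\<close>, and this event has positive
  probability.\<close>

lemma rate_integral_pos: "0 < (\<integral>\<^sup>+\<omega>. rate \<omega> \<partial>M)"
proof (rule ccontr)
  assume "\<not> 0 < (\<integral>\<^sup>+\<omega>. rate \<omega> \<partial>M)"
  then have "(\<integral>\<^sup>+\<omega>. rate \<omega> \<partial>M) = 0" by (simp add: zero_less_iff_neq_zero)
  then have "AE \<omega> in M. rate \<omega> = 0" by (subst (asm) nn_integral_0_iff_AE) auto
  moreover have "rate \<omega> \<noteq> 0" if "\<omega> \<in> space M" "t \<omega> \<le> q" for \<omega>
  proof (cases "t \<omega> = 0")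
    case True
    then show ?thesis by (simp add: rate_def ext_ln_def)
  next
    case False
    then have "0 < t \<omega>" "t \<omega> < 1" using t_nonneg[OF that(1)] that q by auto
    then show ?thesis by (simp add: rate_def ext_ln_ennreal e2ennreal_ereal ennreal_eq_0_iff not_le)
  qed
  ultimately have "AE \<omega> in M. \<omega> \<notin> {\<omega> \<in> space M. t \<omega> \<le> q}" by (elim eventually_mono) blast
  then have "prob {\<omega> \<in> space M. t \<omega> \<le> q} = 0" by (subst prob_eq_0) auto
  then show False using hit_pos by simp
qed

lemma truncated_rate_integral:
  assumes s: "0 \<le> s" "ennreal s < (\<integral>\<^sup>+\<omega>. rate \<omega> \<partial>M)"
  obtains N where "s < (\<integral>\<omega>. truncated_rate N \<omega> \<partial>M)"
proof -
  have "(SUP N. min (of_nat N) r) = r" for r :: ennreal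
  proof (cases "r = top")
    case True
    then show ?thesis by (simp add: ennreal_SUP_of_nat_eq_top)
  next
    case False
    then obtain N :: nat where "r < of_nat N" using ennreal_Ex_less_of_nat[of r] by (auto simp: less_top)
    then have "r \<le> of_nat N" by simp
    then show ?thesis by (intro antisym SUP_least SUP_upper2[of N]) auto
  qed
  then have "(\<integral>\<^sup>+\<omega>. rate \<omega> \<partial>M) = (\<integral>\<^sup>+\<omega>. (SUP N. min (of_nat N) (rate \<omega>)) \<partial>M)" by simp
  also have "\<dots> = (SUP N. \<integral>\<^sup>+\<omega>. min (of_nat N) (rate \<omega>) \<partial>M)"
    by (rule nn_integral_monotone_convergence_SUP)
      (auto simp: incseq_def le_fun_def simp del: min.bounded_iff intro!: min.mono)
  finally obtain N where "ennreal s < (\<integral>\<^sup>+\<omega>. min (of_nat N) (rate \<omega>) \<partial>M)"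
    using s(2) by (auto simp: less_SUP_iff)
  also have "\<dots> = (\<integral>\<^sup>+\<omega>. ennreal (truncated_rate N \<omega>) \<partial>M)" by (simp add: ennreal_truncated_rate)
  also have "\<dots> = ennreal (\<integral>\<omega>. truncated_rate N \<omega> \<partial>M)"
    by (intro nn_integral_eq_integral integrable_const_bound[where B="real N"])
      (auto simp: truncated_rate_nonneg truncated_rate_le)
  finally show thesis using s(1) that by (simp add: ennreal_less_iff)
qed

section \<open>Exponential decay of image diameters\<close>

lemma prod_le_exp:
  assumes "\<omega> \<in> space M"
  shows "(\<Prod>j\<in>J. t (\<theta> (int j) \<omega>)) \<le> exp (- (\<Sum>j\<in>J. truncated_rate N (\<theta> (int j) \<omega>)))"
proof (cases "finite J")
  case True
  have "(\<Prod>j\<in>J. t (\<theta> (int j) \<omega>)) \<le> (\<Prod>j\<in>J. exp (- truncated_rate N (\<theta> (int j) \<omega>)))"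
    using assms by (intro prod_mono) (auto intro: t_nonneg t_le_exp_truncated_rate)
  then show ?thesis using True by (simp add: exp_sum sum_negf[symmetric])
qed simp

text \<open>One hit at a time \<open>k\<close> not depending on \<open>n\<close> suffices: the rates
  up to time \<open>k\<close> add up to a constant, for which the gap between \<open>s\<close> and
  the average rate pays.\<close>

lemma forward_contraction:
  assumes s: "0 \<le> s" "ennreal s < (\<integral>\<^sup>+\<omega>. rate \<omega> \<partial>M)"
  shows "AE \<omega> in M. \<forall>\<^sub>F n in sequentially. \<forall>x\<in>E. \<forall>y\<in>E.
    d (orbit n \<omega> x) (orbit n \<omega> y) \<le> exp (- s * real n)"
proof -
  obtain N where "s < (\<integral>\<omega>. truncated_rate N \<omega> \<partial>M)" using truncated_rate_integral[OF s] .
  then obtain c where c: "s < c" "c < (\<integral>\<omega>. truncated_rate N \<omega> \<partial>M)" using dense by blast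
  let ?f = "truncated_rate N"
  have "AE \<omega> in M. \<forall>\<^sub>F n in sequentially. c * real n < birkhoff_sum ?f n \<omega>"
    by (rule birkhoff_sum_lower_bound[where b="real N"])
      (auto simp: c truncated_rate_nonneg truncated_rate_le)
  \<comment> \<open>A single hit is enough here, so the trivial threshold \<open>0\<close> is
    used.\<close>
  moreover have "AE \<omega> in M. \<forall>\<^sub>F n in sequentially. 0 * real n < birkhoff_sum hit n \<omega>"
    by (rule birkhoff_sum_lower_bound[where b=1]) (auto simp: hit_def[abs_def] integral_hit_pos[unfolded hit_def[abs_def]])
  ultimately show ?thesis using AE_space
  proof eventually_elim
    case (elim \<omega>)
    then have w: "\<omega> \<in> space M" by simp
    obtain n0 where "0 < birkhoff_sum hit n0 \<omega>"
      using elim(2) by (auto simp: eventually_sequentially)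
    then obtain k where k: "hit (\<theta> (int k) \<omega>) > 0"
      unfolding birkhoff_sum_def by (meson sum_nonpos not_le)
    then have k: "t (\<theta> (int k) \<omega>) \<le> q" by (auto simp: hit_def split: if_splits)
    \<comment> \<open>\<open>K\<close> combines the diameter after the hit with the rates up to and
      including time \<open>k\<close>, which enter the Birkhoff sum but not the product.\<close>
    define K where "K = C * exp (birkhoff_sum ?f (Suc k) \<omega>)"
    have "0 < c - s" using c by simp
    from eventually_le_exp[OF this, of K] elim(1) eventually_gt_at_top[of k]
    show ?case
    proof eventually_elim
      case (elim n)
      have split: "{..<n} = {..<Suc k} \<union> {k<..<n}" using \<open>k < n\<close> by auto
      have "birkhoff_sum ?f n \<omega> = birkhoff_sum ?f (Suc k) \<omega> + (\<Sum>j\<in>{k<..<n}. ?f (\<theta> (int j) \<omega>))"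
        unfolding birkhoff_sum_def split by (rule sum.union_disjoint) auto
      then have sum: "- (\<Sum>j\<in>{k<..<n}. ?f (\<theta> (int j) \<omega>)) \<le> birkhoff_sum ?f (Suc k) \<omega> - c * real n"
        using elim by simp
      have "d (orbit n \<omega> x) (orbit n \<omega> y) \<le> exp (- s * real n)" if "x \<in> E" "y \<in> E" for x y
      proof -
        have "d (orbit n \<omega> x) (orbit n \<omega> y) \<le> C * (\<Prod>j\<in>{k<..<n}. t (\<theta> (int j) \<omega>))"
          using orbit_diameter_after_hit[OF w \<open>k < n\<close> k that] .
        also have "\<dots> \<le> C * exp (birkhoff_sum ?f (Suc k) \<omega> - c * real n)"
          using sum C by (intro mult_left_mono order_trans[OF prod_le_exp[OF w, of _ N]]) simp_all
        also have "\<dots> = K * exp (- c * real n)" by (simp add: K_def exp_diff exp_minus divide_inverse)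
        also have "\<dots> \<le> exp ((c - s) * real n) * exp (- c * real n)"
          using elim by (intro mult_right_mono) auto
        also have "\<dots> = exp (- s * real n)" by (simp add: mult_exp_exp algebra_simps)
        finally show ?thesis .
      qed
      then show ?case by blast
    qed
  qed
qed

lemma backward_hits:
  "AE \<omega> in M. \<forall>m::nat. \<exists>n. real m \<le> birkhoff_sum hit n (\<theta> (- int n) \<omega>)"
proof -
  interpret R: ergodic_flow M "\<lambda>z. \<theta> (- z)" by (rule ergodic_flow_reverse) unfold_locales
  define p where "p = (\<integral>\<omega>. hit \<omega> \<partial>M)"
  have p: "0 < p" using integral_hit_pos by (simp add: p_def)
  have "AE \<omega> in M. \<forall>\<^sub>F n in sequentially. p / 2 * real n < R.birkhoff_sum hit n \<omega>"
    by (rule R.birkhoff_sum_lower_bound[where b=1]) (use p in \<open>auto simp: hit_def p_def\<close>)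
  then show ?thesis using AE_space
  proof eventually_elim
    case (elim \<omega>)
    then have w: "\<omega> \<in> space M" by simp
    show ?case
    proof
      fix m :: nat
      obtain n0 where n0: "\<And>n. n \<ge> n0 \<Longrightarrow> p / 2 * real n < R.birkhoff_sum hit n \<omega>"
        using elim by (auto simp: eventually_sequentially)
      \<comment> \<open>The extra \<open>1\<close> compensates for \<open>hit \<omega>\<close>: a
        reversed sum starts at time \<open>0\<close>, whereas the steps from
        \<open>\<theta> (- int n) \<omega>\<close> to \<open>\<omega>\<close> have times
        \<open>- n\<close> to \<open>- 1\<close>.\<close>
      obtain n1 :: nat where n1: "(real m + 1) / (p / 2) < real n1" using reals_Archimedean2 by blast
      define n where "n = max n0 n1"
      have "(real m + 1) / (p / 2) < real (Suc n)" using n1 by (simp add: n_def)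
      then have "real m + 1 < p / 2 * real (Suc n)" using p by (simp add: divide_less_eq mult.commute)
      also have "\<dots> < R.birkhoff_sum hit (Suc n) \<omega>" by (rule n0) (simp add: n_def)
      also have "\<dots> = hit \<omega> + (\<Sum>j<n. hit (\<theta> (- int (Suc j)) \<omega>))"
        unfolding R.birkhoff_sum_def by (subst sum.lessThan_Suc_shift) (use w in simp)
      also have "(\<Sum>j<n. hit (\<theta> (- int (Suc j)) \<omega>)) = birkhoff_sum hit n (\<theta> (- int n) \<omega>)"
        unfolding birkhoff_sum_def
        by (subst sum.nat_diff_reindex[symmetric], rule sum.cong)
          (use w in \<open>auto simp: flow_add of_nat_diff algebra_simps intro!: arg_cong[where f=hit] arg_cong2[where f=\<theta>]\<close>)
      finally have "real m \<le> birkhoff_sum hit n (\<theta> (- int n) \<omega>)" by (simp add: hit_def split: if_splits)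
      then show "\<exists>n. real m \<le> birkhoff_sum hit n (\<theta> (- int n) \<omega>)" by blast
    qed
  qed
qed

text \<open>A step with bounded image diameter must be applied early for most of the factors \<open>t\<close> to
  be used after it; the frequency of such steps is positive, so one occurs among the first
  \<open>\<epsilon> n\<close> of the \<open>n\<close> steps.\<close>

lemma backward_contraction:
  assumes s: "0 \<le> s" "ennreal s < (\<integral>\<^sup>+\<omega>. rate \<omega> \<partial>M)"
  shows "AE \<omega> in M. \<forall>\<^sub>F n in sequentially. \<forall>x\<in>E. \<forall>y\<in>E.
    d (orbit n (\<theta> (- int n) \<omega>) x) (orbit n (\<theta> (- int n) \<omega>) y) \<le> exp (- s * real n)"
proof -
  interpret R: ergodic_flow M "\<lambda>z. \<theta> (- z)" by (rule ergodic_flow_reverse) unfold_locales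
  obtain N where "s < (\<integral>\<omega>. truncated_rate N \<omega> \<partial>M)" using truncated_rate_integral[OF s] .
  then obtain c where c: "s < c" "c < (\<integral>\<omega>. truncated_rate N \<omega> \<partial>M)" using dense by blast
  obtain s' where s': "s < s'" "s' < c" using dense[OF c(1)] by blast
  let ?f = "truncated_rate N"
  define p where "p = (\<integral>\<omega>. hit \<omega> \<partial>M)"
  have p: "0 < p" using integral_hit_pos by (simp add: p_def)
  \<comment> \<open>As \<open>c * a = s'\<close>, contraction at average rate \<open>c\<close> over
    the last \<open>a * n\<close> steps alone gives rate \<open>s'\<close> over all
    \<open>n\<close>. The remaining steps are left for finding a hit.\<close>
  define a where "a = s' / c"
  have a: "0 < a" "a < 1" using s s' by (auto simp: a_def)
  \<comment> \<open>Small enough that the hits at the most recent \<open>a * n\<close> times, of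
    frequency below \<open>p + \<delta>\<close>, are fewer than those at all \<open>n\<close> times,
    of frequency above \<open>p - \<delta>\<close>.\<close>
  define \<delta> where "\<delta> = p * (1 - a) / 2"
  have \<delta>: "0 < \<delta>" using p a by (simp add: \<delta>_def)
  have pa: "(p + \<delta>) * a \<le> p - \<delta>"
  proof -
    have "0 \<le> p * (1 - a) * (1 - a) / 2" using p a by simp
    also have "\<dots> = p - \<delta> - (p + \<delta>) * a" by (simp add: \<delta>_def field_simps)
    finally show ?thesis by simp
  qed
  define m where "m n = nat \<lfloor>a * real n\<rfloor>" for n
  have m: "real (m n) \<le> a * real n" "a * real n - 1 < real (m n)" for n
    using a by (simp_all add: m_def)
  have m_at_top: "filterlim m sequentially sequentially"
    unfolding filterlim_at_top eventually_sequentially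
  proof
    fix Z :: nat
    obtain n0 :: nat where "(real Z + 1) / a < real n0" using reals_Archimedean2 by blast
    then have "real Z + 1 < a * real n" if "n \<ge> n0" for n
      using that a by (simp add: divide_less_eq mult.commute) (meson less_le_trans mult_left_mono of_nat_le_iff less_imp_le)
    then have "Z \<le> m n" if "n \<ge> n0" for n using that m(2)[of n] by fastforce
    then show "\<exists>n0. \<forall>n\<ge>n0. Z \<le> m n" by blast
  qed
  have "AE \<omega> in M. \<forall>\<^sub>F n in sequentially. c * real n < R.birkhoff_sum ?f n \<omega>"
    by (rule R.birkhoff_sum_lower_bound[where b="real N"])
      (auto simp: c truncated_rate_nonneg truncated_rate_le)
  moreover have "AE \<omega> in M. \<forall>\<^sub>F n in sequentially. (p - \<delta>) * real n < R.birkhoff_sum hit n \<omega>"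
    by (rule R.birkhoff_sum_lower_bound[where b=1]) (use \<delta> in \<open>auto simp: hit_def p_def\<close>)
  \<comment> \<open>An upper bound for the frequency of hits, obtained from the lower bound for
    \<open>- hit\<close>.\<close>
  moreover have "AE \<omega> in M. \<forall>\<^sub>F n in sequentially. (- p - \<delta>) * real n < R.birkhoff_sum (\<lambda>\<omega>. - hit \<omega>) n \<omega>"
    by (rule R.birkhoff_sum_lower_bound[where b=1]) (use \<delta> in \<open>auto simp: hit_def p_def\<close>)
  ultimately show ?thesis using AE_space
  proof eventually_elim
    case (elim \<omega>)
    then have w: "\<omega> \<in> space M" by simp
    \<comment> \<open>\<open>N\<close> bounds the truncated rate at time \<open>0\<close>, which
      belongs to the reversed sum but not to the orbit; \<open>c\<close> pays for rounding
      \<open>a * n\<close> down to \<open>m n\<close>.\<close>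
    define L where "L = C * exp (real N + c)"
    have "0 < s' - s" using s' by simp
    from eventually_le_exp[OF this, of L] elim(2)
      eventually_compose_filterlim[OF elim(3) m_at_top] eventually_compose_filterlim[OF elim(1) m_at_top]
      eventually_compose_filterlim[OF eventually_ge_at_top[of 1] m_at_top]
    show ?case
    proof eventually_elim
      case (elim n)
      have "R.birkhoff_sum hit (m n) \<omega> < (p + \<delta>) * real (m n)"
        using elim(3) by (simp add: R.birkhoff_sum_def sum_negf algebra_simps)
      also have "\<dots> \<le> (p + \<delta>) * (a * real n)" using p \<delta> m by (intro mult_left_mono) auto
      also have "\<dots> \<le> (p - \<delta>) * real n" using mult_right_mono[OF pa, of "real n"] by (simp add: mult.assoc)
      also have "\<dots> < R.birkhoff_sum hit n \<omega>" using elim by simp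
      finally have less: "R.birkhoff_sum hit (m n) \<omega> < R.birkhoff_sum hit n \<omega>" .
      have "\<exists>k. m n \<le> k \<and> k < n \<and> t (\<theta> (- int k) \<omega>) \<le> q"
      proof (rule ccontr)
        assume "\<not> ?thesis"
        then have no: "i < m n" if "i < n" "t (\<theta> (- int i) \<omega>) \<le> q" for i
          using that by (meson not_le)
        have "R.birkhoff_sum hit n \<omega> \<le> (\<Sum>j\<in>{..<n} \<inter> {..<m n}. hit (\<theta> (- int j) \<omega>))"
          unfolding R.birkhoff_sum_def
          by (rule eq_refl, rule sum.mono_neutral_right) (auto simp: hit_def no)
        also have "\<dots> \<le> R.birkhoff_sum hit (m n) \<omega>"
          unfolding R.birkhoff_sum_def by (rule sum_mono2) (auto simp: hit_def)
        finally show False using less by simp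
      qed
      then obtain k where k: "m n \<le> k" "k < n" "t (\<theta> (- int k) \<omega>) \<le> q" by blast
      then have k1: "1 \<le> k" using elim by simp
      \<comment> \<open>Seen from \<open>w'\<close>, the time \<open>- k\<close> is step
        \<open>n - k\<close>. The steps after it have times \<open>- (k - 1)\<close> to
        \<open>- 1\<close>; these include \<open>- (m n - 1)\<close> to \<open>- 1\<close> because
        \<open>m n \<le> k\<close>.\<close>
      define w' where "w' = \<theta> (- int n) \<omega>"
      have w': "w' \<in> space M" "\<And>z. \<theta> z w' = \<theta> (z - int n) \<omega>"
        using w by (auto simp: w'_def flow_add)
      have tk: "t (\<theta> (int (n - k)) w') \<le> q" using k by (simp add: w'(2) of_nat_diff)
      have "(\<Sum>j\<in>{1..<m n}. ?f (\<theta> (- int j) \<omega>)) \<le> (\<Sum>j\<in>{1..<k}. ?f (\<theta> (- int j) \<omega>))"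
        using k by (intro sum_mono2) (auto simp: truncated_rate_nonneg)
      also have "\<dots> = (\<Sum>j\<in>{n - k<..<n}. ?f (\<theta> (int j) w'))"
        by (rule sum.reindex_bij_witness[where i="\<lambda>j. n - j" and j="\<lambda>j. n - j"])
          (use k in \<open>auto simp: w' of_nat_diff\<close>)
      finally have sum1: "(\<Sum>j\<in>{1..<m n}. ?f (\<theta> (- int j) \<omega>)) \<le> (\<Sum>j\<in>{n - k<..<n}. ?f (\<theta> (int j) w'))" .
      have "{..<m n} = insert 0 {1..<m n}" using elim by auto
      then have "R.birkhoff_sum ?f (m n) \<omega> = ?f \<omega> + (\<Sum>j\<in>{1..<m n}. ?f (\<theta> (- int j) \<omega>))"
        using w unfolding R.birkhoff_sum_def by simp
      then have sum2: "c * real (m n) - real N \<le> (\<Sum>j\<in>{n - k<..<n}. ?f (\<theta> (int j) w'))"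
        using sum1 elim(4) truncated_rate_le[of N \<omega>] by linarith
      have "c * (a * real n - 1) \<le> c * real (m n)" using m[of n] s s' by (intro mult_left_mono) auto
      moreover have "c * (a * real n - 1) = s' * real n - c" using s s' by (simp add: a_def field_simps)
      ultimately have sum: "- (\<Sum>j\<in>{n - k<..<n}. ?f (\<theta> (int j) w')) \<le> real N + c - s' * real n"
        using sum2 by linarith
      have "d (orbit n w' x) (orbit n w' y) \<le> exp (- s * real n)" if "x \<in> E" "y \<in> E" for x y
      proof -
        have "d (orbit n w' x) (orbit n w' y) \<le> C * (\<Prod>j\<in>{n - k<..<n}. t (\<theta> (int j) w'))"
          using orbit_diameter_after_hit[OF w'(1) _ tk that] k k1 by simp
        also have "\<dots> \<le> C * exp (real N + c - s' * real n)"
          using sum C by (intro mult_left_mono order_trans[OF prod_le_exp[OF w'(1), of _ N]]) simp_all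
        also have "\<dots> = L * exp (- s' * real n)" by (simp add: L_def exp_diff exp_minus divide_inverse)
        also have "\<dots> \<le> exp ((s' - s) * real n) * exp (- s' * real n)"
          using elim by (intro mult_right_mono) auto
        also have "\<dots> = exp (- s * real n)" by (simp add: mult_exp_exp algebra_simps)
        finally show ?thesis .
      qed
      then show ?case by (simp add: w'_def)
    qed
  qed
qed

section \<open>The pullback limit\<close>

definition base :: 'a where "base = (SOME x. x \<in> E)"

lemma base_in: "base \<in> E"
  using nonempty unfolding base_def by (simp add: some_in_eq)

text \<open>In a non-separable space the set where the pullback orbits converge need not be measurable; this
  smaller set of full measure belongs to the past \<open>\<sigma>\<close>-field.\<close>

definition recurrent :: "'w set" where
  "recurrent = {\<omega> \<in> space M. \<forall>m::nat. \<exists>n. real m \<le> birkhoff_sum hit n (\<theta> (- int n) \<omega>)}"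

text \<open>The default \<open>base\<close> makes the map total into \<open>E\<close>. On
  \<open>recurrent\<close> the limit exists and is unique, so the choice operator selects nothing
  arbitrary.\<close>

definition pullback :: "'w \<Rightarrow> 'a" where
  "pullback \<omega> = (if \<omega> \<in> recurrent
     then SOME l. limitin mtopology (\<lambda>n. orbit n (\<theta> (- int n) \<omega>) base) l sequentially else base)"

text \<open>Once the last \<open>n0\<close> steps contain \<open>Suc m\<close> hits, all longer
  pullback orbits end in the image of \<open>E\<close> under these steps, of diameter at most
  \<open>q ^ m * C\<close>; so the sequence is Cauchy.\<close>

lemma pullback_limit:
  assumes "\<omega> \<in> recurrent"
  shows "limitin mtopology (\<lambda>n. orbit n (\<theta> (- int n) \<omega>) base) (pullback \<omega>) sequentially"
proof -
  have w: "\<omega> \<in> space M" using assms by (simp add: recurrent_def)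
  let ?o = "\<lambda>n. orbit n (\<theta> (- int n) \<omega>) base"
  have "MCauchy ?o"
    unfolding MCauchy_def
  proof (intro conjI allI impI)
    show "range ?o \<subseteq> E" using orbit_in base_in w by auto
    fix e :: real assume "0 < e"
    then obtain m where m: "q ^ m * C \<le> e / 2" using hits_exceed[of "e / 2"] by auto
    obtain n0 where n0: "real (Suc m) \<le> birkhoff_sum hit n0 (\<theta> (- int n0) \<omega>)"
      using assms unfolding recurrent_def by blast
    have "d (?o n) (?o n') < e" if "n0 \<le> n" "n0 \<le> n'" for n n'
    proof -
      have "d (?o n) (?o n') \<le> q ^ m * C"
        unfolding orbit_from_past[OF w that(1)] orbit_from_past[OF w that(2)]
        using w base_in orbit_in by (intro orbit_diameter_hits n0) auto
      then show ?thesis using m \<open>0 < e\<close> by simp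
    qed
    then show "\<exists>N. \<forall>n n'. N \<le> n \<longrightarrow> N \<le> n' \<longrightarrow> d (?o n) (?o n') < e" by blast
  qed
  then have "\<exists>l. limitin mtopology ?o l sequentially" using complete by (simp add: mcomplete_def)
  from someI_ex[OF this] show ?thesis using assms by (simp add: pullback_def)
qed

lemma pullback_in: "pullback \<omega> \<in> E"
  using pullback_limit[of \<omega>] base_in by (cases "\<omega> \<in> recurrent") (auto simp: limitin_metric pullback_def)

text \<open>Turns the spread of an image into a distance from the limit: longer pullback orbits stay
  in the image at stage \<open>n\<close>, so the bound passes to their limit.\<close>

lemma pullback_distance:
  assumes w: "\<omega> \<in> recurrent" and x: "x \<in> E"
    and e: "\<And>y. y \<in> E \<Longrightarrow> d (orbit n (\<theta> (- int n) \<omega>) x) (orbit n (\<theta> (- int n) \<omega>) y) \<le> e"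
  shows "d (orbit n (\<theta> (- int n) \<omega>) x) (pullback \<omega>) \<le> e"
proof (rule field_le_epsilon)
  fix e' :: real assume "0 < e'"
  have wM: "\<omega> \<in> space M" using w by (simp add: recurrent_def)
  let ?o = "\<lambda>n. orbit n (\<theta> (- int n) \<omega>)"
  have "\<forall>\<^sub>F k in sequentially. d (?o k base) (pullback \<omega>) < e'"
    using pullback_limit[OF w] \<open>0 < e'\<close> unfolding limitin_metric by (auto elim: eventually_mono)
  then obtain k where k: "n \<le> k" "d (?o k base) (pullback \<omega>) < e'"
    unfolding eventually_sequentially by (meson nle_le)
  have "d (?o n x) (?o k base) \<le> e"
    unfolding orbit_from_past[OF wM k(1)] using orbit_in wM base_in by (intro e) auto
  then show "d (?o n x) (pullback \<omega>) \<le> e + e'"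
    using triangle[of "?o n x" "?o k base" "pullback \<omega>"] k orbit_in wM x base_in pullback_in by force
qed

text \<open>\<open>orbit m \<omega>\<close> is continuous, being nonexpansive, and carries the
  pullback sequence at \<open>\<omega>\<close> to that at \<open>\<theta> (int m) \<omega>\<close>
  with the index shifted by \<open>m\<close>. Recurrence at both points ensures that both values of
  \<open>pullback\<close> are limits.\<close>

lemma pullback_equivariant:
  assumes w: "\<omega> \<in> recurrent" and w': "\<theta> (int m) \<omega> \<in> recurrent"
  shows "orbit m \<omega> (pullback \<omega>) = pullback (\<theta> (int m) \<omega>)"
proof (rule limitin_metric_unique)
  have wM: "\<omega> \<in> space M" using w by (simp add: recurrent_def)
  let ?o = "\<lambda>n. orbit n (\<theta> (- int n) \<omega>) base"
  let ?o' = "\<lambda>n. orbit n (\<theta> (- int n) (\<theta> (int m) \<omega>)) base"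
  have eq: "?o' (n + m) = orbit m \<omega> (?o n)" for n
    using orbit_add[of "\<theta> (- int n) \<omega>" m n base] wM by (simp add: flow_add add.commute)
  show "limitin mtopology (\<lambda>n. ?o' (n + m)) (pullback (\<theta> (int m) \<omega>)) sequentially"
    using pullback_limit[OF w'] by (rule limitin_sequentially_offset)
  show "limitin mtopology (\<lambda>n. ?o' (n + m)) (orbit m \<omega> (pullback \<omega>)) sequentially"
    unfolding eq limitin_metric
  proof (intro conjI allI impI)
    show "orbit m \<omega> (pullback \<omega>) \<in> E" using orbit_in wM pullback_in by simp
    fix e :: real assume "0 < e"
    then have "\<forall>\<^sub>F n in sequentially. ?o n \<in> E \<and> d (?o n) (pullback \<omega>) < e"
      using pullback_limit[OF w] unfolding limitin_metric by blast
    then show "\<forall>\<^sub>F n in sequentially. orbit m \<omega> (?o n) \<in> E \<and> d (orbit m \<omega> (?o n)) (orbit m \<omega> (pullback \<omega>)) < e"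
    proof eventually_elim
      case (elim n)
      then show ?case using orbit_nonexpansive[OF wM, of "?o n" "pullback \<omega>" m] orbit_in wM pullback_in by force
    qed
  qed
qed simp

section \<open>Measurability of the pullback limit\<close>

lemma step_compose_measurable:
  assumes "g \<in> measurable N V" "h \<in> measurable N B"
  shows "(\<lambda>z. P (g z) (h z)) \<in> measurable N B"
  using measurable_compose[OF measurable_Pair[OF assms] step_measurable] by simp

lemma recurrent_in_past: "recurrent \<in> sets F"
proof -
  have "recurrent = {\<omega> \<in> space F. \<forall>m::nat. \<exists>n. real m \<le> (\<Sum>j<n. hit (\<theta> (int j - int n) \<omega>))}"
    by (auto simp: recurrent_def space_F birkhoff_sum_def flow_add)
  moreover have "(\<lambda>\<omega>. \<Sum>j<n. hit (\<theta> (int j - int n) \<omega>)) \<in> borel_measurable F" for n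
  proof (rule borel_measurable_sum)
    fix j assume "j \<in> {..<n}"
    \<comment> \<open>The times \<open>j - n\<close> with \<open>j < n\<close> are strictly
      negative, hence covered by \<open>past\<close>.\<close>
    then have eq: "int j - int n = - int (n - j)" and "1 \<le> n - j" by (auto simp: of_nat_diff)
    from measurable_compose[OF past[OF this(2)] hit_measurable_V]
    show "(\<lambda>\<omega>. hit (\<theta> (int j - int n) \<omega>)) \<in> borel_measurable F" unfolding eq .
  qed
  ultimately show ?thesis by simp
qed

lemma pullback_measurable_past: "pullback \<in> measurable F B"
proof -
  have const: "(\<lambda>_. base) \<in> measurable F B" using base_in by (simp add: space_sigma_open)
  \<comment> \<open>The starting time \<open>- n\<close> stays fixed while the length
    \<open>k\<close> grows: along the diagonal, passing from \<open>n\<close> to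
    \<open>Suc n\<close> would prepend a step, and the recursion of \<open>orbit\<close> could not
    be used.\<close>
  have "(\<lambda>\<omega>. orbit k (\<theta> (- int n) \<omega>) base) \<in> measurable F B" if "k \<le> n" for k n
    using that
  proof (induction k)
    case (Suc k)
    have "- int (n - k) = int k - int n" "1 \<le> n - k" using Suc.prems by (auto simp: of_nat_diff)
    then have "(\<lambda>\<omega>. \<theta> (int k - int n) \<omega>) \<in> measurable F V" using past[of "n - k"] by simp
    from step_compose_measurable[OF this Suc.IH] Suc.prems
    have "(\<lambda>\<omega>. P (\<theta> (int k - int n) \<omega>) (orbit k (\<theta> (- int n) \<omega>) base)) \<in> measurable F B" by simp
    then show ?case by (rule measurable_cong[THEN iffD1, rotated]) (simp add: space_F flow_add)
  qed (simp add: const)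
  \<comment> \<open>Resetting to \<open>base\<close> off \<open>recurrent\<close> makes the sequence
    converge at every point, as \<open>measurable_limit\<close> demands.\<close>
  then have "(\<lambda>\<omega>. if \<omega> \<in> recurrent then orbit n (\<theta> (- int n) \<omega>) base else base) \<in> measurable F B" for n
    using const recurrent_in_past by (intro measurable_If_set) (auto simp: space_F recurrent_def)
  then show ?thesis
  proof (rule measurable_limit)
    fix \<omega>
    show "limitin mtopology (\<lambda>n. if \<omega> \<in> recurrent then orbit n (\<theta> (- int n) \<omega>) base else base) (pullback \<omega>) sequentially"
      using pullback_limit[of \<omega>] base_in by (cases "\<omega> \<in> recurrent") (auto simp: pullback_def)
  qed
qed

lemma pullback_measurable: "pullback \<in> measurable M B"
  by (rule measurable_F_M[OF pullback_measurable_past])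

lemma AE_recurrent: "AE \<omega> in M. \<omega> \<in> recurrent"
  using backward_hits AE_space by eventually_elim (simp add: recurrent_def)

lemma AE_recurrent_forward: "AE \<omega> in M. \<theta> z \<omega> \<in> recurrent"
proof -
  have "recurrent \<in> sets M" using recurrent_in_past sets_F by auto
  then show ?thesis
    using AE_recurrent by (subst (asm) distr_flow[of z, symmetric], subst (asm) AE_distr_iff) auto
qed

section \<open>Invariant measures of the skew product\<close>

lemma orbit_measurable: "(\<lambda>z. orbit n (fst z) (snd z)) \<in> measurable (M \<Otimes>\<^sub>M B) B"
proof (induction n)
  case (Suc n)
  have "(\<lambda>\<omega>. \<omega>) \<in> measurable M V" by (rule measurable_V_M) simp
  then have "(\<lambda>z. \<theta> (int n) (fst z)) \<in> measurable (M \<Otimes>\<^sub>M B) V"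
    using measurable_compose[OF measurable_compose[OF measurable_fst flow_measurable]] by blast
  from step_compose_measurable[OF this Suc.IH] show ?case by simp
qed simp

definition skew :: "nat \<Rightarrow> 'w \<times> 'a \<Rightarrow> 'w \<times> 'a" where
  "skew n = (\<lambda>(\<omega>, x). (\<theta> (int n) \<omega>, orbit n \<omega> x))"

lemma skew_measurable: "skew n \<in> measurable (M \<Otimes>\<^sub>M B) (M \<Otimes>\<^sub>M B)"
proof -
  have "(\<lambda>z. (\<theta> (int n) (fst z), orbit n (fst z) (snd z))) \<in> measurable (M \<Otimes>\<^sub>M B) (M \<Otimes>\<^sub>M B)"
    by (intro measurable_Pair orbit_measurable measurable_compose[OF measurable_fst flow_measurable])
  then show ?thesis by (simp add: skew_def case_prod_beta')
qed

definition graph_measure :: "('w \<times> 'a) measure" where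
  "graph_measure = distr M (M \<Otimes>\<^sub>M B) (\<lambda>\<omega>. (\<omega>, pullback \<omega>))"

lemma sets_graph_measure: "sets graph_measure = sets (M \<Otimes>\<^sub>M B)"
  by (simp add: graph_measure_def)

lemma graph_measurable [measurable]: "(\<lambda>\<omega>. (\<omega>, pullback \<omega>)) \<in> measurable M (M \<Otimes>\<^sub>M B)"
  by (intro measurable_Pair pullback_measurable) simp

lemma prob_space_graph_measure: "prob_space graph_measure"
  unfolding graph_measure_def by (rule prob_space_distr) (rule graph_measurable)

lemma fst_graph_measure: "distr graph_measure M fst = M"
proof -
  have "distr graph_measure M fst = distr M M (fst \<circ> (\<lambda>\<omega>. (\<omega>, pullback \<omega>)))"
    unfolding graph_measure_def by (rule distr_distr) (auto intro: graph_measurable)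
  then show ?thesis by (simp add: comp_def distr_id)
qed

text \<open>By equivariance, the graph map followed by \<open>skew n\<close> agrees almost
  everywhere with \<open>\<theta> (int n)\<close> followed by the graph map, and
  \<open>\<theta> (int n)\<close> preserves \<open>M\<close>.\<close>

lemma skew_graph_measure: "distr graph_measure graph_measure (skew n) = graph_measure"
proof -
  have "distr graph_measure graph_measure (skew n) = distr graph_measure (M \<Otimes>\<^sub>M B) (skew n)"
    by (intro distr_cong) (auto simp: sets_graph_measure)
  also have "\<dots> = distr M (M \<Otimes>\<^sub>M B) (skew n \<circ> (\<lambda>\<omega>. (\<omega>, pullback \<omega>)))"
    unfolding graph_measure_def by (rule distr_distr[OF skew_measurable graph_measurable])
  also have "\<dots> = distr M (M \<Otimes>\<^sub>M B) ((\<lambda>\<omega>. (\<omega>, pullback \<omega>)) \<circ> \<theta> (int n))"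
  proof (rule distr_cong_AE)
    show "skew n \<circ> (\<lambda>\<omega>. (\<omega>, pullback \<omega>)) \<in> measurable M (M \<Otimes>\<^sub>M B)"
      by (rule measurable_comp[OF graph_measurable skew_measurable])
    show "(\<lambda>\<omega>. (\<omega>, pullback \<omega>)) \<circ> \<theta> (int n) \<in> measurable M (M \<Otimes>\<^sub>M B)"
      by (rule measurable_comp[OF flow_measurable graph_measurable])
    show "AE \<omega> in M. (skew n \<circ> (\<lambda>\<omega>. (\<omega>, pullback \<omega>))) \<omega> = ((\<lambda>\<omega>. (\<omega>, pullback \<omega>)) \<circ> \<theta> (int n)) \<omega>"
      using AE_recurrent AE_recurrent_forward[of "int n"]
      by eventually_elim (simp add: skew_def pullback_equivariant)
  qed simp_all
  also have "\<dots> = distr (distr M M (\<theta> (int n))) (M \<Otimes>\<^sub>M B) (\<lambda>\<omega>. (\<omega>, pullback \<omega>))"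
    by (rule distr_distr[symmetric]) auto
  finally show ?thesis by (simp add: distr_flow graph_measure_def)
qed

lemma measure_graph_measure:
  assumes "S \<in> sets M" "W \<in> sets B"
  shows "measure graph_measure (S \<times> W) = prob {\<omega> \<in> S. pullback \<omega> \<in> W}"
proof -
  have "(\<lambda>\<omega>. (\<omega>, pullback \<omega>)) -` (S \<times> W) \<inter> space M = {\<omega> \<in> S. pullback \<omega> \<in> W}"
    using sets.sets_into_space[OF assms(1)] by auto
  then show ?thesis unfolding graph_measure_def
    using measure_distr[OF graph_measurable pair_measureI[OF assms]] by simp
qed

text \<open>Makes the squeezing of \<open>E\<close> uniform outside an event of small probability:
  the events grow with \<open>n\<close>, since hits are never lost, and hits have positive
  frequency.\<close>

lemma prob_hits_tendsto: "(\<lambda>n. prob {\<omega> \<in> space M. real m \<le> birkhoff_sum hit n \<omega>}) \<longlonglongrightarrow> 1"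
proof -
  let ?G = "\<lambda>n. {\<omega> \<in> space M. real m \<le> birkhoff_sum hit n \<omega>}"
  have G: "range ?G \<subseteq> sets M" by auto
  have "incseq ?G"
    by (rule incseq_SucI) (auto simp: birkhoff_sum_def hit_def)
  then have lim: "(\<lambda>n. prob (?G n)) \<longlonglongrightarrow> prob (\<Union>n. ?G n)" by (rule finite_Lim_measure_incseq[OF G])
  define p where "p = (\<integral>\<omega>. hit \<omega> \<partial>M)"
  have p: "0 < p" using integral_hit_pos by (simp add: p_def)
  have "AE \<omega> in M. \<forall>\<^sub>F n in sequentially. p / 2 * real n < birkhoff_sum hit n \<omega>"
    by (rule birkhoff_sum_lower_bound[where b=1]) (use p in \<open>auto simp: hit_def p_def\<close>)
  then have "AE \<omega> in M. \<omega> \<in> (\<Union>n. ?G n)" using AE_space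
  proof eventually_elim
    case (elim \<omega>)
    obtain n0 where n0: "\<And>n. n \<ge> n0 \<Longrightarrow> p / 2 * real n < birkhoff_sum hit n \<omega>"
      using elim by (auto simp: eventually_sequentially)
    obtain n1 :: nat where "real m / (p / 2) < real n1" using reals_Archimedean2 by blast
    then have "real m / (p / 2) < real (max n0 n1)" by simp
    then have "real m < p / 2 * real (max n0 n1)" using p by (simp add: divide_less_eq mult.commute)
    then have "real m \<le> birkhoff_sum hit (max n0 n1) \<omega>" using n0[of "max n0 n1"] by simp
    then show ?case using elim by blast
  qed
  then have "prob (\<Union>n. ?G n) = 1" using G by (subst prob_eq_1) auto
  then show ?thesis using lim by simp
qed

text \<open>The graph of \<open>pullback\<close> need not be measurable in the product when \<open>E\<close> is not separable, so
  an invariant measure is compared with \<open>graph_measure\<close> on rectangles \<open>S \<times> W\<close> with \<open>W\<close> open: after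
  \<open>n\<close> steps, all of \<open>E\<close> lies near \<open>pullback (\<theta> n \<omega>)\<close> except for \<open>\<omega>\<close> in a set of small probability.\<close>

lemma invariant_measure_unique:
  assumes mu: "prob_space \<mu>" "sets \<mu> = sets (M \<Otimes>\<^sub>M B)" "distr \<mu> M fst = M"
    and inv: "\<And>n. distr \<mu> \<mu> (skew n) = \<mu>"
  shows "\<mu> = graph_measure"
proof -
  interpret \<mu>: prob_space \<mu> by fact
  interpret \<nu>: prob_space graph_measure by (rule prob_space_graph_measure)
  have sp: "space \<mu> = space M \<times> E"
    using sets_eq_imp_space_eq[OF mu(2)] by (simp add: space_pair_measure space_sigma_open)
  have skew_meas: "skew n \<in> measurable \<mu> \<mu>" for n
    using skew_measurable by (simp add: measurable_cong_sets[OF mu(2) mu(2)])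
  have fst_meas: "fst \<in> measurable \<mu> M"
    by (simp add: measurable_cong_sets[OF mu(2) refl])
  have rect: "S \<times> W \<in> sets \<mu>" if "S \<in> sets M" "W \<in> sets B" for S W
    using that by (simp add: mu(2) pair_measureI)
  have E_B: "E \<in> sets B" using open_in_sigma[OF openin_topspace] by simp
  \<comment> \<open>Besides invariance, this is the information on \<open>\<mu>\<close> to work
    with: its marginal fixes its values on \<open>S \<times> E\<close>.\<close>
  have cyl: "measure \<mu> (S \<times> E) = prob S" if "S \<in> sets M" for S
  proof -
    have "fst -` S \<inter> space \<mu> = S \<times> E" using sets.sets_into_space[OF that] by (auto simp: sp)
    then show ?thesis using measure_distr[OF fst_meas that] by (simp add: mu(3))
  qed
  have pull: "measure \<mu> A = measure \<mu> (skew n -` A \<inter> space \<mu>)" if "A \<in> sets \<mu>" for A n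
    using measure_distr[OF skew_meas that, of n] by (simp add: inv)
  define D where "D n = {\<omega> \<in> space M. \<omega> \<in> recurrent \<and> \<theta> (int n) \<omega> \<in> recurrent}" for n
  have rec [measurable]: "recurrent \<in> sets M" using recurrent_in_past sets_F by auto
  have D_meas [measurable]: "D n \<in> sets M" for n unfolding D_def by measurable
  have D_prob: "AE \<omega> in M. \<omega> \<in> D n" for n
    using AE_recurrent AE_recurrent_forward[of "int n"] AE_space by eventually_elim (simp add: D_def)
  define G where "G m n = {\<omega> \<in> space M. real (Suc m) \<le> birkhoff_sum hit n \<omega>}" for m n
  have G_meas [measurable]: "G m n \<in> sets M" for m n unfolding G_def by measurable
  \<comment> \<open>The reference point is the orbit of \<open>pullback \<omega>\<close>, which
    equivariance places at \<open>pullback (\<theta> (int n) \<omega>)\<close>.\<close>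
  have near: "d (orbit n \<omega> x) (pullback (\<theta> (int n) \<omega>)) \<le> q ^ m * C"
    if "\<omega> \<in> D n \<inter> G m n" "x \<in> E" for \<omega> x m n
  proof -
    have "\<omega> \<in> space M" using that by (simp add: D_def)
    then show ?thesis
      using that orbit_diameter_hits[of \<omega> x "pullback \<omega>" m n] pullback_in
        pullback_equivariant[of \<omega> n] by (auto simp: D_def G_def)
  qed
  have transported: "prob {\<omega> \<in> space M. \<theta> (int n) \<omega> \<in> S \<and> pullback (\<theta> (int n) \<omega>) \<in> W}
      = measure graph_measure (S \<times> W)" if S: "S \<in> sets M" "W \<in> sets B" for S W n
  proof -
    have "(\<lambda>\<omega>. (\<omega>, pullback \<omega>)) -` (S \<times> W) \<inter> space M = {\<omega> \<in> S. pullback \<omega> \<in> W}"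
      using sets.sets_into_space[OF S(1)] by auto
    then have T: "{\<omega> \<in> S. pullback \<omega> \<in> W} \<in> sets M"
      using measurable_sets[OF graph_measurable pair_measureI[OF S]] by simp
    have "\<theta> (int n) -` {\<omega> \<in> S. pullback \<omega> \<in> W} \<inter> space M
      = {\<omega> \<in> space M. \<theta> (int n) \<omega> \<in> S \<and> pullback (\<theta> (int n) \<omega>) \<in> W}" by auto
    then show ?thesis
      using measure_distr[OF flow_measurable T, of "int n"] by (simp add: distr_flow measure_graph_measure[OF S])
  qed
  \<comment> \<open>The margin of \<open>deep W k\<close> absorbs the distance between
    \<open>orbit n \<omega> x\<close> and \<open>pullback (\<theta> (int n) \<omega>)\<close>: if
    one of them is in \<open>deep W k\<close>, the other is in \<open>W\<close>.\<close>
  have compare: "measure graph_measure (S \<times> deep W k) \<le> measure \<mu> (S \<times> W)"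
      "measure \<mu> (S \<times> deep W k) \<le> measure graph_measure (S \<times> W)"
    if S: "S \<in> sets M" and W: "openin mtopology W" for S W k
  proof -
    obtain m where m: "q ^ m * C \<le> 1 / real (Suc k)" using hits_exceed[of "1 / real (Suc k)"] by auto
    have WB: "W \<in> sets B" "deep W k \<in> sets B" by (simp_all add: W open_in_sigma openin_deep)
    define T where "T n Z = {\<omega> \<in> space M. \<theta> (int n) \<omega> \<in> S \<and> pullback (\<theta> (int n) \<omega>) \<in> Z}" for n Z
    have T_meas: "T n Z \<in> sets M" if "Z \<in> sets B" for n Z
    proof -
      have "T n Z = (\<lambda>\<omega>. (\<theta> (int n) \<omega>, pullback (\<theta> (int n) \<omega>))) -` (S \<times> Z) \<inter> space M"
        by (auto simp: T_def)
      also have "\<dots> \<in> sets M"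
        by (rule measurable_sets[OF measurable_compose[OF flow_measurable graph_measurable] pair_measureI[OF S that]])
      finally show ?thesis .
    qed
    have lower: "measure graph_measure (S \<times> deep W k) \<le> measure \<mu> (S \<times> W) + (1 - prob (G m n))" for n
    proof -
      \<comment> \<open>Over \<open>\<omega> \<in> H\<close> the whole fibre \<open>E\<close> is
        carried into \<open>W\<close>, so a set \<open>H \<times> E\<close> of known measure fits
        into the preimage.\<close>
      define H where "H = T n (deep W k) \<inter> D n \<inter> G m n"
      have H: "H \<in> sets M" using T_meas[OF WB(2)] by (simp add: H_def)
      have "measure graph_measure (S \<times> deep W k) = prob (T n (deep W k))"
        using transported[OF S WB(2)] by (simp add: T_def)
      also have "\<dots> \<le> prob (H \<union> (space M - G m n))"
        by (rule finite_measure_mono_AE) (use D_prob[of n] H T_meas[OF WB(2)] in \<open>auto simp: H_def T_def elim!: eventually_mono\<close>)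
      also have "\<dots> \<le> prob H + prob (space M - G m n)" using H by (intro measure_Un_le) auto
      also have "prob H = measure \<mu> (H \<times> E)" using cyl[OF H] by simp
      also have "\<dots> \<le> measure \<mu> (skew n -` (S \<times> W) \<inter> space \<mu>)"
      proof (rule \<mu>.finite_measure_mono)
        show "H \<times> E \<subseteq> skew n -` (S \<times> W) \<inter> space \<mu>"
        proof clarify
          fix \<omega> x assume hx: "\<omega> \<in> H" "x \<in> E"
          then have w: "\<omega> \<in> space M" by (simp add: H_def D_def)
          have "d (pullback (\<theta> (int n) \<omega>)) (orbit n \<omega> x) \<le> 1 / real (Suc k)"
            using near[of \<omega> n m x] hx m by (simp add: H_def commute)
          then have "orbit n \<omega> x \<in> W"
            using deep_near[of _ W k] orbit_in[OF w hx(2)] hx by (auto simp: H_def T_def)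
          then show "(\<omega>, x) \<in> skew n -` (S \<times> W) \<inter> space \<mu>"
            using hx w by (auto simp: skew_def sp H_def T_def)
        qed
      qed (rule measurable_sets[OF skew_meas rect[OF S WB(1)]])
      also have "\<dots> = measure \<mu> (S \<times> W)" using pull[OF rect[OF S WB(1)]] by simp
      finally show ?thesis by (simp add: prob_compl)
    qed
    have upper: "measure \<mu> (S \<times> deep W k) \<le> measure graph_measure (S \<times> W) + (1 - prob (G m n))" for n
    proof -
      \<comment> \<open>Now \<open>H \<times> E\<close> must cover the preimage: over points outside
        \<open>H\<close> no element of the fibre reaches \<open>S \<times> deep W k\<close>.\<close>
      define H where "H = T n W \<union> (space M - D n) \<union> (space M - G m n)"
      have H: "H \<in> sets M" using T_meas[OF WB(1)] by (simp add: H_def)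
      have "measure \<mu> (S \<times> deep W k) = measure \<mu> (skew n -` (S \<times> deep W k) \<inter> space \<mu>)"
        using pull[OF rect[OF S WB(2)]] by simp
      also have "\<dots> \<le> measure \<mu> (H \<times> E)"
      proof (rule \<mu>.finite_measure_mono)
        show "skew n -` (S \<times> deep W k) \<inter> space \<mu> \<subseteq> H \<times> E"
        proof
          fix z assume "z \<in> skew n -` (S \<times> deep W k) \<inter> space \<mu>"
          then obtain \<omega> x where z: "z = (\<omega>, x)" "\<omega> \<in> space M" "x \<in> E" "\<theta> (int n) \<omega> \<in> S" "orbit n \<omega> x \<in> deep W k"
            by (auto simp: sp skew_def)
          have "pullback (\<theta> (int n) \<omega>) \<in> W" if "\<omega> \<in> D n \<inter> G m n"
            using near[OF that z(3)] m by (intro deep_near[OF z(5) pullback_in]) simp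
          then show "z \<in> H \<times> E" using z by (auto simp: H_def T_def)
        qed
      qed (rule rect[OF H E_B])
      also have "\<dots> = prob H" by (rule cyl[OF H])
      also have "\<dots> \<le> prob (T n W \<union> (space M - G m n))"
        by (rule finite_measure_mono_AE) (use D_prob[of n] H T_meas[OF WB(1)] in \<open>auto simp: H_def elim!: eventually_mono\<close>)
      also have "\<dots> \<le> prob (T n W) + prob (space M - G m n)"
        using T_meas[OF WB(1)] by (intro measure_Un_le) auto
      also have "prob (T n W) = measure graph_measure (S \<times> W)"
        using transported[OF S WB(1)] by (simp add: T_def)
      finally show ?thesis by (simp add: prob_compl)
    qed
    have lim: "(\<lambda>n. c + (1 - prob (G m n))) \<longlonglongrightarrow> c + (1 - 1)" for c
      unfolding G_def by (intro tendsto_intros prob_hits_tendsto)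
    show "measure graph_measure (S \<times> deep W k) \<le> measure \<mu> (S \<times> W)"
      using LIMSEQ_le_const[OF lim[of "measure \<mu> (S \<times> W)"]] lower by auto
    show "measure \<mu> (S \<times> deep W k) \<le> measure graph_measure (S \<times> W)"
      using LIMSEQ_le_const[OF lim[of "measure graph_measure (S \<times> W)"]] upper by auto
  qed
  have deep_lim: "(\<lambda>k. measure N (S \<times> deep W k)) \<longlonglongrightarrow> measure N (S \<times> W)"
    if N: "prob_space N" "sets N = sets (M \<Otimes>\<^sub>M B)" and S: "S \<in> sets M" and W: "openin mtopology W" for N S W
  proof -
    interpret N: prob_space N by fact
    have "(\<lambda>k. measure N (S \<times> deep W k)) \<longlonglongrightarrow> measure N (\<Union>k. S \<times> deep W k)"
    proof (rule N.finite_Lim_measure_incseq)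
      show "range (\<lambda>k. S \<times> deep W k) \<subseteq> sets N"
        using S by (auto simp: N(2) intro!: pair_measureI open_in_sigma openin_deep)
      show "incseq (\<lambda>k. S \<times> deep W k)"
        unfolding incseq_def using deep_mono by blast
    qed
    moreover have "(\<Union>k. S \<times> deep W k) = S \<times> W" using Union_deep[OF W] by blast
    ultimately show ?thesis by simp
  qed
  have rect_eq: "measure \<mu> (S \<times> W) = measure graph_measure (S \<times> W)"
    if S: "S \<in> sets M" and W: "openin mtopology W" for S W
  proof (rule antisym)
    show "measure \<mu> (S \<times> W) \<le> measure graph_measure (S \<times> W)"
      using LIMSEQ_le_const2[OF deep_lim[OF mu(1,2) S W]] compare(2)[OF S W] by blast
    show "measure graph_measure (S \<times> W) \<le> measure \<mu> (S \<times> W)"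
      using LIMSEQ_le_const2[OF deep_lim[OF prob_space_graph_measure sets_graph_measure S W]] compare(1)[OF S W] by blast
  qed
  let ?R = "{a \<times> b |a b. a \<in> sets M \<and> b \<in> {W. openin mtopology W}}"
  have gen: "sets (M \<Otimes>\<^sub>M B) = sigma_sets (space M \<times> E) ?R"
  proof -
    have "sets (M \<Otimes>\<^sub>M B) = sets (sigma (space M \<times> space B) ?R)"
    proof (rule sets_pair_eq)
      show "{W. openin mtopology W} \<subseteq> Pow (space B)" using openin_subset by (fastforce simp: space_sigma_open)
      show "sets M = sigma_sets (space M) (sets M)" by (simp add: sets.sigma_sets_eq)
      show "sets B = sigma_sets (space B) {W. openin mtopology W}" by (simp add: sets_sigma_open space_sigma_open)
      show "countable {space M}" "{space M} \<subseteq> sets M" "\<Union> {space M} = space M" by auto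
      show "countable {E}" "{E} \<subseteq> {W. openin mtopology W}" "\<Union> {E} = space B"
        using openin_topspace[of mtopology] by (auto simp: space_sigma_open)
    qed (rule sets.space_closed)
    also have "\<dots> = sigma_sets (space M \<times> E) ?R"
      unfolding space_sigma_open
      by (rule sets_measure_of) (use openin_subset sets.sets_into_space in fastforce)
    finally show ?thesis .
  qed
  show ?thesis
  proof (rule measure_eqI_generator_eq[where E="?R" and \<Omega>="space M \<times> E" and A="\<lambda>_. space M \<times> E"])
    show "Int_stable ?R"
    proof (rule Int_stableI)
      fix a b assume "a \<in> ?R" "b \<in> ?R"
      then obtain S W S' W' where "a = S \<times> W" "b = S' \<times> W'" "S \<in> sets M" "S' \<in> sets M"
        "openin mtopology W" "openin mtopology W'" by blast
      then have "a \<inter> b = (S \<inter> S') \<times> (W \<inter> W')" "S \<inter> S' \<in> sets M" "openin mtopology (W \<inter> W')" by auto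
      then show "a \<inter> b \<in> ?R" by blast
    qed
    show "?R \<subseteq> Pow (space M \<times> E)" using openin_subset sets.sets_into_space by fastforce
    show "emeasure \<mu> X = emeasure graph_measure X" if "X \<in> ?R" for X
      using that rect_eq by (auto simp: \<mu>.emeasure_eq_measure \<nu>.emeasure_eq_measure)
    show "sets \<mu> = sigma_sets (space M \<times> E) ?R" "sets graph_measure = sigma_sets (space M \<times> E) ?R"
      using gen mu(2) sets_graph_measure by auto
    show "range (\<lambda>_. space M \<times> E) \<subseteq> ?R" using openin_topspace[of mtopology] by auto
    show "(\<Union>i::nat. space M \<times> E) = space M \<times> E" by simp
    show "emeasure \<mu> (space M \<times> E) \<noteq> \<infinity>" by simp
  qed
qed

text \<open>Decay at one rate implies decay at all smaller ones, so rational \<open>s\<close>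
  suffice and a single null set serves every \<open>s\<close> below the integral.\<close>

lemma uniform_contraction:
  "AE \<omega> in M. \<omega> \<in> recurrent \<and> (\<forall>s\<ge>0. ennreal s < (\<integral>\<^sup>+\<omega>. rate \<omega> \<partial>M) \<longrightarrow>
    (\<forall>\<^sub>F n in sequentially. \<forall>x\<in>E. \<forall>y\<in>E. d (orbit n \<omega> x) (orbit n \<omega> y) \<le> exp (- s * real n)) \<and>
    (\<forall>\<^sub>F n in sequentially. \<forall>x\<in>E. \<forall>y\<in>E.
      d (orbit n (\<theta> (- int n) \<omega>) x) (orbit n (\<theta> (- int n) \<omega>) y) \<le> exp (- s * real n)))"
proof -
  let ?I = "\<integral>\<^sup>+\<omega>. rate \<omega> \<partial>M"
  let ?Q = "\<lambda>s \<omega>.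
    (\<forall>\<^sub>F n in sequentially. \<forall>x\<in>E. \<forall>y\<in>E. d (orbit n \<omega> x) (orbit n \<omega> y) \<le> exp (- s * real n)) \<and>
    (\<forall>\<^sub>F n in sequentially. \<forall>x\<in>E. \<forall>y\<in>E.
      d (orbit n (\<theta> (- int n) \<omega>) x) (orbit n (\<theta> (- int n) \<omega>) y) \<le> exp (- s * real n))"
  have "AE \<omega> in M. \<forall>s\<in>{s\<in>\<rat>. 0 \<le> s \<and> ennreal s < ?I}. ?Q s \<omega>"
  proof (rule AE_ball_countable')
    show "countable {s \<in> \<rat>. 0 \<le> s \<and> ennreal s < ?I}" by (rule countable_subset[OF _ countable_rat]) auto
    fix s assume "s \<in> {s \<in> \<rat>. 0 \<le> s \<and> ennreal s < ?I}"
    then have s: "0 \<le> s" "ennreal s < ?I" by auto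
    from forward_contraction[OF s] backward_contraction[OF s] show "AE \<omega> in M. ?Q s \<omega>"
      by eventually_elim (rule conjI)
  qed
  then show ?thesis using AE_recurrent
  proof eventually_elim
    case (elim \<omega>)
    have "?Q s \<omega>" if s: "0 \<le> s" "ennreal s < ?I" for s
    proof -
      obtain s' where s': "s' \<in> \<rat>" "s \<le> s'" "ennreal s' < ?I"
      proof -
        \<comment> \<open>\<open>r\<close> is finite even if the integral is not, so the density of
          the rationals in the reals applies below it.\<close>
        obtain r where r: "ennreal s < r" "r < ?I" using dense[OF s(2)] by blast
        then obtain r' where r': "r = ennreal r'" "0 \<le> r'" by (cases r) auto
        then have "s < r'" using r(1) s(1) by (simp add: ennreal_less_iff)
        then obtain s' where s': "s' \<in> \<rat>" "s < s'" "s' < r'" using Rats_dense_in_real by blast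
        then have "ennreal s' \<le> r" by (simp add: r' ennreal_leI)
        then show thesis using that[of s'] s' r(2) by simp
      qed
      then have Q: "?Q s' \<omega>" using elim(1) s(1) by auto
      have le: "exp (- s' * real n) \<le> exp (- s * real n)" for n using s' by (simp add: mult_right_mono)
      show ?thesis
        by (intro conjI eventually_mono[OF conjunct1[OF Q]] eventually_mono[OF conjunct2[OF Q]])
          (meson le order_trans)+
    qed
    then show ?case using elim(2) by blast
  qed
qed

end

section \<open>Projective contraction of cones\<close>

locale hilbert_section =
  fixes K U :: "'x::real_normed_vector set"
  assumes cone: "closed_cone K" and pointed: "K \<inter> uminus ` K = {0}"
    and nontrivial: "K - {0} \<noteq> {}" and solid: "interior K \<noteq> {}"
    and transverse: "intersects_transversely U K"
    and metric: "Metric_space (cone_section K U) (hilbert_metric K)"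
begin

section \<open>Geometry of the open cone\<close>

sublocale Metric_space "cone_section K U" "hilbert_metric K" by (rule metric)

lemmas less_iff = hilbert_metric_less_iff[OF cone pointed nontrivial]

lemma cone_section_interior: "x \<in> cone_section K U \<Longrightarrow> x \<in> interior K"
  by (simp add: cone_section_def)

lemma interior_not_0: "x \<in> interior K \<Longrightarrow> x \<in> K - {0}"
  using interior_nonzero[OF cone pointed nontrivial] interior_subset[of K] by auto

lemma interior_scale:
  assumes "x \<in> interior K" "0 < c"
  shows "c *\<^sub>R x \<in> interior K"
proof -
  have "(\<lambda>y. c *\<^sub>R y) ` interior K \<subseteq> interior K"
  proof (rule interior_maximal)
    show "open ((\<lambda>y. c *\<^sub>R y) ` interior K)" using assms by (intro open_scaling) auto
    show "(\<lambda>y. c *\<^sub>R y) ` interior K \<subseteq> K" using closed_coneD(2)[OF cone] assms interior_subset[of K] by force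
  qed
  then show ?thesis using assms by auto
qed

lemma interior_add:
  assumes "x \<in> interior K" "y \<in> K"
  shows "x + y \<in> interior K"
proof -
  have "(\<lambda>z. y + z) ` interior K \<subseteq> interior K"
  proof (rule interior_maximal)
    show "open ((\<lambda>z. y + z) ` interior K)" by (rule open_translation) simp
    show "(\<lambda>z. y + z) ` interior K \<subseteq> K" using closed_coneD(1)[OF cone] assms interior_subset[of K] by force
  qed
  then show ?thesis using assms by (auto simp: add.commute)
qed

lemma hilbert_dist_eq:
  assumes "x \<in> interior K" "y \<in> interior K"
  shows "hilbert_dist K x y = ereal (hilbert_metric K x y)"
  using hilbert_dist_bounds[OF cone pointed nontrivial assms] by (metis hilbert_metric_def real_of_ereal.simps(1))

text \<open>\<open>\<alpha>\<close> and \<open>\<beta>\<close> are the values of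
  \<open>cone_m\<close> and \<open>cone_M\<close>. Extremality is stated for all real coefficients
  because it is applied to quotients that may be negative.\<close>

lemma hilbert_metric_extremal:
  assumes x: "x \<in> interior K" and y: "y \<in> interior K"
  obtains \<alpha> \<beta> where "0 < \<alpha>" "0 < \<beta>" "hilbert_metric K x y = ln \<beta> - ln \<alpha>"
    "\<And>a. x - a *\<^sub>R y \<in> K \<Longrightarrow> a \<le> \<alpha>" "\<And>b. b *\<^sub>R y - x \<in> K \<Longrightarrow> \<beta> \<le> b"
proof -
  obtain \<beta> \<alpha> where Mm: "0 < \<beta>" "0 < \<alpha>" "cone_M K x y = ennreal \<beta>" "cone_m K x y = ennreal \<alpha>"
    "hilbert_dist K x y = ereal (ln \<beta> - ln \<alpha>)"
    using hilbert_dist_bounds[OF cone pointed nontrivial x y] .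
  have upper: "a \<le> \<alpha>" if a: "x - a *\<^sub>R y \<in> K" for a
  proof (cases "0 \<le> a")
    case True
    then have "ennreal a \<le> cone_m K x y" unfolding cone_m_def
      by (intro Sup_upper) (use a in \<open>auto simp: cone_le_def\<close>)
    then show ?thesis using Mm by (simp add: ennreal_le_iff)
  qed (use Mm in simp)
  have nonneg: "\<beta> \<le> b" if "0 \<le> b" "b *\<^sub>R y - x \<in> K" for b
  proof -
    have "cone_M K x y \<le> ennreal b" unfolding cone_M_def
      by (intro Inf_lower) (use that in \<open>auto simp: cone_le_def\<close>)
    then show ?thesis using Mm that by (simp add: ennreal_le_iff)
  qed
  have lower: "\<beta> \<le> b" if b: "b *\<^sub>R y - x \<in> K" for b
  proof (cases "0 \<le> b")
    case False
    have "y \<in> K" using y interior_subset by blast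
    \<comment> \<open>A negative \<open>b\<close> would put \<open>- x\<close> into
      \<open>K\<close>, making \<open>0\<close> an admissible coefficient and forcing
      \<open>\<beta> \<le> 0\<close>.\<close>
    then have "(- b) *\<^sub>R y + (b *\<^sub>R y - x) \<in> K"
      using b False by (intro closed_coneD[OF cone]) auto
    then have "0 *\<^sub>R y - x \<in> K" by simp
    then have "\<beta> \<le> 0" by (rule nonneg[OF order_refl])
    then show ?thesis using Mm by simp
  qed (use nonneg b in simp)
  show thesis using that[OF Mm(2,1) _ upper lower] Mm by (simp add: hilbert_metric_def)
qed

lemma hilbert_metric_scale:
  assumes x: "x \<in> interior K" and y: "y \<in> interior K" and c: "0 < c" "0 < c'"
  shows "hilbert_metric K (c *\<^sub>R x) (c' *\<^sub>R y) = hilbert_metric K x y"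
proof -
  have le: "hilbert_metric K (c *\<^sub>R x) (c' *\<^sub>R y) \<le> hilbert_metric K x y"
    if x: "x \<in> interior K" and y: "y \<in> interior K" and c: "0 < c" "0 < c'" for x y c c'
  proof (rule dense_ge)
    fix r assume "hilbert_metric K x y < r"
    then obtain a b where ab: "0 < a" "0 < b" "x - a *\<^sub>R y \<in> K" "b *\<^sub>R y - x \<in> K" "ln b - ln a < r"
      using less_iff[OF x y] by blast
    have "c *\<^sub>R (x - a *\<^sub>R y) \<in> K" "c *\<^sub>R (b *\<^sub>R y - x) \<in> K"
      using ab c closed_coneD(2)[OF cone] by auto
    then have "c *\<^sub>R x - (a * c / c') *\<^sub>R c' *\<^sub>R y \<in> K" "(b * c / c') *\<^sub>R c' *\<^sub>R y - c *\<^sub>R x \<in> K"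
      using c by (simp_all add: scaleR_diff_right mult.commute)
    moreover have "ln (b * c / c') - ln (a * c / c') < r" using ab c by (simp add: ln_mult_pos ln_div)
    ultimately have "hilbert_metric K (c *\<^sub>R x) (c' *\<^sub>R y) < r"
      unfolding less_iff[OF interior_scale[OF x c(1)] interior_scale[OF y c(2)]]
      using ab c by (intro exI[of _ "a * c / c'"] exI[of _ "b * c / c'"]) auto
    then show "hilbert_metric K (c *\<^sub>R x) (c' *\<^sub>R y) \<le> r" by simp
  qed
  show ?thesis
  proof (rule antisym[OF le[OF x y c]])
    show "hilbert_metric K x y \<le> hilbert_metric K (c *\<^sub>R x) (c' *\<^sub>R y)"
      using le[OF interior_scale[OF x c(1)] interior_scale[OF y c(2)], of "1 / c" "1 / c'"] c by simp
  qed
qed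

section \<open>The projective action of positive operators\<close>

lemma positive_interior: "positive_op K T \<Longrightarrow> x \<in> interior K \<Longrightarrow> blinfun_apply T x \<in> interior K"
  by (auto simp: positive_op_def)

lemma normalize_interior:
  assumes "x \<in> interior K"
  obtains c where "0 < c" "c *\<^sub>R x \<in> cone_section K U"
proof -
  obtain c where "0 < c" "c *\<^sub>R x \<in> U"
    using transverse interior_not_0[OF assms] unfolding intersects_transversely_def by blast
  then show thesis using that interior_scale[OF assms] by (simp add: cone_section_def)
qed

lemma section_nonempty: "cone_section K U \<noteq> {}"
  using solid normalize_interior by blast

lemma proj_action_in: "positive_op K T \<Longrightarrow> x \<in> cone_section K U \<Longrightarrow> proj_action U T x \<in> cone_section K U"
  using proj_action_props(2)[OF cone pointed nontrivial transverse] cone_section_interior by blast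

lemma proj_action_scaleE:
  assumes "positive_op K T" "x \<in> interior K"
  obtains c where "0 < c" "proj_action U T x = c *\<^sub>R blinfun_apply T x"
  using proj_action_props(1)[OF cone pointed nontrivial transverse assms] by blast

lemma proj_action_eqI:
  assumes "blinfun_apply T x \<in> interior K" "0 < c" "c *\<^sub>R blinfun_apply T x \<in> U"
  shows "proj_action U T x = c *\<^sub>R blinfun_apply T x"
proof -
  have "\<exists>!s. 0 < s \<and> s *\<^sub>R blinfun_apply T x \<in> U"
    using transverse interior_not_0[OF assms(1)] by (simp add: intersects_transversely_def)
  then show ?thesis unfolding proj_action_def using assms by (intro the_equality) auto
qed

lemma proj_action_id: "x \<in> cone_section K U \<Longrightarrow> proj_action U id_blinfun x = x"
  using proj_action_eqI[of id_blinfun x 1] by (simp add: cone_section_def)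

lemma positive_op_compose: "positive_op K S \<Longrightarrow> positive_op K T \<Longrightarrow> positive_op K (S o\<^sub>L T)"
  by (auto simp: positive_op_def)

text \<open>Linearity lets the normalising factor pass through \<open>S\<close>, so normalising
  after each operator or once at the end gives the same point of \<open>U\<close>.\<close>

lemma proj_action_compose:
  assumes S: "positive_op K S" and T: "positive_op K T" and x: "x \<in> cone_section K U"
  shows "proj_action U (S o\<^sub>L T) x = proj_action U S (proj_action U T x)"
proof -
  note xi = cone_section_interior[OF x]
  obtain c where c: "0 < c" "proj_action U T x = c *\<^sub>R blinfun_apply T x" using proj_action_scaleE[OF T xi] .
  have Tx: "proj_action U T x \<in> cone_section K U" using proj_action_in[OF T x] .
  obtain c' where c': "0 < c'" "proj_action U S (proj_action U T x) = c' *\<^sub>R blinfun_apply S (proj_action U T x)"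
    using proj_action_scaleE[OF S cone_section_interior[OF Tx]] .
  then have eq: "proj_action U S (proj_action U T x) = (c' * c) *\<^sub>R blinfun_apply (S o\<^sub>L T) x"
    by (simp add: c blinfun.scaleR_right)
  have "proj_action U S (proj_action U T x) \<in> U" using proj_action_in[OF S Tx] by (simp add: cone_section_def)
  then show ?thesis
    using proj_action_eqI[of "S o\<^sub>L T" x "c' * c"] positive_interior[OF positive_op_compose[OF S T] xi] c c' eq by simp
qed

text \<open>With \<open>p = T u\<close>, \<open>r = T v\<close> and optimal \<open>\<alpha> r \<le> p \<le> \<beta> r\<close>, contraction is applied to
  \<open>u + \<alpha> v\<close> and \<open>u + \<beta> v\<close>: their distance is at most \<open>ln (\<beta> / \<alpha>)\<close>, while that of their images is
  at least \<open>ln ((\<alpha> + \<beta>)\<^sup>2 / (4 \<alpha> \<beta>))\<close>. This replaces the sharp Birkhoff-Hopf theorem.\<close>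

lemma finite_image_diameter:
  assumes T: "positive_op K T" and q: "0 \<le> q" "q < 1"
    and lip: "\<And>x y. x \<in> cone_section K U \<Longrightarrow> y \<in> cone_section K U \<Longrightarrow>
      hilbert_metric K (proj_action U T x) (proj_action U T y) \<le> q * hilbert_metric K x y"
    and x: "x \<in> cone_section K U" and y: "y \<in> cone_section K U"
  shows "hilbert_metric K (proj_action U T x) (proj_action U T y) \<le> ln 4 / (1 - q)"
proof -
  \<comment> \<open>The vectors used below need not lie in \<open>U\<close>; scale invariance
    carries the Lipschitz bound from the section to the whole open cone.\<close>
  have lip': "hilbert_metric K (T w) (T w') \<le> q * hilbert_metric K w w'"
    if w: "w \<in> interior K" "w' \<in> interior K" for w w'
  proof -
    obtain c where c: "0 < c" "c *\<^sub>R w \<in> cone_section K U" using normalize_interior[OF w(1)] .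
    obtain c' where c': "0 < c'" "c' *\<^sub>R w' \<in> cone_section K U" using normalize_interior[OF w(2)] .
    obtain e where e: "0 < e" "proj_action U T (c *\<^sub>R w) = e *\<^sub>R T (c *\<^sub>R w)"
      using proj_action_scaleE[OF T cone_section_interior[OF c(2)]] .
    obtain e' where e': "0 < e'" "proj_action U T (c' *\<^sub>R w') = e' *\<^sub>R T (c' *\<^sub>R w')"
      using proj_action_scaleE[OF T cone_section_interior[OF c'(2)]] .
    have "hilbert_metric K (proj_action U T (c *\<^sub>R w)) (proj_action U T (c' *\<^sub>R w')) = hilbert_metric K (T w) (T w')"
      using hilbert_metric_scale[OF positive_interior[OF T w(1)] positive_interior[OF T w(2)], of "e * c" "e' * c'"]
        c c' e e' by (simp add: blinfun.scaleR_right)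
    then show ?thesis using lip[OF c(2) c'(2)] hilbert_metric_scale[OF w c(1) c'(1)] by simp
  qed
  have xi: "x \<in> interior K" "y \<in> interior K" using x y cone_section_interior by auto
  define p r where "p = T x" and "r = T y"
  have pr: "p \<in> interior K" "r \<in> interior K" using positive_interior[OF T] xi by (auto simp: p_def r_def)
  then have prK: "p \<in> K" "r \<in> K" using interior_subset by auto
  obtain \<alpha> \<beta> where ab: "0 < \<alpha>" "0 < \<beta>" "hilbert_metric K p r = ln \<beta> - ln \<alpha>"
    and max: "\<And>a. p - a *\<^sub>R r \<in> K \<Longrightarrow> a \<le> \<alpha>" and min: "\<And>b. b *\<^sub>R r - p \<in> K \<Longrightarrow> \<beta> \<le> b"
    by (rule hilbert_metric_extremal[OF pr]) blast
  have image: "hilbert_metric K (proj_action U T x) (proj_action U T y) = ln \<beta> - ln \<alpha>"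
  proof -
    obtain c where "0 < c" "proj_action U T x = c *\<^sub>R p" using proj_action_scaleE[OF T xi(1)] unfolding p_def .
    moreover obtain c' where "0 < c'" "proj_action U T y = c' *\<^sub>R r" using proj_action_scaleE[OF T xi(2)] unfolding r_def .
    ultimately show ?thesis using hilbert_metric_scale[OF pr] ab by simp
  qed
  show ?thesis
  proof (cases "\<alpha> < \<beta>")
    case False
    then have "ln \<beta> - ln \<alpha> \<le> 0" using ab by simp
    also have "0 \<le> ln 4 / (1 - q)" using q by simp
    finally show ?thesis using image by simp
  next
    case True
    define w where "w s = x + s *\<^sub>R y" for s
    have yK: "s *\<^sub>R y \<in> K" if "0 < s" for s using interior_scale[OF xi(2) that] interior_subset by auto
    have wi: "w s \<in> interior K" if "0 < s" for s unfolding w_def using interior_add[OF xi(1) yK[OF that]] .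
    have Tw: "T (w s) = p + s *\<^sub>R r" for s by (simp add: w_def p_def r_def blinfun.add_right blinfun.scaleR_right)
    \<comment> \<open>In the cone order \<open>w \<beta>\<close> lies between
      \<open>w \<alpha>\<close> and \<open>\<beta> / \<alpha>\<close> times
      \<open>w \<alpha>\<close>, as \<open>\<alpha> < \<beta>\<close>.\<close>
    have source: "hilbert_metric K (w \<beta>) (w \<alpha>) \<le> ln \<beta> - ln \<alpha>"
    proof (rule dense_ge)
      fix e assume e: "ln \<beta> - ln \<alpha> < e"
      have "w \<beta> - 1 *\<^sub>R w \<alpha> = (\<beta> - \<alpha>) *\<^sub>R y" by (simp add: w_def scaleR_diff_left)
      then have 1: "w \<beta> - 1 *\<^sub>R w \<alpha> \<in> K" using yK[of "\<beta> - \<alpha>"] True by simp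
      have "(\<beta> / \<alpha>) *\<^sub>R w \<alpha> - w \<beta> = (\<beta> / \<alpha> - 1) *\<^sub>R x" using ab by (simp add: w_def algebra_simps)
      then have 2: "(\<beta> / \<alpha>) *\<^sub>R w \<alpha> - w \<beta> \<in> K"
        using interior_scale[OF xi(1), of "\<beta> / \<alpha> - 1"] interior_subset[of K] True ab by auto
      have "ln (\<beta> / \<alpha>) - ln 1 < e" using e ab by (simp add: ln_div)
      then have "hilbert_metric K (w \<beta>) (w \<alpha>) < e"
        unfolding less_iff[OF wi[OF ab(2)] wi[OF ab(1)]] using 1 2 ab
        by (intro exI[of _ 1] exI[of _ "\<beta> / \<alpha>"]) auto
      then show "hilbert_metric K (w \<beta>) (w \<alpha>) \<le> e" by simp
    qed
    \<comment> \<open>Bounds for the coefficients comparing \<open>T (w \<beta>)\<close> with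
      \<open>T (w \<alpha>)\<close>. They solve
      \<open>(\<beta> - b * \<alpha>) / (b - 1) = \<alpha>\<close> for \<open>b\<close> and
      \<open>(\<beta> - a * \<alpha>) / (a - 1) = \<beta>\<close> for \<open>a\<close>, where the
      extremality of \<open>\<alpha>\<close> and of \<open>\<beta>\<close> takes effect.\<close>
    let ?l = "(\<alpha> + \<beta>) / (2 * \<alpha>)" and ?m = "2 * \<beta> / (\<alpha> + \<beta>)"
    have lower: "?l \<le> b" if b: "b *\<^sub>R T (w \<alpha>) - T (w \<beta>) \<in> K" for b
    proof -
      have k: "(b - 1) *\<^sub>R p - (\<beta> - b * \<alpha>) *\<^sub>R r \<in> K" using b by (simp add: Tw algebra_simps)
      show ?thesis
      proof (cases "1 < b")
        case True
        have "(1 / (b - 1)) *\<^sub>R ((b - 1) *\<^sub>R p - (\<beta> - b * \<alpha>) *\<^sub>R r) \<in> K"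
          using True by (intro closed_coneD(2)[OF cone] k) simp
        then have "p - ((\<beta> - b * \<alpha>) / (b - 1)) *\<^sub>R r \<in> K" using True by (simp add: scaleR_diff_right)
        then have "(\<beta> - b * \<alpha>) / (b - 1) \<le> \<alpha>" by (rule max)
        then have "\<beta> - b * \<alpha> \<le> \<alpha> * (b - 1)" using True by (simp add: pos_divide_le_eq)
        then show ?thesis using ab by (simp add: pos_divide_le_eq algebra_simps)
      next
        case False
        have "b * \<alpha> \<le> 1 * \<alpha>" using False ab by (intro mult_right_mono) auto
        then have g: "0 < \<beta> - b * \<alpha>" using \<open>\<alpha> < \<beta>\<close> by simp
        \<comment> \<open>For \<open>b \<le> 1\<close> a negative multiple of \<open>r\<close> would
          lie in \<open>K\<close>. Scaled by \<open>s\<close> and added to \<open>p\<close>, it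
          gives \<open>p - (\<alpha> + 1) r\<close> in \<open>K\<close>, beyond the maximal
          coefficient \<open>\<alpha>\<close>.\<close>
        define s where "s = (\<alpha> + 1) / (\<beta> - b * \<alpha>)"
        have s: "0 < s" "s * (\<beta> - b * \<alpha>) = \<alpha> + 1" using g ab by (simp_all add: s_def)
        have "(1 - b) *\<^sub>R p + ((b - 1) *\<^sub>R p - (\<beta> - b * \<alpha>) *\<^sub>R r) \<in> K"
          using False prK by (intro closed_coneD[OF cone] k) auto
        then have "- ((\<beta> - b * \<alpha>) *\<^sub>R r) \<in> K" by (simp add: algebra_simps)
        then have "s *\<^sub>R (- ((\<beta> - b * \<alpha>) *\<^sub>R r)) \<in> K" using s by (intro closed_coneD(2)[OF cone]) auto
        then have "p + s *\<^sub>R (- ((\<beta> - b * \<alpha>) *\<^sub>R r)) \<in> K" by (rule closed_coneD(1)[OF cone prK(1)])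
        then have "p - (\<alpha> + 1) *\<^sub>R r \<in> K" using s by simp
        then show ?thesis using max by fastforce
      qed
    qed
    have upper: "a \<le> ?m" if a: "T (w \<beta>) - a *\<^sub>R T (w \<alpha>) \<in> K" for a
    proof (cases "1 < a")
      case True
      have k: "(\<beta> - a * \<alpha>) *\<^sub>R r - (a - 1) *\<^sub>R p \<in> K" using a by (simp add: Tw algebra_simps)
      have "(1 / (a - 1)) *\<^sub>R ((\<beta> - a * \<alpha>) *\<^sub>R r - (a - 1) *\<^sub>R p) \<in> K"
        using True by (intro closed_coneD(2)[OF cone] k) simp
      then have "((\<beta> - a * \<alpha>) / (a - 1)) *\<^sub>R r - p \<in> K" using True by (simp add: scaleR_diff_right)
      then have "\<beta> \<le> (\<beta> - a * \<alpha>) / (a - 1)" by (rule min)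
      then have "\<beta> * (a - 1) \<le> \<beta> - a * \<alpha>" using True by (simp add: pos_le_divide_eq)
      then show ?thesis using ab by (simp add: pos_le_divide_eq algebra_simps)
    next
      case False
      have "1 \<le> ?m" using ab \<open>\<alpha> < \<beta>\<close> by simp
      then show ?thesis using False by linarith
    qed
    have "ln ?l - ln ?m \<le> hilbert_metric K (T (w \<beta>)) (T (w \<alpha>))"
    proof (rule ccontr)
      assume "\<not> ?thesis"
      then obtain a b where h: "0 < a" "0 < b" "T (w \<beta>) - a *\<^sub>R T (w \<alpha>) \<in> K" "b *\<^sub>R T (w \<alpha>) - T (w \<beta>) \<in> K"
        "ln b - ln a < ln ?l - ln ?m"
        using less_iff[OF positive_interior[OF T wi[OF ab(2)]] positive_interior[OF T wi[OF ab(1)]], of "ln ?l - ln ?m"]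
        by (auto simp: not_le)
      have "0 < ?l" "0 < ?m" using ab by auto
      then have "ln ?l \<le> ln b" "ln a \<le> ln ?m"
        using lower[OF h(4)] upper[OF h(3)] h by (simp_all only: ln_le_cancel_iff)
      then show False using h by linarith
    qed
    also have "\<dots> \<le> q * (ln \<beta> - ln \<alpha>)"
      using lip'[OF wi[OF ab(2)] wi[OF ab(1)]] mult_left_mono[OF source q(1)] by linarith
    also have "ln ?l = ln (\<alpha> + \<beta>) - ln 2 - ln \<alpha>" using ab by (simp add: ln_div ln_mult_pos)
    also have "ln ?m = ln 2 + ln \<beta> - ln (\<alpha> + \<beta>)" using ab by (simp add: ln_div ln_mult_pos)
    finally have "2 * ln (\<alpha> + \<beta>) - 2 * ln 2 - ln \<alpha> - ln \<beta> \<le> q * (ln \<beta> - ln \<alpha>)" by simp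
    \<comment> \<open>Replacing \<open>ln (\<alpha> + \<beta>)\<close> by \<open>ln \<beta>\<close>
      leaves \<open>ln \<beta> - ln \<alpha> - 2 * ln 2\<close> on the left, the origin of
      \<open>ln 4\<close>.\<close>
    moreover have "ln \<beta> \<le> ln (\<alpha> + \<beta>)" using ab by simp
    ultimately have "(ln \<beta> - ln \<alpha>) * (1 - q) \<le> 2 * ln 2" by (simp add: algebra_simps)
    also have "2 * ln 2 = ln (2 ^ 2 :: real)" by (subst ln_realpow) auto
    also have "(2 ^ 2 :: real) = 4" by simp
    finally show ?thesis using q image by (simp add: pos_le_divide_eq)
  qed
qed

section \<open>The projective norm as a Lipschitz constant and as a measurable function\<close>

lemma proj_norm_ratio:
  assumes T: "positive_op K T" and x: "x \<in> cone_section K U" and y: "y \<in> cone_section K U" and "x \<noteq> y"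
  shows "e2ennreal (hilbert_dist K (proj_action U T x) (proj_action U T y)) / e2ennreal (hilbert_dist K x y)
    = ennreal (hilbert_metric K (proj_action U T x) (proj_action U T y) / hilbert_metric K x y)"
    and "0 < hilbert_metric K x y"
proof -
  show pos: "0 < hilbert_metric K x y" using mdist_pos_eq[OF x y] \<open>x \<noteq> y\<close> by simp
  show "e2ennreal (hilbert_dist K (proj_action U T x) (proj_action U T y)) / e2ennreal (hilbert_dist K x y)
    = ennreal (hilbert_metric K (proj_action U T x) (proj_action U T y) / hilbert_metric K x y)"
    using proj_action_in[OF T] x y cone_section_interior pos
    by (simp add: hilbert_dist_eq e2ennreal_ereal divide_ennreal)
qed

lemma proj_norm_le_1:
  assumes T: "positive_op K T"
  shows "proj_norm K U T \<le> 1"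
  unfolding proj_norm_def
proof (rule SUP_least, clarify)
  fix x y assume xy: "x \<in> cone_section K U" "y \<in> cone_section K U" "x \<noteq> y"
  show "e2ennreal (hilbert_dist K (proj_action U T x) (proj_action U T y)) / e2ennreal (hilbert_dist K x y) \<le> 1"
    unfolding proj_norm_ratio(1)[OF T xy]
    using proj_norm_ratio(2)[OF T xy] proj_action_nonexpansive[OF cone pointed nontrivial solid transverse T xy(1,2)]
    by (simp add: ennreal_le_1 divide_le_eq_1)
qed

lemma proj_norm_lipschitz:
  assumes T: "positive_op K T" and x: "x \<in> cone_section K U" and y: "y \<in> cone_section K U"
  shows "hilbert_metric K (proj_action U T x) (proj_action U T y) \<le> enn2real (proj_norm K U T) * hilbert_metric K x y"
proof (cases "x = y")
  case True
  then show ?thesis using mdist_zero proj_action_in[OF T] x by simp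
next
  case False
  have "ennreal (hilbert_metric K (proj_action U T x) (proj_action U T y) / hilbert_metric K x y) \<le> proj_norm K U T"
    unfolding proj_norm_def proj_norm_ratio(1)[OF T x y False, symmetric]
    by (rule SUP_upper2[of "(x, y)"]) (use x y False in auto)
  also have "\<dots> = ennreal (enn2real (proj_norm K U T))"
    using proj_norm_le_1[OF T] by (simp add: le_less_trans[OF _ ennreal_one_less_top])
  finally show ?thesis
    using proj_norm_ratio(2)[OF T x y False] by (simp add: ennreal_le_iff pos_divide_le_eq)
qed

text \<open>On positive operators, \<^const>\<open>proj_norm\<close> is a supremum of norm-continuous functions, hence lower
  semicontinuous; no separability is involved.\<close>

lemma proj_norm_lower_semicontinuous:
  assumes T0: "positive_op K T0" and c: "c < proj_norm K U T0"
  obtains S where "open S" "T0 \<in> S" "\<And>T. T \<in> S \<Longrightarrow> positive_op K T \<Longrightarrow> c < proj_norm K U T"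
proof -
  let ?d = "hilbert_metric K" and ?E = "cone_section K U" and ?P = "proj_action U"
  obtain x y where xy: "x \<in> ?E" "y \<in> ?E" "x \<noteq> y"
    and cr: "c < ennreal (?d (?P T0 x) (?P T0 y) / ?d x y)"
    using c unfolding proj_norm_def by (auto simp: less_SUP_iff proj_norm_ratio(1)[OF T0])
  obtain r where r: "c = ennreal r" "0 \<le> r" using cr by (cases c) auto
  have dxy: "0 < ?d x y" using proj_norm_ratio(2)[OF T0 xy] .
  have "r < ?d (?P T0 x) (?P T0 y) / ?d x y" using cr r by (simp add: ennreal_less_iff)
  then have gap: "r * ?d x y < ?d (?P T0 x) (?P T0 y)" using dxy by (simp add: pos_less_divide_eq)
  \<comment> \<open>Half the gap: the images of \<open>x\<close> and \<open>y\<close> may each move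
    by less than \<open>e\<close>, so their distance drops by less than the gap.\<close>
  define e where "e = (?d (?P T0 x) (?P T0 y) - r * ?d x y) / 2"
  have e: "0 < e" using gap by (simp add: e_def)
  have close: "\<exists>S. open S \<and> T0 \<in> S \<and> (\<forall>T\<in>S. positive_op K T \<longrightarrow> ?d (?P T z) (?P T0 z) < e)"
    if z: "z \<in> ?E" for z
  proof -
    note zi = cone_section_interior[OF z]
    obtain \<eta> where \<eta>: "0 < \<eta>" "\<And>w c c'. dist w (T0 z) < \<eta> \<Longrightarrow> 0 < c \<Longrightarrow> 0 < c' \<Longrightarrow> c *\<^sub>R w \<in> interior K \<Longrightarrow>
      c' *\<^sub>R T0 z \<in> interior K \<Longrightarrow> ?d (c *\<^sub>R w) (c' *\<^sub>R T0 z) < e"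
      using hilbert_small[OF cone pointed nontrivial positive_interior[OF T0 zi] e] by blast
    define S where "S = {T. dist (blinfun_apply T z) (T0 z) < \<eta>}"
    have "open S" unfolding S_def by (intro open_Collect_less continuous_intros)
    moreover have "?d (?P T z) (?P T0 z) < e" if T: "T \<in> S" "positive_op K T" for T
    proof -
      obtain c where "0 < c" "?P T z = c *\<^sub>R T z" using proj_action_scaleE[OF T(2) zi] .
      moreover obtain c' where "0 < c'" "?P T0 z = c' *\<^sub>R T0 z" using proj_action_scaleE[OF T0 zi] .
      ultimately show ?thesis
        using \<eta>(2)[of "T z" c c'] T cone_section_interior[OF proj_action_in[OF T(2) z]]
          cone_section_interior[OF proj_action_in[OF T0 z]] by (simp add: S_def)
    qed
    ultimately show ?thesis using \<eta>(1) by (intro exI[of _ S]) (auto simp: S_def)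
  qed
  obtain S where S: "open S" "T0 \<in> S" "\<And>T. T \<in> S \<Longrightarrow> positive_op K T \<Longrightarrow> ?d (?P T x) (?P T0 x) < e"
    using close[OF xy(1)] by blast
  obtain S' where S': "open S'" "T0 \<in> S'" "\<And>T. T \<in> S' \<Longrightarrow> positive_op K T \<Longrightarrow> ?d (?P T y) (?P T0 y) < e"
    using close[OF xy(2)] by blast
  show thesis
  proof (rule that[of "S \<inter> S'"])
    fix T assume T: "T \<in> S \<inter> S'" "positive_op K T"
    note in' = proj_action_in[OF T(2)] proj_action_in[OF T0]
    have "?d (?P T0 x) (?P T0 y) \<le> ?d (?P T0 x) (?P T x) + ?d (?P T x) (?P T y) + ?d (?P T y) (?P T0 y)"
      using triangle[of "?P T0 x" "?P T x" "?P T0 y"] triangle[of "?P T x" "?P T y" "?P T0 y"] in' xy by force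
    then have "r * ?d x y < ?d (?P T x) (?P T y)"
      using S(3)[of T] S'(3)[of T] T commute[of "?P T0 x" "?P T x"] by (simp add: e_def field_simps)
    then have "r < ?d (?P T x) (?P T y) / ?d x y" using dxy by (simp add: pos_less_divide_eq)
    then have "c < ennreal (?d (?P T x) (?P T y) / ?d x y)" using r by (simp add: ennreal_less_iff)
    also have "\<dots> \<le> proj_norm K U T"
      unfolding proj_norm_def proj_norm_ratio(1)[OF T(2) xy, symmetric]
      by (rule SUP_upper2[of "(x, y)"]) (use xy in auto)
    finally show "c < proj_norm K U T" .
  qed (use S S' in auto)
qed

text \<open>Semicontinuity is available among positive operators only. The union \<open>O'\<close>
  of the neighbourhoods is open in the full operator space, and its trace on the values of
  \<open>A\<close> is the level set. This gives measurability for the field generated by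
  \<open>A\<close> itself, as needed for the past.\<close>

lemma proj_norm_measurable:
  assumes A: "\<And>\<omega>. \<omega> \<in> \<Omega> \<Longrightarrow> positive_op K (A \<omega>)"
  shows "(\<lambda>\<omega>. proj_norm K U (A \<omega>)) \<in> borel_measurable (vimage_algebra \<Omega> A borel)"
proof (rule borel_measurableI_greater)
  fix c
  define O' where "O' = \<Union> {S. open S \<and> (\<forall>T\<in>S. positive_op K T \<longrightarrow> c < proj_norm K U T)}"
  have "open O'" by (auto simp: O'_def)
  have "c < proj_norm K U (A \<omega>) \<longleftrightarrow> A \<omega> \<in> O'" if w: "\<omega> \<in> \<Omega>" for \<omega>
  proof
    assume "c < proj_norm K U (A \<omega>)"
    then obtain S where "open S" "A \<omega> \<in> S" "\<And>T. T \<in> S \<Longrightarrow> positive_op K T \<Longrightarrow> c < proj_norm K U T"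
      by (rule proj_norm_lower_semicontinuous[OF A[OF w]]) blast
    then show "A \<omega> \<in> O'" unfolding O'_def by (intro UnionI[of S]) simp_all
  next
    assume "A \<omega> \<in> O'"
    then show "c < proj_norm K U (A \<omega>)" using A[OF w] by (auto simp: O'_def)
  qed
  then have "{\<omega> \<in> space (vimage_algebra \<Omega> A borel). c < proj_norm K U (A \<omega>)} = A -` O' \<inter> \<Omega>" by auto
  also have "\<dots> \<in> sets (vimage_algebra \<Omega> A borel)" by (rule in_vimage_algebra) (use \<open>open O'\<close> in auto)
  finally show "{\<omega> \<in> space (vimage_algebra \<Omega> A borel). c < proj_norm K U (A \<omega>)} \<in> sets (vimage_algebra \<Omega> A borel)" .
qed

end

section \<open>The stable random point\<close>

text \<open>Testing against finite rates \<open>s < I\<close> covers \<open>I = \<infinity>\<close>,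
  where the bound is \<open>- \<infinity>\<close>.\<close>

lemma limsup_exponential_rate:
  fixes \<delta> :: "nat \<Rightarrow> 'i \<Rightarrow> real"
  assumes I: "0 < I"
    and decay: "\<And>s. 0 \<le> s \<Longrightarrow> ennreal s < I \<Longrightarrow> \<forall>\<^sub>F n in sequentially. \<forall>i\<in>J. \<delta> n i \<le> exp (- s * real n)"
  shows "limsup (\<lambda>n. ereal (1 / real n) * (SUP i\<in>J. ext_ln (ennreal (\<delta> n i)))) \<le> - enn2ereal I"
proof (rule ccontr)
  let ?X = "\<lambda>n. ereal (1 / real n) * (SUP i\<in>J. ext_ln (ennreal (\<delta> n i)))"
  assume "\<not> limsup ?X \<le> - enn2ereal I"
  moreover have "- enn2ereal I < 0" using I by (simp add: less_ennreal.rep_eq zero_ennreal.rep_eq ereal_uminus_less_reorder)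
  ultimately have "- enn2ereal I < min (limsup ?X) 0" by (simp add: not_le)
  \<comment> \<open>The minimum with \<open>0\<close> makes \<open>r\<close> negative, so that
    \<open>- r\<close> is an admissible rate.\<close>
  then obtain r where r: "- enn2ereal I < ereal r" "ereal r < min (limsup ?X) 0" using ereal_dense2 by blast
  define s where "s = - r"
  have s: "0 \<le> s" using r(2) by (simp add: s_def)
  have "ereal s < enn2ereal I" using r(1) ereal_uminus_less_reorder[of "enn2ereal I" "ereal r"] by (simp add: s_def)
  then have "ennreal s < I" using s by (simp add: less_ennreal.rep_eq enn2ereal_ennreal)
  from decay[OF s this] eventually_gt_at_top[of 0] have "\<forall>\<^sub>F n in sequentially. ?X n \<le> ereal r"
  proof eventually_elim
    case (elim n)
    have "(SUP i\<in>J. ext_ln (ennreal (\<delta> n i))) \<le> ereal (r * real n)"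
    proof (rule SUP_least)
      fix i assume "i \<in> J"
      then have "ext_ln (ennreal (\<delta> n i)) \<le> ext_ln (ennreal (exp (r * real n)))"
        using elim by (intro ext_ln_mono ennreal_leI) (simp add: s_def)
      then show "ext_ln (ennreal (\<delta> n i)) \<le> ereal (r * real n)" by (simp add: ext_ln_ennreal)
    qed
    then have "?X n \<le> ereal (1 / real n) * ereal (r * real n)" by (intro ereal_mult_left_mono) auto
    then show ?case using elim by simp
  qed
  then have "limsup ?X \<le> ereal r" by (rule Limsup_bounded)
  then show False using r(2) by (simp add: not_less[symmetric])
qed

section \<open>Expectation, disintegration and the past\<close>

lemma ereal_expectation_nonpos:
  assumes "\<And>\<omega>. \<omega> \<in> space M \<Longrightarrow> Y \<omega> \<le> 0"
  shows "ereal_expectation M Y = - enn2ereal (\<integral>\<^sup>+\<omega>. e2ennreal (- Y \<omega>) \<partial>M)"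
proof -
  have "(\<integral>\<^sup>+\<omega>. e2ennreal (Y \<omega>) \<partial>M) = (\<integral>\<^sup>+\<omega>. 0 \<partial>M)"
    by (rule nn_integral_cong) (simp add: assms e2ennreal_neg)
  then show ?thesis by (simp add: ereal_expectation_def zero_ennreal.rep_eq)
qed

text \<open>The Dirac mass at \<open>u \<omega>\<close> of the section of \<open>C\<close> over
  \<open>\<omega>\<close> is \<open>1\<close> or \<open>0\<close> according to whether
  \<open>(\<omega>, u \<omega>)\<close> lies in \<open>C\<close>; integration gives the image
  measure under the graph map.\<close>

lemma dirac_disintegration_eq_distr:
  fixes K U :: "'x::real_normed_vector set"
  assumes u: "u \<in> measurable M (hilbert_borel K U)" and E: "space (hilbert_borel K U) = cone_section K U"
  shows "dirac_disintegration K U M u = distr M (M \<Otimes>\<^sub>M hilbert_borel K U) (\<lambda>\<omega>. (\<omega>, u \<omega>))"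
proof -
  let ?B = "hilbert_borel K U" let ?D = "distr M (M \<Otimes>\<^sub>M ?B) (\<lambda>\<omega>. (\<omega>, u \<omega>))"
  have g: "(\<lambda>\<omega>. (\<omega>, u \<omega>)) \<in> measurable M (M \<Otimes>\<^sub>M ?B)" using u by (intro measurable_Pair) simp_all
  have sp: "space (M \<Otimes>\<^sub>M ?B) = space M \<times> cone_section K U" by (simp add: space_pair_measure E)
  have "dirac_disintegration K U M u = measure_of (space ?D) (sets ?D) (emeasure ?D)"
    unfolding dirac_disintegration_def space_distr sets_distr sp
  proof (rule measure_of_eq)
    show "sets (M \<Otimes>\<^sub>M ?B) \<subseteq> Pow (space M \<times> cone_section K U)" using sets.space_closed[of "M \<Otimes>\<^sub>M ?B"] by (simp add: sp)
    fix C assume "C \<in> sigma_sets (space M \<times> cone_section K U) (sets (M \<Otimes>\<^sub>M ?B))"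
    then have C: "C \<in> sets (M \<Otimes>\<^sub>M ?B)" using sets.sigma_sets_eq[of "M \<Otimes>\<^sub>M ?B"] by (simp add: sp)
    have "(\<integral>\<^sup>+\<omega>. emeasure (return ?B (u \<omega>)) (Pair \<omega> -` C) \<partial>M) = (\<integral>\<^sup>+\<omega>. indicator ((\<lambda>\<omega>. (\<omega>, u \<omega>)) -` C \<inter> space M) \<omega> \<partial>M)"
      by (rule nn_integral_cong) (simp add: sets_Pair1[OF C] indicator_def)
    also have "\<dots> = emeasure ?D C"
      using measurable_sets[OF g C] by (simp add: emeasure_distr[OF g C])
    finally show "(\<integral>\<^sup>+\<omega>. emeasure (return ?B (u \<omega>)) (Pair \<omega> -` C) \<partial>M) = emeasure ?D C" .
  qed
  then show ?thesis by (simp only: measure_of_of_measure)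
qed

lemma past_sigma_space: "space (past_sigma M \<theta> A) = space M"
  unfolding past_sigma_def by (rule space_measure_of) auto

lemma past_sigma_measurable:
  assumes "1 \<le> n" "\<And>\<omega>. \<omega> \<in> space M \<Longrightarrow> \<theta> (- int n) \<omega> \<in> space M"
  shows "\<theta> (- int n) \<in> measurable (past_sigma M \<theta> A) (vimage_algebra (space M) A borel)"
proof (rule measurable_vimage_algebra2)
  show "\<theta> (- int n) \<in> space (past_sigma M \<theta> A) \<rightarrow> space M" using assms(2) by (auto simp: past_sigma_space)
  show "(\<lambda>\<omega>. A (\<theta> (- int n) \<omega>)) \<in> borel_measurable (past_sigma M \<theta> A)"
  proof (rule measurableI)
    fix S :: "('b \<Rightarrow>\<^sub>L 'b) set" assume "S \<in> sets borel"
    then show "(\<lambda>\<omega>. A (\<theta> (- int n) \<omega>)) -` S \<inter> space (past_sigma M \<theta> A) \<in> sets (past_sigma M \<theta> A)"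
      unfolding past_sigma_space unfolding past_sigma_def
      by (subst sets_measure_of) (use assms(1) in \<open>auto intro!: sigma_sets.Basic\<close>)
  qed simp
qed

lemma sets_past_sigma:
  assumes "A \<in> borel_measurable M" "\<And>n. \<theta> (- int n) \<in> measurable M M"
  shows "sets (past_sigma M \<theta> A) \<subseteq> sets M"
proof -
  have "(\<lambda>\<omega>. A (\<theta> (- int n) \<omega>)) \<in> borel_measurable M" for n
    using measurable_compose[OF assms(2,1)] .
  then show ?thesis
    unfolding past_sigma_def
    by (subst sets_measure_of) (auto intro!: sets.sigma_sets_subset measurable_sets)
qed

theorem theorem3p4:
  fixes K U :: "'x::banach set"
    and M :: "'w measure"
    and \<theta> :: "int \<Rightarrow> 'w \<Rightarrow> 'w"
    and A :: "'w \<Rightarrow> 'x \<Rightarrow>\<^sub>L 'x"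
  defines "E \<equiv> cone_section K U"
    and "d \<equiv> hilbert_dist K"
    and "\<phi> \<equiv> proj_cocycle U \<theta> A"
    and "\<rho> \<equiv> ereal_expectation M (\<lambda>\<omega>. ext_ln (proj_norm K U (A \<omega>)))"
  assumes cone: "closed_cone K" "K \<inter> uminus ` K = {0}" "interior K \<noteq> {}" "K - {0} \<noteq> {}"
    and transverse: "affine U" "intersects_transversely U K"
    and complete: "Metric_space E (hilbert_metric K)" "Metric_space.mcomplete E (hilbert_metric K)"
    and ergodic: "ergodic_ds M \<theta>"
    and random_op: "A \<in> borel_measurable M" "measurable_action K U M A"
    and positive: "\<forall>\<omega>\<in>space M. positive_op K (A \<omega>)"
    and contracting: "measure M {\<omega>\<in>space M. A \<omega> \<in> contracting_ops K U} > 0"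
  shows "\<exists>\<Omega>' u.
    \<Omega>' \<in> sets M \<and> flow_invariant \<theta> \<Omega>' \<and> measure M \<Omega>' = 1 \<and>
    u \<in> measurable M (hilbert_borel K U) \<and>
    \<comment> \<open>(i)\<close>
    (\<forall>\<omega>\<in>\<Omega>'.
       limsup (\<lambda>n. ereal (1 / real n) *
         (SUP (f, g)\<in>E \<times> E. ext_ln (e2ennreal (d (\<phi> n \<omega> f) (\<phi> n \<omega> g))))) \<le> \<rho>) \<and> \<rho> < 0 \<and>
    \<comment> \<open>(ii)\<close>
    u \<in> measurable (past_sigma M \<theta> A) (hilbert_borel K U) \<and>
    (\<forall>\<omega>\<in>\<Omega>'. \<forall>n\<ge>1. \<phi> n \<omega> (u \<omega>) = u (\<theta> (int n) \<omega>)) \<and>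
    \<comment> \<open>(iii)\<close>
    (\<forall>\<omega>\<in>\<Omega>'.
       limsup (\<lambda>n. ereal (1 / real n) *
         (SUP f\<in>E. ext_ln (e2ennreal (d (\<phi> n (\<theta> (- int n) \<omega>) f) (u \<omega>))))) \<le> \<rho> \<and>
       limsup (\<lambda>n. ereal (1 / real n) *
         (SUP f\<in>E. ext_ln (e2ennreal (d (\<phi> n \<omega> f) (u (\<theta> (int n) \<omega>)))))) \<le> \<rho>) \<and>
    \<comment> \<open>(iv)\<close>
    (\<forall>\<mu>. rds_invariant K U M \<theta> A \<mu> \<longleftrightarrow> \<mu> = dirac_disintegration K U M u)"
proof -
  let ?hm = "hilbert_metric K" and ?V = "vimage_algebra (space M) A borel" and ?F = "past_sigma M \<theta> A"
  let ?P = "\<lambda>\<omega>. proj_action U (A \<omega>)"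
  define t where "t \<omega> = enn2real (proj_norm K U (A \<omega>))" for \<omega>
  interpret hs: hilbert_section K U
    using cone transverse complete by (intro hilbert_section.intro) (simp_all add: E_def)
  interpret flow: ergodic_flow M \<theta> using ergodic by unfold_locales
  have pos: "positive_op K (A \<omega>)" if "\<omega> \<in> space M" for \<omega> using positive that by blast
  have norm_t: "proj_norm K U (A \<omega>) = ennreal (t \<omega>)" if "\<omega> \<in> space M" for \<omega>
    using hs.proj_norm_le_1[OF pos[OF that]] by (simp add: t_def le_less_trans[OF _ ennreal_one_less_top])
  have t01: "0 \<le> t \<omega>" "t \<omega> \<le> 1" if "\<omega> \<in> space M" for \<omega>
  proof -
    show "0 \<le> t \<omega>" by (simp add: t_def)
    then show "t \<omega> \<le> 1" using hs.proj_norm_le_1[OF pos[OF that]] by (simp add: norm_t[OF that] ennreal_le_1)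
  qed
  have t_V: "t \<in> borel_measurable ?V"
  proof -
    have [measurable]: "(\<lambda>\<omega>. proj_norm K U (A \<omega>)) \<in> borel_measurable ?V"
      by (rule hs.proj_norm_measurable[OF pos])
    show ?thesis unfolding t_def by measurable
  qed
  have sets_V: "sets ?V \<subseteq> sets M"
    using random_op(1) by (auto simp: sets_vimage_algebra2 measurable_sets)
  have t_M: "t \<in> borel_measurable M"
    using t_V sets_V by (auto simp: measurable_def)
  \<comment> \<open>The event \<open>\<tau>(A) < 1\<close> is covered by the countably many events
    \<open>t \<omega> \<le> 1 - 1 / Suc k\<close>, so one of them has positive probability.\<close>
  obtain q where q: "0 \<le> q" "q < 1" "0 < measure M {\<omega> \<in> space M. t \<omega> \<le> q}"
  proof -
    let ?S = "\<lambda>k. {\<omega> \<in> space M. t \<omega> \<le> 1 - 1 / real (Suc k)}"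
    have S: "range ?S \<subseteq> sets M" using t_M by (auto intro!: borel_measurable_le)
    have "{\<omega> \<in> space M. A \<omega> \<in> contracting_ops K U} \<subseteq> (\<Union>k. ?S k)"
    proof clarify
      fix \<omega> assume w: "\<omega> \<in> space M" "A \<omega> \<in> contracting_ops K U"
      then have "t \<omega> < 1" using norm_t[OF w(1)] t01[OF w(1)] by (simp add: contracting_ops_def ennreal_less_iff flip: ennreal_1)
      then obtain k :: nat where "1 / real (Suc k) < 1 - t \<omega>" using nat_approx_posE[of "1 - t \<omega>"] by auto
      then have "\<omega> \<in> ?S k" using w by simp
      then show "\<omega> \<in> (\<Union>k. ?S k)" by blast
    qed
    then have union: "0 < measure M (\<Union>k. ?S k)"
      using contracting S by (meson flow.finite_measure_mono less_le_trans sets.countable_UN)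
    have "\<exists>k. measure M (?S k) \<noteq> 0"
    proof (rule ccontr)
      assume "\<not> ?thesis"
      then have "emeasure M (\<Union>k. ?S k) = 0"
        using S by (intro emeasure_UN_eq_0) (auto simp: flow.emeasure_eq_measure)
      then show False using union by (simp add: measure_def)
    qed
    then obtain k where "0 < measure M (?S k)" by (auto simp: less_le)
    then show thesis by (intro that[of "1 - 1 / real (Suc k)"]) auto
  qed
  interpret rc: random_contraction M \<theta> "cone_section K U" ?hm ?V ?F ?P t q "ln 4 / (1 - q)"
  proof unfold_locales
    show "hs.mcomplete" using complete by (simp add: E_def)
    show "cone_section K U \<noteq> {}" by (rule hs.section_nonempty)
    show "sets ?F \<subseteq> sets M" using random_op(1) by (rule sets_past_sigma) (rule flow.flow_measurable)
    show "\<theta> (- int n) \<in> measurable ?F ?V" if "1 \<le> n" for n using that by (rule past_sigma_measurable) simp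
    show "(\<lambda>(\<omega>, x). ?P \<omega> x) \<in> measurable (?V \<Otimes>\<^sub>M sigma (cone_section K U) {W. openin hs.mtopology W})
        (sigma (cone_section K U) {W. openin hs.mtopology W})"
      using random_op(2) by (simp add: measurable_action_def hilbert_borel_def)
    show lip: "?hm (?P \<omega> x) (?P \<omega> y) \<le> t \<omega> * ?hm x y"
      if "\<omega> \<in> space M" "x \<in> cone_section K U" "y \<in> cone_section K U" for \<omega> x y
      unfolding t_def using hs.proj_norm_lipschitz[OF pos that(2,3)] that(1) .
    show "?hm (?P \<omega> x) (?P \<omega> y) \<le> ln 4 / (1 - q)"
      if "\<omega> \<in> space M" "t \<omega> \<le> q" "x \<in> cone_section K U" "y \<in> cone_section K U" for \<omega> x y
      using that q by (intro hs.finite_image_diameter[OF pos] order_trans[OF lip mult_right_mono]) auto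
  qed (use q t01 t_V sets_V in \<open>simp_all add: past_sigma_space\<close>)
  have B: "hilbert_borel K U = rc.B" by (simp add: hilbert_borel_def)
  have cocycle_positive: "positive_op K (cocycle \<theta> A n \<omega>)" if "\<omega> \<in> space M" for n \<omega>
    using that by (induction n) (auto simp: positive_op_def intro!: hs.positive_interior[OF pos])
  \<comment> \<open>The cocycle is normalised once at the end, the orbit after every step.\<close>
  have orbit: "\<phi> n \<omega> x = rc.orbit n \<omega> x" if "\<omega> \<in> space M" "x \<in> E" for n \<omega> x
    using that unfolding \<phi>_def E_def proj_cocycle_def
    by (induction n) (simp_all add: hs.proj_action_id hs.proj_action_compose[OF pos cocycle_positive])
  have dist: "e2ennreal (d x y) = ennreal (?hm x y)" if "x \<in> E" "y \<in> E" for x y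
    using that hs.cone_section_interior by (simp add: d_def E_def hs.hilbert_dist_eq e2ennreal_ereal)
  let ?I = "\<integral>\<^sup>+\<omega>. rc.rate \<omega> \<partial>M"
  \<comment> \<open>As \<open>\<tau>(A) \<le> 1\<close>, the positive part of its logarithm vanishes
    and no difference of infinities can arise.\<close>
  have rho: "\<rho> = - enn2ereal ?I"
  proof -
    have "ext_ln (proj_norm K U (A \<omega>)) \<le> 0" if "\<omega> \<in> space M" for \<omega>
      using ext_ln_mono[OF hs.proj_norm_le_1[OF pos[OF that]]] ext_ln_ennreal[of 1] by (simp add: zero_ereal_def)
    moreover have "(\<integral>\<^sup>+\<omega>. e2ennreal (- ext_ln (proj_norm K U (A \<omega>))) \<partial>M) = ?I"
      by (rule nn_integral_cong) (simp add: rc.rate_def norm_t)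
    ultimately show ?thesis unfolding \<rho>_def by (simp add: ereal_expectation_nonpos)
  qed
  have rho_neg: "\<rho> < 0" using rc.rate_integral_pos by (simp add: rho less_ennreal.rep_eq zero_ennreal.rep_eq ereal_uminus_less_reorder)
  obtain \<Omega>' where \<Omega>': "\<Omega>' \<in> sets M" "flow_invariant \<theta> \<Omega>'" "measure M \<Omega>' = 1"
    and good: "\<And>\<omega>. \<omega> \<in> \<Omega>' \<Longrightarrow> \<omega> \<in> rc.recurrent \<and> (\<forall>s\<ge>0. ennreal s < ?I \<longrightarrow>
      (\<forall>\<^sub>F n in sequentially. \<forall>x\<in>E. \<forall>y\<in>E. ?hm (rc.orbit n \<omega> x) (rc.orbit n \<omega> y) \<le> exp (- s * real n)) \<and>
      (\<forall>\<^sub>F n in sequentially. \<forall>x\<in>E. \<forall>y\<in>E.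
        ?hm (rc.orbit n (\<theta> (- int n) \<omega>) x) (rc.orbit n (\<theta> (- int n) \<omega>) y) \<le> exp (- s * real n)))"
    by (rule flow.AE_on_flow_invariant_set[OF rc.uniform_contraction[folded E_def]]) blast
  have space: "\<omega> \<in> space M" if "\<omega> \<in> \<Omega>'" for \<omega> using sets.sets_into_space[OF \<Omega>'(1)] that by blast
  have inv: "\<theta> z \<omega> \<in> \<Omega>'" if "\<omega> \<in> \<Omega>'" for z \<omega> using \<Omega>'(2) that by (auto simp: flow_invariant_def)
  let ?u = rc.pullback
  have uE: "?u \<omega> \<in> E" for \<omega> using rc.pullback_in by (simp add: E_def)
  have orbitE: "rc.orbit n \<omega> x \<in> E" if "\<omega> \<in> space M" "x \<in> E" for n \<omega> x
    using rc.orbit_in that by (simp add: E_def)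
  have equivariant: "rc.orbit n \<omega> (?u \<omega>) = ?u (\<theta> (int n) \<omega>)" if "\<omega> \<in> \<Omega>'" for n \<omega>
    using rc.pullback_equivariant good that inv by blast
  have I: "0 < ?I" by (rule rc.rate_integral_pos)
  have forward: "limsup (\<lambda>n. ereal (1 / real n) *
      (SUP (f, g)\<in>E \<times> E. ext_ln (e2ennreal (d (\<phi> n \<omega> f) (\<phi> n \<omega> g))))) \<le> \<rho>" if w: "\<omega> \<in> \<Omega>'" for \<omega>
  proof -
    have "(SUP (f, g)\<in>E \<times> E. ext_ln (e2ennreal (d (\<phi> n \<omega> f) (\<phi> n \<omega> g))))
      = (SUP z\<in>E \<times> E. ext_ln (ennreal (?hm (rc.orbit n \<omega> (fst z)) (rc.orbit n \<omega> (snd z)))))" for n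
      by (rule SUP_cong) (auto simp: orbit space[OF w] dist orbitE)
    then show ?thesis
      unfolding rho using good[OF w]
      by (simp only:) (rule limsup_exponential_rate[OF I], fastforce elim: eventually_mono)
  qed
  have backward: "limsup (\<lambda>n. ereal (1 / real n) *
      (SUP f\<in>E. ext_ln (e2ennreal (d (\<phi> n (\<theta> (- int n) \<omega>) f) (?u \<omega>))))) \<le> \<rho>" if w: "\<omega> \<in> \<Omega>'" for \<omega>
  proof -
    have "(SUP f\<in>E. ext_ln (e2ennreal (d (\<phi> n (\<theta> (- int n) \<omega>) f) (?u \<omega>))))
      = (SUP f\<in>E. ext_ln (ennreal (?hm (rc.orbit n (\<theta> (- int n) \<omega>) f) (?u \<omega>))))" for n
      by (rule SUP_cong) (auto simp: orbit space[OF w] dist orbitE uE)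
    moreover have "\<forall>\<^sub>F n in sequentially. \<forall>f\<in>E. ?hm (rc.orbit n (\<theta> (- int n) \<omega>) f) (?u \<omega>) \<le> exp (- s * real n)"
      if s: "0 \<le> s" "ennreal s < ?I" for s
    proof -
      have "\<forall>\<^sub>F n in sequentially. \<forall>x\<in>E. \<forall>y\<in>E.
        ?hm (rc.orbit n (\<theta> (- int n) \<omega>) x) (rc.orbit n (\<theta> (- int n) \<omega>) y) \<le> exp (- s * real n)"
        using good[OF w] s by blast
      then show ?thesis
      proof eventually_elim
        case (elim n)
        then show ?case using good[OF w] by (auto simp: E_def intro!: rc.pullback_distance)
      qed
    qed
    ultimately show ?thesis unfolding rho by (simp only:) (rule limsup_exponential_rate[OF I])
  qed
  have attracting: "limsup (\<lambda>n. ereal (1 / real n) *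
      (SUP f\<in>E. ext_ln (e2ennreal (d (\<phi> n \<omega> f) (?u (\<theta> (int n) \<omega>)))))) \<le> \<rho>" if w: "\<omega> \<in> \<Omega>'" for \<omega>
  proof -
    \<comment> \<open>Since \<open>?u (\<theta> (int n) \<omega>)\<close> is itself the orbit of
      \<open>?u \<omega>\<close>, attraction is forward contraction for the pair \<open>f\<close>,
      \<open>?u \<omega>\<close>.\<close>
    have "(SUP f\<in>E. ext_ln (e2ennreal (d (\<phi> n \<omega> f) (?u (\<theta> (int n) \<omega>)))))
      = (SUP f\<in>E. ext_ln (ennreal (?hm (rc.orbit n \<omega> f) (rc.orbit n \<omega> (?u \<omega>)))))" for n
      by (rule SUP_cong) (auto simp: orbit space[OF w] dist orbitE uE equivariant[OF w, symmetric])
    moreover have "\<forall>\<^sub>F n in sequentially. \<forall>f\<in>E. ?hm (rc.orbit n \<omega> f) (rc.orbit n \<omega> (?u \<omega>)) \<le> exp (- s * real n)"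
      if s: "0 \<le> s" "ennreal s < ?I" for s
    proof -
      have "\<forall>\<^sub>F n in sequentially. \<forall>x\<in>E. \<forall>y\<in>E. ?hm (rc.orbit n \<omega> x) (rc.orbit n \<omega> y) \<le> exp (- s * real n)"
        using good[OF w] s by blast
      then show ?thesis by (rule eventually_mono) (use uE in blast)
    qed
    ultimately show ?thesis unfolding rho by (simp only:) (rule limsup_exponential_rate[OF I])
  qed
  have dirac: "dirac_disintegration K U M ?u = rc.graph_measure"
    unfolding rc.graph_measure_def B[symmetric]
    by (rule dirac_disintegration_eq_distr) (simp_all add: B rc.pullback_measurable hs.space_sigma_open)
  \<comment> \<open>Agreement is needed only on \<open>space M \<times> E\<close>, the whole space
    of \<open>\<mu>\<close>.\<close>
  have skew: "distr \<mu> \<mu> (skew_product U \<theta> A n) = distr \<mu> \<mu> (rc.skew n)"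
    if "sets \<mu> = sets (M \<Otimes>\<^sub>M rc.B)" for \<mu> n
  proof (rule distr_cong)
    fix z assume "z \<in> space \<mu>"
    then show "skew_product U \<theta> A n z = rc.skew n z"
      using sets_eq_imp_space_eq[OF that] orbit[unfolded \<phi>_def E_def]
      by (auto simp: skew_product_def rc.skew_def space_pair_measure hs.space_sigma_open)
  qed simp_all
  have invariant: "rds_invariant K U M \<theta> A \<mu> \<longleftrightarrow> \<mu> = dirac_disintegration K U M ?u" for \<mu>
  proof
    assume "rds_invariant K U M \<theta> A \<mu>"
    then show "\<mu> = dirac_disintegration K U M ?u"
      unfolding dirac by (intro rc.invariant_measure_unique) (auto simp: rds_invariant_def B skew)
  next
    assume "\<mu> = dirac_disintegration K U M ?u"
    then show "rds_invariant K U M \<theta> A \<mu>"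
      unfolding dirac rds_invariant_def B
      using rc.prob_space_graph_measure rc.sets_graph_measure rc.fst_graph_measure rc.skew_graph_measure
      by (simp add: skew)
  qed
  have invariance: "\<phi> n \<omega> (?u \<omega>) = ?u (\<theta> (int n) \<omega>)" if "\<omega> \<in> \<Omega>'" for n \<omega>
    using orbit[OF space[OF that] uE] equivariant[OF that] by simp
  show ?thesis
    by (intro exI[of _ \<Omega>'] exI[of _ ?u] conjI ballI allI impI \<Omega>' forward rho_neg backward attracting
        invariant invariance rc.pullback_measurable[folded B] rc.pullback_measurable_past[folded B])
qed

end
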